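(* Let $\mathbb{S}^2 = \{(x,y,z)\in\mathbb{R}^3 \mid x^2+y^2+z^2=1\}$ be the round sphere and, for small $a>0$, let $\mathbb{S}^2_a = \mathbb{S}^2\setminus\{(x,y,z)\in\mathbb{S}^2 \mid xy=0,\ 1-z\le a\}$ be the sphere with a crack in the form of a cross centered at the north pole $(0,0,1)$. For all sufficiently small $a>0$, the Extended Courant Property for $\mathbb{S}^2_a$, with the Neumann condition on the crack, is false; that is, there exist an integer $m\ge 1$ and a linear combination $v$ of eigenfunctions of $-\Delta$ in $\mathbb{S}^2_a$ (with the Neumann condition on the crack) associated with eigenvalues less than or equal to $\lambda_m$ such that $\beta_0(v)>\kappa(\lambda_m)$.
   Context: Here $\Delta$ is the Laplace–Beltrami operator of the round metric. The realization of $-\Delta$ in $\mathbb{S}^2_a$ is the self-adjoint operator with the Neumann condition on (both sides of) the crack, i.e. the operator associated with the quadratic form $\int_{\mathbb{S}^2_a}|\nabla u|^2$ on $H^1(\mathbb{S}^2_a)$. Its eigenvalues are listed in nondecreasing order, counted with multiplicity and starting with index $1$: $\lambda_1 < \lambda_2 \le \lambda_3 \le \cdots$. For an eigenvalue $\lambda$, set $\kappa(\lambda) = \min\{k \mid \lambda_k = \lambda\}$. For a real continuous function $v$ on $\Omega=\mathbb{S}^2_a$, the nodal set is $\mathcal{Z}(v) = \overline{\{p \in \Omega \mid v(p) = 0\}}$, and $\beta_0(v)$ denotes the number of connected components of $\Omega \setminus \mathcal{Z}(v)$ (nodal domains). The Extended Courant Property for $\Omega$ with the given boundary conditions is the assertion: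 for every $m \ge 1$ and every real linear combination $v$ of real eigenfunctions associated with eigenvalues $\le \lambda_m$, one has $\beta_0(v) \le \kappa(\lambda_m) \le m$. *)

theory Defs
  imports "HOL-Analysis.Analysis" "HOL-Library.Extended_Nat"
begin

section \<open>The sphere with a cross-shaped crack\<close>

definition cracked_sphere :: "real \<Rightarrow> (real^3) set" where
  "cracked_sphere a =
     sphere 0 1 - {p \<in> sphere 0 1. p$1 * p$2 = 0 \<and> 1 - p$3 \<le> a}"

text \<open>
  The round area measure, as the cone measure: the area of \<open>A\<close> is three times the
  volume of \<open>{t *\<^sub>R p | p \<in> A, 0 < t < 1}\<close>. It is a measure on the Borel sets of
  the ambient space, concentrated on the unit sphere, of total mass \<open>4 * pi\<close>.
\<close>

definition sphere_measure :: "(real^3) measure" where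
  "sphere_measure =
     distr (density lborel (\<lambda>x. 3 * indicator (ball 0 1) x)) borel (\<lambda>x. x /\<^sub>R norm x)"

definition area :: "(real^3) set \<Rightarrow> (real^3) measure" where
  "area \<Omega> = restrict_space sphere_measure \<Omega>"


section \<open>The Sobolev space and the Neumann Laplacian\<close>

text \<open>
  In this section \<open>\<Omega>\<close> is meant to be a relatively open subset of the unit sphere. Only
  the values on \<open>\<Omega>\<close> of a function matter, and functions that agree almost everywhere on
  \<open>\<Omega>\<close> are interchangeable; no quotient is formed.
\<close>

primrec Ck :: "nat \<Rightarrow> (real^3 \<Rightarrow> real^3) \<Rightarrow> bool" where
  "Ck 0 X \<longleftrightarrow> continuous_on UNIV X"
| "Ck (Suc k) X \<longleftrightarrow> (\<forall>x. X differentiable at x) \<and>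
     (\<forall>h. Ck k (\<lambda>x. frechet_derivative X (at x) h))"

text \<open>
  Smooth tangential vector fields with compact support in \<open>\<Omega>\<close>. Every such field on the
  sphere is the restriction of a smooth field on the ambient space.
\<close>

definition test_field :: "(real^3) set \<Rightarrow> (real^3 \<Rightarrow> real^3) \<Rightarrow> bool" where
  "test_field \<Omega> X \<longleftrightarrow> (\<forall>k. Ck k X) \<and> (\<forall>p \<in> sphere 0 1. X p \<bullet> p = 0) \<and>
     (\<exists>K. compact K \<and> K \<subseteq> \<Omega> \<and> (\<forall>p \<in> sphere 0 1 - K. X p = 0))"

text \<open>
  The divergence on the sphere: the trace of the derivative over the tangent plane at \<open>p\<close>,
  that is, the full trace minus the contribution of the unit normal, which is \<open>p\<close>.
\<close>

definition sphere_div :: "(real^3 \<Rightarrow> real^3) \<Rightarrow> real^3 \<Rightarrow> real" where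
  "sphere_div X p =
     (\<Sum>i\<in>Basis. frechet_derivative X (at p) i \<bullet> i) - frechet_derivative X (at p) p \<bullet> p"

definition L2 :: "(real^3) set \<Rightarrow> (real^3 \<Rightarrow> 'b::euclidean_space) \<Rightarrow> bool" where
  "L2 \<Omega> f \<longleftrightarrow> f \<in> borel_measurable (area \<Omega>) \<and> integrable (area \<Omega>) (\<lambda>p. (norm (f p))\<^sup>2)"

text \<open>\<open>G\<close> is a square integrable tangential field that is the distributional gradient of \<open>u\<close>.\<close>

definition weak_gradient ::
  "(real^3) set \<Rightarrow> (real^3 \<Rightarrow> real) \<Rightarrow> (real^3 \<Rightarrow> real^3) \<Rightarrow> bool" where
  "weak_gradient \<Omega> u G \<longleftrightarrow> L2 \<Omega> G \<and> (\<forall>p\<in>\<Omega>. G p \<bullet> p = 0) \<and>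
     (\<forall>X. test_field \<Omega> X \<longrightarrow>
        (\<integral>p. u p * sphere_div X p \<partial>area \<Omega>) = - (\<integral>p. G p \<bullet> X p \<partial>area \<Omega>))"

definition H1 :: "(real^3) set \<Rightarrow> (real^3 \<Rightarrow> real) \<Rightarrow> bool" where
  "H1 \<Omega> u \<longleftrightarrow> L2 \<Omega> u \<and> (\<exists>G. weak_gradient \<Omega> u G)"

text \<open>The weak gradient is unique almost everywhere, so the choice below is harmless.\<close>

definition grad :: "(real^3) set \<Rightarrow> (real^3 \<Rightarrow> real) \<Rightarrow> real^3 \<Rightarrow> real^3" where
  "grad \<Omega> u = (SOME G. weak_gradient \<Omega> u G)"

definition dirichlet_form :: "(real^3) set \<Rightarrow> (real^3 \<Rightarrow> real) \<Rightarrow> (real^3 \<Rightarrow> real) \<Rightarrow> real" where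
  "dirichlet_form \<Omega> u w = (\<integral>p. grad \<Omega> u p \<bullet> grad \<Omega> w p \<partial>area \<Omega>)"

text \<open>
  The graph of the self-adjoint operator associated with the Dirichlet form on \<open>H1 \<Omega>\<close>:
  \<open>u\<close> lies in the domain and is mapped to \<open>f\<close>. Since all of \<open>H1 \<Omega>\<close> is used for testing,
  the Neumann condition on both sides of the crack is built in.
\<close>

definition neumann_laplacian ::
  "(real^3) set \<Rightarrow> (real^3 \<Rightarrow> real) \<Rightarrow> (real^3 \<Rightarrow> real) \<Rightarrow> bool" where
  "neumann_laplacian \<Omega> u f \<longleftrightarrow> H1 \<Omega> u \<and> L2 \<Omega> f \<and>
     (\<forall>w. H1 \<Omega> w \<longrightarrow> dirichlet_form \<Omega> u w = (\<integral>p. f p * w p \<partial>area \<Omega>))"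

definition eigenfunction :: "(real^3) set \<Rightarrow> real \<Rightarrow> (real^3 \<Rightarrow> real) \<Rightarrow> bool" where
  "eigenfunction \<Omega> \<mu> u \<longleftrightarrow>
     neumann_laplacian \<Omega> u (\<lambda>p. \<mu> * u p) \<and> \<not> (AE p in area \<Omega>. u p = 0)"


section \<open>The list of eigenvalues\<close>

definition independent_ae :: "(real^3) set \<Rightarrow> nat \<Rightarrow> (nat \<Rightarrow> real^3 \<Rightarrow> real) \<Rightarrow> bool" where
  "independent_ae \<Omega> n u \<longleftrightarrow>
     (\<forall>c :: nat \<Rightarrow> real. (AE p in area \<Omega>. (\<Sum>i<n. c i * u i p) = 0) \<longrightarrow> (\<forall>i<n. c i = 0))"

text \<open>
  The dimension (in the space of square integrable functions modulo null functions) of the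
  span of all eigenfunctions with eigenvalue in \<open>S\<close>, that is, the number of eigenvalues in
  \<open>S\<close> counted with multiplicity.
\<close>

definition eigenvalue_count :: "(real^3) set \<Rightarrow> real set \<Rightarrow> enat" where
  "eigenvalue_count \<Omega> S =
     (SUP n \<in> {n. \<exists>u \<nu>. (\<forall>i<n. \<nu> i \<in> S \<and> eigenfunction \<Omega> (\<nu> i) (u i)) \<and> independent_ae \<Omega> n u}.
        enat n)"

text \<open>
  The \<open>k\<close>-th eigenvalue, \<open>k \<ge> 1\<close>, in the nondecreasing list with multiplicities: the value
  that occupies the positions \<open>k\<close> with \<open>N (< \<mu>) < k \<le> N (\<le> \<mu>)\<close>, where \<open>N\<close> is the count
  above. At most one \<open>\<mu>\<close> qualifies, and it is an eigenvalue.
\<close>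

definition nth_eigenvalue :: "(real^3) set \<Rightarrow> nat \<Rightarrow> real" where
  "nth_eigenvalue \<Omega> k =
     (THE \<mu>. eigenvalue_count \<Omega> {..<\<mu>} < enat k \<and> enat k \<le> eigenvalue_count \<Omega> {..\<mu>})"

definition kappa :: "(real^3) set \<Rightarrow> real \<Rightarrow> nat" where
  "kappa \<Omega> \<mu> = (LEAST k. 1 \<le> k \<and> nth_eigenvalue \<Omega> k = \<mu>)"


section \<open>Nodal domains and the Extended Courant Property\<close>

definition nodal_set :: "(real^3) set \<Rightarrow> (real^3 \<Rightarrow> real) \<Rightarrow> (real^3) set" where
  "nodal_set \<Omega> v = closure {p \<in> \<Omega>. v p = 0}"

definition beta0 :: "(real^3) set \<Rightarrow> (real^3 \<Rightarrow> real) \<Rightarrow> enat" where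
  "beta0 \<Omega> v = (let C = components (\<Omega> - nodal_set \<Omega> v) in
     if finite C then enat (card C) else \<infinity>)"

text \<open>
  Real linear combinations of eigenfunctions with eigenvalues at most \<open>L\<close>. Eigenfunctions
  were defined up to null sets, so the continuous representative of the combination is
  selected here; by elliptic regularity it exists, and it is unique on \<open>\<Omega>\<close>.
\<close>

definition eigen_combination :: "(real^3) set \<Rightarrow> real \<Rightarrow> (real^3 \<Rightarrow> real) \<Rightarrow> bool" where
  "eigen_combination \<Omega> L v \<longleftrightarrow> continuous_on \<Omega> v \<and>
     (\<exists>n (c :: nat \<Rightarrow> real) u \<nu>. (\<forall>i<n. \<nu> i \<le> L \<and> eigenfunction \<Omega> (\<nu> i) (u i)) \<and>
        (\<forall>p\<in>\<Omega>. v p = (\<Sum>i<n. c i * u i p)))"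

definition extended_courant_property :: "(real^3) set \<Rightarrow> bool" where
  "extended_courant_property \<Omega> \<longleftrightarrow>
     (\<forall>m\<ge>1. \<forall>v. eigen_combination \<Omega> (nth_eigenvalue \<Omega> m) v \<longrightarrow>
        beta0 \<Omega> v \<le> enat (kappa \<Omega> (nth_eigenvalue \<Omega> m)) \<and> kappa \<Omega> (nth_eigenvalue \<Omega> m) \<le> m)"

end

theory Submission
  imports Defs
begin

text \<open>
  The function that violates the property is \<open>z - (1 - a / 2)\<close>, where \<open>z\<close> is the third
  coordinate. It combines \<open>z\<close> with the constant \<open>1\<close>, and both are Neumann eigenfunctions of the
  cracked sphere for every \<open>a\<close>, with eigenvalues \<open>2\<close> and \<open>0\<close>: the gradient of \<open>z\<close> is tangent to
  the planes \<open>x = 0\<close> and \<open>y = 0\<close> that contain the crack, so that the Neumann condition holds. The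
  zero circle runs at half the height of the cross. Hence the cap above it is cut by the cross into
  four sectors, and together with the region below there are at least five nodal domains
  (\<open>five_nodal_domains\<close>). It remains to see that \<open>2\<close> has a position at most \<open>4\<close> in the list of
  eigenvalues, which means that for small \<open>a\<close> at most three independent eigenfunctions have an
  eigenvalue below \<open>2\<close> (\<open>few_small_eigenvalues\<close>).

  Three is the number of linear conditions on \<open>w\<close> that force the energy of \<open>w\<close> to be at least twice
  its square norm (\<open>spectral_gap\<close>). Split \<open>w\<close> by its parities under the reflections of \<open>x\<close> and of
  \<open>y\<close>; the four parts are orthogonal, also in energy. A part that is even or odd in each of the two
  becomes even in both after multiplication by a product of the signs of \<open>x\<close> and \<open>y\<close>, and neither
  its norm nor its energy changes. A function that is even in \<open>x\<close> and \<open>y\<close> does not jump across the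
  crack, so it is weakly differentiable on the whole sphere, where the first nonzero eigenvalue is
  \<open>2\<close> (\<open>even_Poincare\<close>); the condition is that its mean vanishes. This costs one condition in each
  of three parity classes. The part that is odd in both variables needs none: on a circle of
  latitude below the crack it is a combination of \<open>sin (2 k \<phi>)\<close> with \<open>k \<ge> 1\<close>, so its angular
  derivative alone gives the factor \<open>4\<close> there (\<open>latitude_inequality\<close>), and what it can carry in the
  small cap is bounded by a Poincare inequality (\<open>cap_estimate\<close>). For a small cap the two bounds
  leave the factor \<open>2\<close> (\<open>odd_odd_bound\<close>).

  Functions in the Sobolev space are known only through integrals against test fields, and all
  inequalities are therefore proved by duality, with explicit smooth fields in place of traces, of
  chain rules and of regularity theory. Two facts make this work. A smooth tangential field whose
  component across each plane vanishes to first order on that plane may be used for testing although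
  its support crosses the crack, and even after multiplication by the signs of \<open>x\<close> and \<open>y\<close>
  (\<open>weak_pair_cutoff\<close>). And the gradients of the polynomials that are even in \<open>x\<close> and \<open>y\<close> are such
  fields; these polynomials are sums of spherical harmonics (\<open>spectral_sum_monomial\<close>) and dense in
  the square integrable functions of that parity (\<open>parity_approx\<close>).
\<close>

section \<open>Smooth functions and fields\<close>

text \<open>
  Derivatives of \<open>exp (- 1 / t)\<close> are combinations of these functions, which is why the power of
  \<open>t\<close> is part of the family.
\<close>

definition flat :: "nat \<Rightarrow> real \<Rightarrow> real" where
  "flat k t = (if 0 < t then exp (- (1 / t)) / t ^ k else 0)"

text \<open>
  At \<open>0\<close> the difference quotient is again of this form, and the exponential beats every power.
\<close>

lemma flat_has_derivative:
  "(flat k has_real_derivative flat (k + 2) t - real k * flat (Suc k) t) (at t)"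
proof -
  consider "t > 0" | "t < 0" | "t = 0" by linarith
  then show ?thesis
  proof cases
    case 1
    have "((\<lambda>t. exp (- (1 / t)) / t ^ k) has_real_derivative
        flat (k + 2) t - real k * flat (Suc k) t) (at t)"
    proof (cases k)
      case 0
      then show ?thesis
        using 1 by (auto intro!: derivative_eq_intros simp: flat_def field_simps power2_eq_square)
    next
      case (Suc n)
      then show ?thesis
        using 1
        by (auto intro!: derivative_eq_intros simp: flat_def field_simps power2_eq_square)
          (metis One_nat_def power_eq_if)
    qed
    then show ?thesis
      by (rule has_field_derivative_transform_within_open[where S = "{0<..}"])
        (use 1 in \<open>auto simp: flat_def\<close>)
  next
    case 2
    have "((\<lambda>t. 0) has_real_derivative flat (k + 2) t - real k * flat (Suc k) t) (at t)"
      using 2 by (auto simp: flat_def)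
    then show ?thesis
      by (rule has_field_derivative_transform_within_open[where S = "{..<0}"])
        (use 2 in \<open>auto simp: flat_def\<close>)
  next
    case 3
    have "((\<lambda>h. flat k h / h) \<longlongrightarrow> 0) (at_right 0)"
    proof (rule Lim_transform_eventually)
      have "((\<lambda>u::real. u ^ Suc k / exp u) \<longlongrightarrow> 0) at_top"
        by (rule tendsto_power_div_exp_0)
      then show "((\<lambda>h::real. inverse h ^ Suc k / exp (inverse h)) \<longlongrightarrow> 0) (at_right 0)"
        by (rule filterlim_compose) (rule filterlim_inverse_at_top_right)
      show "\<forall>\<^sub>F h in at_right (0::real). inverse h ^ Suc k / exp (inverse h) = flat k h / h"
        by (rule eventually_mono[OF eventually_at_right_less])
          (auto simp: flat_def exp_minus field_simps)
    qed
    moreover have "((\<lambda>h. flat k h / h) \<longlongrightarrow> 0) (at_left 0)"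
      by (rule Lim_transform_eventually[of "\<lambda>_. 0"])
        (auto simp: flat_def eventually_at_left_field intro!: exI[of _ "-1"])
    ultimately have "((\<lambda>h. flat k h / h) \<longlongrightarrow> 0) (at 0)"
      by (simp add: filterlim_at_split)
    then show ?thesis
      using 3 by (simp add: has_field_derivative_iff flat_def)
  qed
qed

text \<open>
  An inductive class that is closed under differentiation by construction. It contains the
  polynomials and enough cutoff functions, and it makes differentiability of every order
  (\<open>smooth_field_Ck\<close>) a short induction.
\<close>

inductive smooth :: "(real^3 \<Rightarrow> real) \<Rightarrow> bool" where
  smooth_const: "smooth (\<lambda>_. c)"
| smooth_coord: "smooth (\<lambda>p. p $ i)"
| smooth_flat: "smooth (\<lambda>p. flat k (c * p $ i + d))"
| smooth_add: "smooth f \<Longrightarrow> smooth g \<Longrightarrow> smooth (\<lambda>p. f p + g p)"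
| smooth_mult: "smooth f \<Longrightarrow> smooth g \<Longrightarrow> smooth (\<lambda>p. f p * g p)"

definition has_grad :: "(real^3 \<Rightarrow> real) \<Rightarrow> (real^3 \<Rightarrow> real^3) \<Rightarrow> bool" where
  "has_grad f g \<longleftrightarrow> (\<forall>p. (f has_derivative (\<lambda>v. g p \<bullet> v)) (at p))"

definition smooth_field :: "(real^3 \<Rightarrow> real^3) \<Rightarrow> bool" where
  "smooth_field X \<longleftrightarrow> (\<forall>i. smooth (\<lambda>p. X p $ i))"

lemma smooth_neg: "smooth f \<Longrightarrow> smooth (\<lambda>p. - f p)"
  using smooth_mult[OF smooth_const[of "-1"], of f] by simp

lemma smooth_diff: "smooth f \<Longrightarrow> smooth g \<Longrightarrow> smooth (\<lambda>p. f p - g p)"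
  using smooth_add[OF _ smooth_neg, of f g] by simp

lemma smooth_power: "smooth f \<Longrightarrow> smooth (\<lambda>p. f p ^ n)"
  by (induction n) (auto intro: smooth_const smooth_mult)

lemma smooth_sum: "(\<And>i. i \<in> I \<Longrightarrow> smooth (f i)) \<Longrightarrow> smooth (\<lambda>p. \<Sum>i\<in>I. f i p)"
  by (induction I rule: infinite_finite_induct) (auto intro: smooth_const smooth_add)

lemmas smooth_intros = smooth_const smooth_coord smooth_flat smooth_add smooth_mult smooth_neg
  smooth_diff smooth_power smooth_sum

lemma smooth_inner: "smooth_field X \<Longrightarrow> smooth_field Y \<Longrightarrow> smooth (\<lambda>p. X p \<bullet> Y p)"
  unfolding inner_vec_def smooth_field_def by (simp add: smooth_intros)

lemma smooth_field_scaleR: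
  "smooth f \<Longrightarrow> smooth_field X \<Longrightarrow> smooth_field (\<lambda>p. f p *\<^sub>R X p)"
  by (auto simp: smooth_field_def intro: smooth_mult)

lemma smooth_field_add:
  "smooth_field X \<Longrightarrow> smooth_field Y \<Longrightarrow> smooth_field (\<lambda>p. X p + Y p)"
  by (auto simp: smooth_field_def intro: smooth_add)

lemma smooth_field_diff:
  "smooth_field X \<Longrightarrow> smooth_field Y \<Longrightarrow> smooth_field (\<lambda>p. X p - Y p)"
  by (auto simp: smooth_field_def intro: smooth_diff)

lemma smooth_field_id: "smooth_field (\<lambda>p. p)"
  by (auto simp: smooth_field_def intro: smooth_coord)

lemma smooth_field_const: "smooth_field (\<lambda>p. c)"
  by (auto simp: smooth_field_def intro: smooth_const)

lemma has_grad_const: "has_grad (\<lambda>_. c) (\<lambda>_. 0)"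
  by (auto simp: has_grad_def)

lemma has_grad_coord: "has_grad (\<lambda>p. p $ i) (\<lambda>_. axis i 1)"
proof -
  have "(\<lambda>v. axis i 1 \<bullet> v) = (\<lambda>v::real^3. v $ i)"
    by (simp add: inner_axis' fun_eq_iff)
  then show ?thesis
    unfolding has_grad_def using bounded_linear_imp_has_derivative[OF bounded_linear_vec_nth] by metis
qed

lemma has_grad_add:
  "has_grad f g \<Longrightarrow> has_grad f' g' \<Longrightarrow> has_grad (\<lambda>p. f p + f' p) (\<lambda>p. g p + g' p)"
  by (auto simp: has_grad_def inner_add_left intro: has_derivative_add)

lemma has_grad_mult:
  "has_grad f g \<Longrightarrow> has_grad f' g' \<Longrightarrow>
    has_grad (\<lambda>p. f p * f' p) (\<lambda>p. f p *\<^sub>R g' p + f' p *\<^sub>R g p)"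
  unfolding has_grad_def
  by (auto intro!: derivative_eq_intros simp: inner_add_left algebra_simps)

lemma has_grad_comp:
  assumes "has_grad f g" "\<And>t. (h has_real_derivative h' t) (at t)"
  shows "has_grad (\<lambda>p. h (f p)) (\<lambda>p. h' (f p) *\<^sub>R g p)"
  unfolding has_grad_def
proof
  fix p
  have "(h has_derivative (*) (h' (f p))) (at (f p))"
    using assms(2) by (simp add: has_field_derivative_def)
  moreover have "(f has_derivative (\<lambda>v. g p \<bullet> v)) (at p)"
    using assms(1) by (simp add: has_grad_def)
  ultimately have "(h \<circ> f has_derivative (*) (h' (f p)) \<circ> (\<lambda>v. g p \<bullet> v)) (at p)"
    by (rule diff_chain_at[rotated])
  then show "((\<lambda>p. h (f p)) has_derivative (\<lambda>v. (h' (f p) *\<^sub>R g p) \<bullet> v)) (at p)"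
    by (simp add: o_def)
qed

lemma has_grad_scale: "has_grad f g \<Longrightarrow> has_grad (\<lambda>p. c * f p) (\<lambda>p. c *\<^sub>R g p)"
  using has_grad_mult[OF has_grad_const[of c]] by simp

lemma has_grad_flat:
  "has_grad (\<lambda>p. flat k (c * p $ i + d))
    (\<lambda>p. (flat (k + 2) (c * p $ i + d) - real k * flat (Suc k) (c * p $ i + d)) *\<^sub>R (c *\<^sub>R axis i 1))"
proof -
  have "has_grad (\<lambda>p. c * p $ i + d) (\<lambda>p. c *\<^sub>R axis i 1)"
    using has_grad_add[OF has_grad_scale[OF has_grad_coord[of i], of c] has_grad_const[of d]] by simp
  from has_grad_comp[OF this flat_has_derivative] show ?thesis by simp
qed

text \<open>
  Closure of the class under differentiation.
\<close>

lemma smooth_has_grad: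
  assumes "smooth f"
  obtains g where "has_grad f g" "smooth_field g"
proof -
  have "\<exists>g. has_grad f g \<and> smooth_field g" using assms
  proof induction
    case (smooth_const c)
    then show ?case using has_grad_const smooth_field_const by blast
  next
    case (smooth_coord i)
    then show ?case using has_grad_coord smooth_field_const by blast
  next
    case (smooth_flat k c i d)
    have "smooth_field (\<lambda>p. (flat (k + 2) (c * p $ i + d) - real k * flat (Suc k) (c * p $ i + d)) *\<^sub>R
        (c *\<^sub>R axis i (1::real)))"
      by (intro smooth_field_scaleR smooth_field_const smooth_intros)
    then show ?case using has_grad_flat by blast
  next
    case (smooth_add f g)
    then show ?case using has_grad_add smooth_field_add by metis
  next
    case (smooth_mult f g)
    then obtain f' g' where "has_grad f f'" "smooth_field f'" "has_grad g g'" "smooth_field g'"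
      by blast
    then have "has_grad (\<lambda>p. f p * g p) (\<lambda>p. f p *\<^sub>R g' p + g p *\<^sub>R f' p)"
      "smooth_field (\<lambda>p. f p *\<^sub>R g' p + g p *\<^sub>R f' p)"
      using smooth_mult by (auto intro: has_grad_mult smooth_field_add smooth_field_scaleR)
    then show ?case by blast
  qed
  then show thesis using that by blast
qed

lemma has_grad_continuous: "has_grad f g \<Longrightarrow> continuous_on S f"
  unfolding has_grad_def
  by (meson continuous_at_imp_continuous_on has_derivative_continuous)

lemma smooth_continuous: "smooth f \<Longrightarrow> continuous_on S f"
  using smooth_has_grad has_grad_continuous by metis

lemma smooth_field_continuous: "smooth_field X \<Longrightarrow> continuous_on S X"
  unfolding smooth_field_def
  using continuous_on_vec_lambda[of S "\<lambda>i p. X p $ i"] by (auto intro: smooth_continuous)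

lemma has_grad_field:
  assumes "\<And>i. has_grad (\<lambda>p. X p $ i) (Y i)"
  shows "(X has_derivative (\<lambda>v. \<chi> i. Y i p \<bullet> v)) (at p)"
proof -
  have "((\<lambda>p. X p \<bullet> b) has_derivative (\<lambda>v. (\<chi> i. Y i p \<bullet> v) \<bullet> b)) (at p)" if "b \<in> Basis" for b
  proof -
    obtain i where "b = axis i 1" using \<open>b \<in> Basis\<close> unfolding Basis_vec_def by auto
    then show ?thesis using assms[of i] by (simp add: has_grad_def inner_axis)
  qed
  then show ?thesis by (subst has_derivative_componentwise_within) auto
qed

lemma smooth_field_derivative:
  assumes "smooth_field X"
  obtains Y where "\<And>i. has_grad (\<lambda>p. X p $ i) (Y i)" "\<And>i. smooth_field (Y i)"
    "\<And>p v. frechet_derivative X (at p) v = (\<chi> i. Y i p \<bullet> v)"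
proof -
  have "\<exists>g. has_grad (\<lambda>p. X p $ i) g \<and> smooth_field g" for i
    using assms smooth_has_grad unfolding smooth_field_def by metis
  then obtain Y where Y: "\<And>i. has_grad (\<lambda>p. X p $ i) (Y i)" "\<And>i. smooth_field (Y i)"
    by metis
  have "frechet_derivative X (at p) v = (\<chi> i. Y i p \<bullet> v)" for p v
    using fun_cong[OF frechet_derivative_at[OF has_grad_field[OF Y(1), of p]], of v] by simp
  with Y show thesis using that by blast
qed

lemma smooth_field_differentiable: "smooth_field X \<Longrightarrow> X differentiable (at p)"
  using smooth_field_derivative has_grad_field by (metis differentiableI)

lemma smooth_field_Ck: "smooth_field X \<Longrightarrow> Ck k X"
proof (induction k arbitrary: X)
  case 0
  then show ?case by (simp add: smooth_field_continuous)
next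
  case (Suc k)
  from Suc.prems obtain Y where Y: "\<And>i. smooth_field (Y i)"
    "\<And>p v. frechet_derivative X (at p) v = (\<chi> i. Y i p \<bullet> v)"
    using smooth_field_derivative by metis
  have "smooth_field (\<lambda>p. frechet_derivative X (at p) h)" for h
    unfolding smooth_field_def Y(2) using smooth_inner[OF Y(1) smooth_field_const] by simp
  then show ?case using Suc smooth_field_differentiable by auto
qed

text \<open>
  The product rule. The last term corrects for the radial part of the gradient of \<open>f\<close>, since
  the divergence is the trace over the tangent plane only; it vanishes for tangential \<open>X\<close>.
\<close>

lemma sphere_div_scaleR:
  assumes "has_grad f g" "X differentiable (at p)"
  shows "sphere_div (\<lambda>p. f p *\<^sub>R X p) p =
    f p * sphere_div X p + g p \<bullet> X p - (g p \<bullet> p) * (X p \<bullet> p)"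
proof -
  have "((\<lambda>p. f p *\<^sub>R X p) has_derivative
      (\<lambda>v. f p *\<^sub>R frechet_derivative X (at p) v + (g p \<bullet> v) *\<^sub>R X p)) (at p)"
    using assms unfolding has_grad_def frechet_derivative_works
    by (intro has_derivative_scaleR) auto
  then have *: "frechet_derivative (\<lambda>p. f p *\<^sub>R X p) (at p) =
      (\<lambda>v. f p *\<^sub>R frechet_derivative X (at p) v + (g p \<bullet> v) *\<^sub>R X p)"
    by (rule frechet_derivative_at[symmetric])
  show ?thesis
    unfolding sphere_div_def *
    by (simp add: inner_add_left sum.distrib sum_distrib_left[symmetric] algebra_simps
        euclidean_inner[of "g p" "X p"])
qed

lemma sphere_div_add:
  assumes "X differentiable (at p)" "Y differentiable (at p)"
  shows "sphere_div (\<lambda>p. X p + Y p) p = sphere_div X p + sphere_div Y p"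
proof -
  have "((\<lambda>p. X p + Y p) has_derivative
      (\<lambda>v. frechet_derivative X (at p) v + frechet_derivative Y (at p) v)) (at p)"
    using assms unfolding frechet_derivative_works by (intro has_derivative_add) auto
  then have *: "frechet_derivative (\<lambda>p. X p + Y p) (at p) =
      (\<lambda>v. frechet_derivative X (at p) v + frechet_derivative Y (at p) v)"
    by (rule frechet_derivative_at[symmetric])
  show ?thesis
    unfolding sphere_div_def * by (simp add: inner_add_left sum.distrib)
qed

lemma sphere_div_cmult:
  assumes "X differentiable (at p)"
  shows "sphere_div (\<lambda>p. c *\<^sub>R X p) p = c * sphere_div X p"
  using sphere_div_scaleR[OF has_grad_const assms, of c] by simp

lemma sphere_div_components:
  assumes "\<And>i. has_grad (\<lambda>p. X p $ i) (Y i)"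
  shows "sphere_div X p = (\<Sum>i\<in>UNIV. Y i p $ i) - (\<Sum>i\<in>UNIV. (Y i p \<bullet> p) * p $ i)"
proof -
  have "frechet_derivative X (at p) = (\<lambda>v. \<chi> i. Y i p \<bullet> v)"
    by (rule frechet_derivative_at[symmetric, OF has_grad_field[OF assms]])
  moreover have "(\<Sum>i\<in>Basis. F i) = (\<Sum>i\<in>UNIV. F (axis i 1))" for F :: "real^3 \<Rightarrow> real"
  proof -
    have "Basis = range (\<lambda>i. axis i (1::real) :: real^3)" by (auto simp: Basis_vec_def)
    show ?thesis unfolding \<open>Basis = _\<close> by (subst sum.reindex) (auto simp: inj_on_def axis_eq_axis)
  qed
  ultimately show ?thesis
    by (simp add: sphere_div_def inner_axis) (simp add: inner_vec_def)
qed

section \<open>The area measure and square integrable functions\<close>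

abbreviation sphere_integral :: "(real^3 \<Rightarrow> 'b::{banach, second_countable_topology}) \<Rightarrow> 'b"
    (binder "\<integral>\<^sub>S" 10) where
  "sphere_integral f \<equiv> integral\<^sup>L sphere_measure f"

lemma space_sphere_measure [simp]: "space sphere_measure = UNIV"
  by (simp add: sphere_measure_def)

lemma sets_sphere_measure [simp, measurable_cong]: "sets sphere_measure = sets borel"
  by (simp add: sphere_measure_def)

lemma measurable_normalise [measurable]: "(\<lambda>x::real^3. x /\<^sub>R norm x) \<in> borel_measurable borel"
  by measurable

lemma ball_measurable [measurable]: "ball (0::real^3) 1 \<in> sets borel"
  by simp

interpretation sphere: finite_measure sphere_measure
proof
  have "emeasure sphere_measure UNIV = (\<integral>\<^sup>+x. 3 * indicator (ball (0::real^3) 1) x \<partial>lborel)"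
    by (simp add: sphere_measure_def emeasure_distr emeasure_density)
  also have "\<dots> = 3 * emeasure lborel (ball (0::real^3) 1)"
    by (subst nn_integral_cmult_indicator) auto
  also have "\<dots> < \<infinity>"
    using emeasure_bounded_finite[of "ball (0::real^3) 1"] by (simp add: ennreal_mult_less_top)
  finally show "emeasure sphere_measure (space sphere_measure) \<noteq> \<infinity>" by simp
qed

lemma AE_sphere_measureI:
  assumes "AE x in lborel. P (x /\<^sub>R norm x)" "{x. P x} \<in> sets borel"
  shows "AE p in sphere_measure. P p"
proof -
  have "AE x in density lborel (\<lambda>x. 3 * indicator (ball (0::real^3) 1) x). P (x /\<^sub>R norm x)"
    using assms(1) by (subst AE_density) (auto elim: eventually_mono)
  then show ?thesis
    unfolding sphere_measure_def using assms(2) by (subst AE_distr_iff) auto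
qed

lemma AE_sphere: "AE p in sphere_measure. p \<in> sphere 0 1"
proof (rule AE_sphere_measureI)
  show "AE x in lborel. x /\<^sub>R norm x \<in> sphere (0::real^3) 1"
    using AE_lborel_singleton[of "0::real^3"] by eventually_elim simp
qed (simp add: borel_closed)

lemma AE_coord_nonzero: "AE p in sphere_measure. p $ i \<noteq> 0"
proof (rule AE_sphere_measureI)
  have "negligible {x::real^3. x $ i = 0}"
    using negligible_standard_hyperplane_cart[of i] by simp
  then have "AE x in lebesgue. (x::real^3) \<notin> {x. x $ i = 0}"
    by (intro AE_not_in) (simp add: negligible_iff_null_sets)
  then have "AE x in lborel. (x::real^3) \<notin> {x. x $ i = 0}"
    by (simp add: AE_completion_iff)
  then show "AE x in lborel. (x /\<^sub>R norm (x::real^3)) $ i \<noteq> 0"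
    by eventually_elim auto
  show "{x::real^3. x $ i \<noteq> 0} \<in> sets borel" by measurable
qed

lemma lborel_orthogonal_transformation:
  fixes T :: "real^3 \<Rightarrow> real^3"
  assumes "orthogonal_transformation T"
  shows "distr lborel borel T = lborel"
proof (rule lborel_eqI[symmetric])
  have T: "linear T" "bij T" "orthogonal_transformation (inv T)"
    using assms orthogonal_transformation_linear orthogonal_transformation_bij
      orthogonal_transformation_inv by auto
  have [measurable]: "T \<in> borel_measurable borel"
    using T(1) by (simp add: borel_measurable_continuous_onI linear_continuous_on linear_conv_bounded_linear)
  fix l u :: "real^3" assume "\<And>b. b \<in> Basis \<Longrightarrow> l \<bullet> b \<le> u \<bullet> b"
  then have box: "emeasure lborel (box l u) = ennreal (\<Prod>b\<in>Basis. (u - l) \<bullet> b)"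
    by simp
  have vim: "T -` box l u = inv T ` box l u"
    using T(2) by (simp add: bij_vimage_eq_inv_image)
  have meas: "inv T ` box l u \<in> lmeasurable"
    by (rule measurable_orthogonal_image[OF T(3)]) simp
  have "emeasure (distr lborel borel T) (box l u) = emeasure lborel (T -` box l u)"
    by (simp add: emeasure_distr)
  also have "\<dots> = emeasure lebesgue (inv T ` box l u)"
  proof -
    have "T -` box l u \<in> sets lborel"
      using measurable_sets_borel[of T borel "box l u"] by simp
    then show ?thesis unfolding vim[symmetric] by (simp add: emeasure_completion)
  qed
  also have "\<dots> = ennreal (measure lebesgue (inv T ` box l u))"
    using meas by (simp add: emeasure_eq_measure2 fmeasurableD2 emeasure_eq_ennreal_measure)
  also have "measure lebesgue (inv T ` box l u) = measure lebesgue (box l u)"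
    by (rule measure_orthogonal_image[OF T(3)]) simp
  also have "ennreal (measure lebesgue (box l u)) = emeasure lborel (box l u)"
    using emeasure_lborel_box_finite[of l u] emeasure_eq_ennreal_measure[of lborel "box l u"] by simp
  finally show "emeasure (distr lborel borel T) (box l u) = ennreal (\<Prod>b\<in>Basis. (u - l) \<bullet> b)"
    using box by simp
qed simp

lemma orthogonal_transformation_measurable [measurable (raw)]:
  fixes T :: "real^3 \<Rightarrow> real^3"
  shows "orthogonal_transformation T \<Longrightarrow> T \<in> borel_measurable borel"
  by (simp add: borel_measurable_continuous_onI linear_continuous_on
      linear_conv_bounded_linear[symmetric] orthogonal_transformation_linear)

text \<open>
  The unit ball and the radial projection both commute with \<open>T\<close>, so the invariance of the
  area is inherited from that of Lebesgue measure.
\<close>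

lemma sphere_measure_orthogonal_transformation:
  assumes T: "orthogonal_transformation T"
  shows "distr sphere_measure borel T = sphere_measure"
proof -
  have [measurable]: "T \<in> borel_measurable borel"
    using T by (rule orthogonal_transformation_measurable)
  let ?g = "\<lambda>x::real^3. 3 * indicator (ball 0 1) x :: ennreal"
  let ?\<pi> = "\<lambda>x::real^3. x /\<^sub>R norm x"
  have gT: "?g \<circ> T = ?g"
    using T by (auto simp: fun_eq_iff orthogonal_transformation_norm indicator_def dist_norm)
  have "density lborel ?g = density (distr lborel borel T) ?g"
    by (simp add: lborel_orthogonal_transformation[OF T])
  also have "\<dots> = distr (density lborel (?g \<circ> T)) borel T"
    by (subst density_distr) (auto simp: o_def)
  finally have dens: "distr (density lborel ?g) borel T = density lborel ?g"
    by (simp add: gT)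
  have "T \<circ> ?\<pi> = ?\<pi> \<circ> T"
    using T by (auto simp: fun_eq_iff orthogonal_transformation_norm
        linear_scale orthogonal_transformation_linear)
  then have "distr sphere_measure borel T = distr (distr (density lborel ?g) borel T) borel ?\<pi>"
    unfolding sphere_measure_def by (simp add: distr_distr)
  then show ?thesis
    by (simp add: dens sphere_measure_def)
qed

lemma integral_orthogonal_transformation:
  fixes f :: "real^3 \<Rightarrow> 'b::{banach, second_countable_topology}"
  assumes T: "orthogonal_transformation T" and [measurable]: "f \<in> borel_measurable borel"
  shows "(\<integral>\<^sub>S p. f (T p)) = (\<integral>\<^sub>S p. f p)"
    "integrable sphere_measure (\<lambda>p. f (T p)) \<longleftrightarrow> integrable sphere_measure f"
proof -
  have [measurable]: "T \<in> borel_measurable borel"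
    using T by (rule orthogonal_transformation_measurable)
  show "(\<integral>\<^sub>S p. f (T p)) = (\<integral>\<^sub>S p. f p)"
    using integral_distr[of T sphere_measure borel f] sphere_measure_orthogonal_transformation[OF T]
    by simp
  show "integrable sphere_measure (\<lambda>p. f (T p)) \<longleftrightarrow> integrable sphere_measure f"
    using integrable_distr_eq[of T sphere_measure borel f] sphere_measure_orthogonal_transformation[OF T]
    by simp
qed

text \<open>
  Measurability is required with respect to the Borel sets of the ambient space: functions on the
  cracked sphere will be extended by zero, so that one measure space serves for all of them.
\<close>

definition square_integrable :: "(real^3 \<Rightarrow> 'b::euclidean_space) \<Rightarrow> bool" where
  "square_integrable f \<longleftrightarrow> f \<in> borel_measurable borel \<and> integrable sphere_measure (\<lambda>p. (norm (f p))\<^sup>2)"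

lemma square_integrable_measurable [measurable_dest]: "square_integrable f \<Longrightarrow> f \<in> borel_measurable borel"
  by (simp add: square_integrable_def)

lemma square_integrable_integrable: "square_integrable f \<Longrightarrow> integrable sphere_measure (\<lambda>p. (norm (f p))\<^sup>2)"
  by (simp add: square_integrable_def)

lemma integrable_bounded_on_sphere:
  fixes f :: "real^3 \<Rightarrow> 'b::{banach, second_countable_topology}"
  assumes "f \<in> borel_measurable borel" "\<And>p. p \<in> sphere 0 1 \<Longrightarrow> norm (f p) \<le> B"
  shows "integrable sphere_measure f"
proof (rule sphere.integrable_const_bound[where B = B])
  show "AE p in sphere_measure. norm (f p) \<le> B"
    using AE_sphere by eventually_elim (use assms in auto)
qed (use assms in simp)

lemma continuous_bounded_on_sphere:
  fixes f :: "real^3 \<Rightarrow> 'b::real_normed_vector"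
  assumes "continuous_on UNIV f"
  obtains B where "B \<ge> 0" "\<And>p. p \<in> sphere 0 1 \<Longrightarrow> norm (f p) \<le> B"
proof -
  have "compact (f ` sphere 0 1)"
    using assms by (intro compact_continuous_image) (auto intro: continuous_on_subset)
  then obtain B where "\<And>x. x \<in> f ` sphere 0 1 \<Longrightarrow> norm x \<le> B"
    using compact_imp_bounded bounded_iff by metis
  then show thesis using that[of "max B 0"] by force
qed

lemma continuous_integrable:
  fixes f :: "real^3 \<Rightarrow> 'b::{banach, second_countable_topology}"
  assumes "continuous_on UNIV f"
  shows "integrable sphere_measure f"
  using continuous_bounded_on_sphere[OF assms] integrable_bounded_on_sphere
    borel_measurable_continuous_onI[OF assms] by metis

lemma square_integrable_continuous:
  fixes f :: "real^3 \<Rightarrow> 'b::euclidean_space"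
  assumes "continuous_on UNIV f" shows "square_integrable f"
  unfolding square_integrable_def
  using borel_measurable_continuous_onI[OF assms] assms
  by (auto intro!: continuous_integrable continuous_intros)

lemma square_integrable_smooth: "smooth f \<Longrightarrow> square_integrable f"
  by (intro square_integrable_continuous smooth_continuous)

lemma square_integrable_smooth_field: "smooth_field f \<Longrightarrow> square_integrable f"
  by (intro square_integrable_continuous smooth_field_continuous)

lemma square_integrable_inner:
  fixes f g :: "real^3 \<Rightarrow> 'b::euclidean_space"
  assumes "square_integrable f" "square_integrable g"
  shows "integrable sphere_measure (\<lambda>p. f p \<bullet> g p)"
proof (rule Bochner_Integration.integrable_bound)
  note [measurable] = square_integrable_measurable[OF assms(1)] square_integrable_measurable[OF assms(2)]
  show "integrable sphere_measure (\<lambda>p. (norm (f p))\<^sup>2 + (norm (g p))\<^sup>2)"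
    using assms by (auto simp: square_integrable_integrable)
  show "(\<lambda>p. f p \<bullet> g p) \<in> borel_measurable sphere_measure" by measurable
  have "\<bar>f p \<bullet> g p\<bar> \<le> (norm (f p))\<^sup>2 + (norm (g p))\<^sup>2" for p
    using Cauchy_Schwarz_ineq2[of "f p" "g p"] sum_squares_bound[of "norm (f p)" "norm (g p)"]
      zero_le_power2[of "norm (f p)"] zero_le_power2[of "norm (g p)"] by linarith
  then show "AE p in sphere_measure. norm (f p \<bullet> g p) \<le> norm ((norm (f p))\<^sup>2 + (norm (g p))\<^sup>2)"
    by (intro AE_I2) (auto intro: order_trans)
qed

lemma square_integrable_mult: "square_integrable f \<Longrightarrow> square_integrable g \<Longrightarrow> integrable sphere_measure (\<lambda>p. f p * (g p :: real))"
  using square_integrable_inner[of f g] by simp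

lemma square_integrable_imp_integrable: "square_integrable f \<Longrightarrow> integrable sphere_measure (f :: real^3 \<Rightarrow> real)"
  using square_integrable_mult[of f "\<lambda>_. 1"] square_integrable_continuous[of "\<lambda>_. 1::real"] by simp

lemma square_integrable_add:
  assumes "square_integrable f" "square_integrable g" shows "square_integrable (\<lambda>p. f p + g p)"
proof -
  note [measurable] = square_integrable_measurable[OF assms(1)] square_integrable_measurable[OF assms(2)]
  have "integrable sphere_measure (\<lambda>p. (norm (f p))\<^sup>2 + (norm (g p))\<^sup>2 + 2 * (f p \<bullet> g p))"
    using assms by (auto simp: square_integrable_integrable square_integrable_inner)
  then have "integrable sphere_measure (\<lambda>p. (norm (f p + g p))\<^sup>2)"
    by (rule back_subst[where P = "integrable sphere_measure"])
      (auto simp: power2_norm_eq_inner inner_add_left inner_add_right inner_commute algebra_simps)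
  then show ?thesis unfolding square_integrable_def by simp
qed

lemma square_integrable_mult_bounded:
  fixes f :: "real^3 \<Rightarrow> 'b::euclidean_space"
  assumes f: "square_integrable f" and [measurable]: "h \<in> borel_measurable borel"
    and B: "\<And>p. p \<in> sphere 0 1 \<Longrightarrow> \<bar>h p\<bar> \<le> B"
  shows "square_integrable (\<lambda>p. h p *\<^sub>R f p)"
proof -
  note [measurable] = square_integrable_measurable[OF f]
  have "integrable sphere_measure (\<lambda>p. (norm (h p *\<^sub>R f p))\<^sup>2)"
  proof (rule Bochner_Integration.integrable_bound)
    show "integrable sphere_measure (\<lambda>p. B\<^sup>2 * (norm (f p))\<^sup>2)"
      using f by (auto simp: square_integrable_integrable)
    have "norm ((norm (h p *\<^sub>R f p))\<^sup>2) \<le> norm (B\<^sup>2 * (norm (f p))\<^sup>2)" if "p \<in> sphere 0 1" for p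
    proof -
      have "(h p)\<^sup>2 \<le> B\<^sup>2" using B[OF that] by (metis abs_ge_zero power2_abs power_mono)
      then show ?thesis by (simp add: power_mult_distrib mult_right_mono)
    qed
    then show "AE p in sphere_measure. norm ((norm (h p *\<^sub>R f p))\<^sup>2) \<le> norm (B\<^sup>2 * (norm (f p))\<^sup>2)"
      using AE_sphere by (auto elim: eventually_mono)
  qed measurable
  then show ?thesis unfolding square_integrable_def by simp
qed

lemma square_integrable_mult_continuous:
  fixes f :: "real^3 \<Rightarrow> 'b::euclidean_space"
  assumes "square_integrable f" "continuous_on UNIV h"
  shows "square_integrable (\<lambda>p. h p *\<^sub>R f p)"
  using continuous_bounded_on_sphere[OF assms(2)] square_integrable_mult_bounded[OF assms(1)]
    borel_measurable_continuous_onI[OF assms(2)] by (metis real_norm_def)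

lemma square_integrable_scaleR: "square_integrable f \<Longrightarrow> square_integrable (\<lambda>p. c *\<^sub>R f p)"
  by (rule square_integrable_mult_continuous) auto

lemma square_integrable_cmult: "square_integrable f \<Longrightarrow> square_integrable (\<lambda>p. c * f p :: real)"
  using square_integrable_scaleR[of f c] by simp

lemma square_integrable_minus: "square_integrable f \<Longrightarrow> square_integrable (\<lambda>p. - f p)"
  using square_integrable_scaleR[of f "-1"] by simp

lemma square_integrable_diff: "square_integrable f \<Longrightarrow> square_integrable g \<Longrightarrow> square_integrable (\<lambda>p. f p - g p)"
  using square_integrable_add[OF _ square_integrable_minus, of f g] by simp

lemma square_integrable_zero: "square_integrable (\<lambda>p. 0)"
  by (simp add: square_integrable_def)

lemma square_integrable_sum: "(\<And>i. i \<in> I \<Longrightarrow> square_integrable (f i)) \<Longrightarrow> square_integrable (\<lambda>p. \<Sum>i\<in>I. f i p)"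
  by (induction I rule: infinite_finite_induct) (auto intro: square_integrable_add square_integrable_zero)

lemma square_integrable_orthogonal:
  assumes T: "orthogonal_transformation T" and f: "square_integrable f"
  shows "square_integrable (\<lambda>p. f (T p))"
proof -
  note [measurable] = square_integrable_measurable[OF f] orthogonal_transformation_measurable[OF T]
  show ?thesis
    using integral_orthogonal_transformation(2)[OF T, of "\<lambda>p. (norm (f p))\<^sup>2"] f
    unfolding square_integrable_def by simp
qed

lemma norm_square_integral_add:
  fixes f g :: "real^3 \<Rightarrow> 'b::euclidean_space"
  assumes "square_integrable f" "square_integrable g"
  shows "(\<integral>\<^sub>S p. (norm (f p + g p))\<^sup>2) =
    (\<integral>\<^sub>S p. (norm (f p))\<^sup>2) + 2 * (\<integral>\<^sub>S p. f p \<bullet> g p)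
      + (\<integral>\<^sub>S p. (norm (g p))\<^sup>2)"
proof -
  have "(norm (f p + g p))\<^sup>2 = (norm (f p))\<^sup>2 + 2 * (f p \<bullet> g p) + (norm (g p))\<^sup>2" for p
    by (auto simp: power2_norm_eq_inner inner_add_left inner_add_right inner_commute)
  then show ?thesis using assms by (simp add: square_integrable_integrable square_integrable_inner)
qed

lemma Cauchy_Schwarz_sphere:
  fixes f g :: "real^3 \<Rightarrow> 'b::euclidean_space"
  assumes "square_integrable f" "square_integrable g"
  shows "(\<integral>\<^sub>S p. f p \<bullet> g p)\<^sup>2 \<le>
    (\<integral>\<^sub>S p. (norm (f p))\<^sup>2) * (\<integral>\<^sub>S p. (norm (g p))\<^sup>2)"
    (is "?B\<^sup>2 \<le> ?A * ?C")
proof -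
  have quad: "0 \<le> ?A + 2 * t * ?B + t\<^sup>2 * ?C" for t
  proof -
    have "0 \<le> (\<integral>\<^sub>S p. (norm (f p + t *\<^sub>R g p))\<^sup>2)" by simp
    also have "\<dots> = ?A + 2 * t * ?B + t\<^sup>2 * ?C"
      using norm_square_integral_add[OF assms(1) square_integrable_scaleR[OF assms(2), of t]]
      by (simp add: power_mult_distrib)
    finally show ?thesis .
  qed
  have C: "0 \<le> ?C" by simp
  show ?thesis
  proof (cases "?C = 0")
    case True
    have "?B = 0"
    proof (rule ccontr)
      assume "?B \<noteq> 0"
      \<comment> \<open>a linear function of \<open>t\<close> that is nonnegative everywhere has slope zero\<close>
      then show False using quad[of "- (?A + 1) / (2 * ?B)"] True by (simp add: field_simps)
    qed
    then show ?thesis by (simp add: True)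
  next
    case False
    then have "0 < ?C" using C by linarith
    have "0 \<le> ?A - ?B\<^sup>2 / ?C"
      using quad[of "- ?B / ?C"] \<open>0 < ?C\<close> by (simp add: power2_eq_square field_simps)
    then show ?thesis using \<open>0 < ?C\<close> by (simp add: field_simps)
  qed
qed

text \<open>
  Strong convergence implies weak convergence and convergence of norms, by the inequality of
  Cauchy and Schwarz. All approximation arguments below pass to the limit through these two
  statements.
\<close>

lemma square_integrable_convergence:
  fixes w :: "real^3 \<Rightarrow> real"
  assumes w: "square_integrable w" and f: "\<And>n. square_integrable (f n)"
    and lim: "(\<lambda>n. \<integral>\<^sub>S p. (w p - f n p)\<^sup>2) \<longlonglongrightarrow> 0"
  shows "\<And>h. square_integrable h \<Longrightarrow> (\<lambda>n. \<integral>\<^sub>S p. h p * f n p) \<longlonglongrightarrow> (\<integral>\<^sub>S p. h p * w p)"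
    and "(\<lambda>n. \<integral>\<^sub>S p. (f n p)\<^sup>2) \<longlonglongrightarrow> (\<integral>\<^sub>S p. (w p)\<^sup>2)"
proof -
  have d: "square_integrable (\<lambda>p. w p - f n p)" for n using w f by (rule square_integrable_diff)
  show h: "(\<lambda>n. \<integral>\<^sub>S p. h p * f n p) \<longlonglongrightarrow> (\<integral>\<^sub>S p. h p * w p)" if "square_integrable h" for h
  proof -
    let ?e = "\<lambda>n. \<integral>\<^sub>S p. h p * (w p - f n p)"
    have "(\<lambda>n. (\<integral>\<^sub>S p. (h p)\<^sup>2) * (\<integral>\<^sub>S p. (w p - f n p)\<^sup>2)) \<longlonglongrightarrow> 0"
      using tendsto_mult[OF tendsto_const lim] by simp
    then have "(\<lambda>n. (?e n)\<^sup>2) \<longlonglongrightarrow> 0"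
      by (rule tendsto_sandwich[OF _ _ tendsto_const, rotated 2])
        (use Cauchy_Schwarz_sphere[OF that d] in \<open>auto intro: always_eventually\<close>)
    then have "?e \<longlonglongrightarrow> 0" using tendsto_real_sqrt by fastforce
    then have "(\<lambda>n. (\<integral>\<^sub>S p. h p * w p) - ?e n) \<longlonglongrightarrow> (\<integral>\<^sub>S p. h p * w p) - 0"
      by (intro tendsto_diff tendsto_const)
    moreover have "(\<integral>\<^sub>S p. h p * w p) - ?e n = (\<integral>\<^sub>S p. h p * f n p)" for n
      using that w f by (simp add: right_diff_distrib square_integrable_mult)
    ultimately show ?thesis by simp
  qed
  have "(\<lambda>n. (\<integral>\<^sub>S p. (w p - f n p)\<^sup>2) + 2 * (\<integral>\<^sub>S p. w p * f n p)
      - (\<integral>\<^sub>S p. w p * w p)) \<longlonglongrightarrow>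
      0 + 2 * (\<integral>\<^sub>S p. w p * w p) - (\<integral>\<^sub>S p. w p * w p)"
    by (intro tendsto_intros lim h w)
  moreover have "(\<integral>\<^sub>S p. (w p - f n p)\<^sup>2) + 2 * (\<integral>\<^sub>S p. w p * f n p)
      - (\<integral>\<^sub>S p. w p * w p) = (\<integral>\<^sub>S p. (f n p)\<^sup>2)" for n
  proof -
    have "(f n p)\<^sup>2 = (w p - f n p)\<^sup>2 + 2 * (w p * f n p) - w p * w p" for p
      by (simp add: power2_eq_square algebra_simps)
    moreover have "integrable sphere_measure (\<lambda>p. (w p - f n p)\<^sup>2)"
      using square_integrable_integrable[OF d] by simp
    ultimately show ?thesis using w f by (simp add: square_integrable_mult)
  qed
  ultimately show "(\<lambda>n. \<integral>\<^sub>S p. (f n p)\<^sup>2) \<longlonglongrightarrow> (\<integral>\<^sub>S p. (w p)\<^sup>2)"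
    by (simp add: power2_eq_square)
qed

section \<open>The divergence theorem on the sphere\<close>

text \<open>
  The rotation by the angle \<open>t\<close> about the coordinate axis \<open>k\<close>, in the form of Rodrigues.
\<close>

definition rotation :: "3 \<Rightarrow> real \<Rightarrow> real^3 \<Rightarrow> real^3" where
  "rotation k t p = cos t *\<^sub>R p + sin t *\<^sub>R cross3 (axis k 1) p + ((1 - cos t) * p $ k) *\<^sub>R axis k 1"

lemma rotation_orthogonal: "orthogonal_transformation (rotation k t)"
proof -
  have "linear (rotation k t)"
    by (rule linearI)
      (auto simp: rotation_def cross_add_right cross_mult_right algebra_simps)
  moreover have "norm (rotation k t p) = norm p" for p
  proof -
    have "rotation k t p \<bullet> rotation k t p = p \<bullet> p"
    proof -
      have sc: "sin t * sin t = 1 - cos t * cos t"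
        using sin_squared_eq[of t] by (simp add: power2_eq_square)
      have [simp]: "sin t * (sin t * x) = x - cos t * (cos t * x)" for x
        unfolding mult.assoc[symmetric] sc by (simp add: algebra_simps)
      show ?thesis
        using exhaust_3[of k] by (auto simp: rotation_def cross3_simps axis_def sc)
    qed
    then show ?thesis by (simp add: norm_eq_sqrt_inner)
  qed
  ultimately show ?thesis by (simp add: orthogonal_transformation)
qed

lemma rotation_has_derivative:
  "((\<lambda>t. rotation k t p) has_vector_derivative cross3 (axis k 1) (rotation k t p)) (at t)"
proof -
  have "cross3 (axis k 1) (rotation k t p) =
      - sin t *\<^sub>R p + cos t *\<^sub>R cross3 (axis k 1) p + (sin t * p $ k) *\<^sub>R axis k 1"
    using exhaust_3[of k]
    by (auto simp: rotation_def cross3_simps axis_def forall_3)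
  moreover have "((\<lambda>t. rotation k t p) has_vector_derivative
      (- sin t *\<^sub>R p + cos t *\<^sub>R cross3 (axis k 1) p + (sin t * p $ k) *\<^sub>R axis k 1)) (at t)"
    unfolding rotation_def by (auto intro!: derivative_eq_intros)
  ultimately show ?thesis by simp
qed

lemma rotation_0 [simp]: "rotation k 0 p = p"
  by (simp add: rotation_def)

text \<open>
  The integral of \<open>a\<close> over the sphere does not change when \<open>a\<close> is rotated, so the derivative of
  \<open>a\<close> along the flow of rotations has integral zero; dominated convergence exchanges limit and
  integral.
\<close>

lemma integral_rotation_derivative:
  assumes a: "\<And>p. (a has_derivative a' p) (at p)"
    and b: "continuous_on UNIV (\<lambda>p. a' p (cross3 (axis k 1) p))"
  shows "(\<integral>\<^sub>S p. a' p (cross3 (axis k 1) p)) = (0::real)"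
proof -
  let ?b = "\<lambda>p. a' p (cross3 (axis k 1) p)"
  have curve: "((\<lambda>t. a (rotation k t p)) has_real_derivative ?b (rotation k t p)) (at t)" for p t
  proof -
    have "((\<lambda>t. rotation k t p) has_derivative (\<lambda>s. s *\<^sub>R cross3 (axis k 1) (rotation k t p))) (at t)"
      using rotation_has_derivative unfolding has_vector_derivative_def .
    from diff_chain_at[OF this a]
    have "((\<lambda>t. a (rotation k t p)) has_derivative
        (\<lambda>s. a' (rotation k t p) (s *\<^sub>R cross3 (axis k 1) (rotation k t p)))) (at t)"
      by (simp add: o_def)
    then show ?thesis
      unfolding has_field_derivative_def
      by (simp add: linear_scale[OF has_derivative_linear[OF a]] mult_commute_abs)
  qed
  obtain B where B: "\<And>p. p \<in> sphere 0 1 \<Longrightarrow> norm (?b p) \<le> B"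
    using continuous_bounded_on_sphere[OF b] by blast
  have cont_a: "continuous_on UNIV a"
    using a by (meson continuous_at_imp_continuous_on has_derivative_continuous)
  have [measurable]: "a \<in> borel_measurable borel" "?b \<in> borel_measurable borel"
    using cont_a b by (auto intro: borel_measurable_continuous_onI)
  have [measurable]: "rotation k t \<in> borel_measurable borel" for t
    by (rule orthogonal_transformation_measurable[OF rotation_orthogonal])
  let ?h = "\<lambda>n. inverse (real (Suc n))"
  \<comment> \<open>the difference quotients along the flow have integral zero and are bounded by the mean value theorem\<close>
  let ?F = "\<lambda>n p. (a (rotation k (?h n) p) - a p) / ?h n"
  have bound: "norm (?F n p) \<le> B" if p: "p \<in> sphere 0 1" for n p
  proof -
    have "\<exists>z>0. z < ?h n \<and> a (rotation k (?h n) p) - a (rotation k 0 p) = (?h n - 0) * ?b (rotation k z p)"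
      by (rule MVT2) (auto intro: curve)
    then obtain z where "a (rotation k (?h n) p) - a p = ?h n * ?b (rotation k z p)" by auto
    moreover have "norm (?b (rotation k z p)) \<le> B"
      using p orthogonal_transformation_norm[OF rotation_orthogonal] by (intro B) auto
    ultimately show ?thesis by simp
  qed
  have lim: "(\<lambda>n. ?F n p) \<longlonglongrightarrow> ?b p" for p
  proof -
    have "((\<lambda>h. (a (rotation k h p) - a p) / h) \<longlongrightarrow> ?b p) (at 0)"
      using curve[of p 0] by (simp add: has_field_derivative_iff)
    moreover have "filterlim ?h (at 0) sequentially"
      unfolding filterlim_at using LIMSEQ_inverse_real_of_nat by auto
    ultimately show ?thesis by (rule filterlim_compose)
  qed
  have "(\<lambda>n. \<integral>\<^sub>S p. ?F n p) \<longlonglongrightarrow> (\<integral>\<^sub>S p. ?b p)"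
    by (rule integral_dominated_convergence[where w = "\<lambda>_. B"])
      (use lim bound AE_sphere in \<open>auto elim: eventually_mono\<close>)
  moreover have "(\<integral>\<^sub>S p. ?F n p) = 0" for n
  proof -
    have "integrable sphere_measure a" by (rule continuous_integrable[OF cont_a])
    then show ?thesis
      using integral_orthogonal_transformation[OF rotation_orthogonal, of a k "?h n"] by simp
  qed
  ultimately show ?thesis by (simp add: LIMSEQ_const_iff)
qed

text \<open>
  At a point of the sphere, the three rotation fields satisfy \<open>\<Sum>k. L k p \<otimes> L k p = 1 - p \<otimes> p\<close>,
  the projection onto the tangent plane. They therefore compute the tangential trace as an
  orthonormal frame would, and unlike such a frame they exist globally.
\<close>

lemma trace_over_rotations:
  fixes D :: "real^3 \<Rightarrow> real^3"
  assumes "linear D"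
  shows "(\<Sum>k\<in>UNIV. D (cross3 (axis k 1) p) \<bullet> cross3 (axis k 1) p) =
    (p \<bullet> p) * (\<Sum>i\<in>Basis. D i \<bullet> i) - D p \<bullet> p"
proof -
  have D: "D v = v $ 1 *\<^sub>R D (axis 1 1) + v $ 2 *\<^sub>R D (axis 2 1) + v $ 3 *\<^sub>R D (axis 3 1)" for v
  proof -
    have "v = v $ 1 *\<^sub>R axis 1 1 + v $ 2 *\<^sub>R axis 2 1 + v $ 3 *\<^sub>R axis 3 1"
      by (simp add: vec_eq_iff forall_3 axis_def)
    then have "D v = D (v $ 1 *\<^sub>R axis 1 1 + v $ 2 *\<^sub>R axis 2 1 + v $ 3 *\<^sub>R axis 3 1)" by simp
    then show ?thesis by (simp add: linear_add[OF assms] linear_scale[OF assms])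
  qed
  have B: "(\<Sum>i\<in>Basis. D i \<bullet> i) = (\<Sum>k\<in>UNIV. D (axis k 1) $ k)"
  proof -
    have "Basis = range (\<lambda>i. axis i (1::real) :: real^3)" by (auto simp: Basis_vec_def)
    show ?thesis unfolding \<open>Basis = _\<close>
      by (subst sum.reindex) (auto simp: inj_on_def axis_eq_axis inner_axis)
  qed
  show ?thesis
    unfolding B D[of "cross3 _ _"] D[of p]
    by (simp add: sum_3 cross3_simps axis_def)
qed

lemma sum_double_cross: "(\<Sum>k\<in>UNIV. cross3 (axis k 1) (cross3 (axis k 1) p)) = - 2 *\<^sub>R p"
  by (simp add: sum_3 cross3_simps axis_def forall_3)

lemma bounded_linear_cross: "bounded_linear (cross3 a)"
  by (simp add: linear_conv_bounded_linear[symmetric] linearI cross_add_right cross_mult_right)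

lemma continuous_linear_family:
  fixes D :: "real^3 \<Rightarrow> real^3 \<Rightarrow> real^3"
  assumes D: "\<And>p. linear (D p)" and cD: "\<And>v. continuous_on S (\<lambda>p. D p v)"
    and h: "continuous_on S h"
  shows "continuous_on S (\<lambda>p. D p (h p))"
proof -
  have "D p v = (\<Sum>i\<in>UNIV. v $ i *\<^sub>R D p (axis i 1))" for p v
  proof -
    have "(\<Sum>i\<in>UNIV. v $ i *\<^sub>R axis i 1) = v"
      by (subst vec_eq_iff) (simp add: forall_3 sum_3 axis_def)
    then have "D p v = D p (\<Sum>i\<in>UNIV. v $ i *\<^sub>R axis i 1)" by simp
    then show ?thesis by (simp add: linear_sum[OF D] linear_scale[OF D])
  qed
  then have "(\<lambda>p. D p (h p)) = (\<lambda>p. \<Sum>i\<in>UNIV. h p $ i *\<^sub>R D p (axis i 1))"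
    by blast
  moreover have "continuous_on S (\<lambda>p. \<Sum>i\<in>UNIV. h p $ i *\<^sub>R D p (axis i 1))"
    by (intro continuous_intros cD h)
  ultimately show ?thesis by (simp only:)
qed

lemma Ck_1_sphere_div_continuous:
  assumes X: "Ck 1 X" shows "continuous_on UNIV (sphere_div X)"
proof -
  have dX: "(X has_derivative frechet_derivative X (at p)) (at p)" for p
    using X by (simp add: frechet_derivative_works[symmetric])
  have cD: "continuous_on UNIV (\<lambda>p. frechet_derivative X (at p) h)" for h
    using X by simp
  have "continuous_on UNIV (\<lambda>p. frechet_derivative X (at p) p)"
    by (rule continuous_linear_family[OF has_derivative_linear[OF dX] cD continuous_on_id])
  then show ?thesis
    unfolding sphere_div_def by (intro continuous_intros cD)
qed

text \<open>
  For a tangential field the divergence equals \<open>\<Sum>k. L k (X \<bullet> L k)\<close>, where \<open>L k\<close> is the rotation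
  field about the axis \<open>k\<close>: a sum of derivatives along rotations.
\<close>

theorem divergence_theorem:
  assumes X: "Ck 1 X" and tan: "\<And>p. p \<in> sphere 0 1 \<Longrightarrow> X p \<bullet> p = 0"
  shows "(\<integral>\<^sub>S p. sphere_div X p) = 0"
proof -
  let ?D = "\<lambda>p. frechet_derivative X (at p)"
  let ?L = "\<lambda>k p. cross3 (axis k 1) p"
  have dX: "(X has_derivative ?D p) (at p)" for p
    using X by (simp add: frechet_derivative_works[symmetric])
  have cD: "continuous_on UNIV (\<lambda>p. ?D p h)" for h
    using X by simp
  have cX: "continuous_on UNIV X"
    using dX by (meson continuous_at_imp_continuous_on has_derivative_continuous)
  let ?a' = "\<lambda>k p v. X p \<bullet> ?L k v + ?D p v \<bullet> ?L k p"
  have a': "((\<lambda>p. X p \<bullet> ?L k p) has_derivative ?a' k p) (at p)" for k p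
    by (rule has_derivative_inner[OF dX bounded_linear_imp_has_derivative[OF bounded_linear_cross]])
  have cL: "continuous_on UNIV (?L k)" for k
    by (intro linear_continuous_on bounded_linear_cross)
  have cDL: "continuous_on UNIV (\<lambda>p. ?D p (?L k p))" for k
    by (rule continuous_linear_family[OF has_derivative_linear[OF dX] cD cL])
  have c: "continuous_on UNIV (\<lambda>p. ?a' k p (?L k p))" for k
    by (intro continuous_intros cX cDL cL continuous_on_compose2[OF cL]) auto
  have "sphere_div X p = (\<Sum>k\<in>UNIV. ?a' k p (?L k p))" if "p \<in> sphere 0 1" for p
  proof -
    have "p \<bullet> p = 1" using that by (simp add: norm_eq_1)
    then show ?thesis
      using trace_over_rotations[OF has_derivative_linear[OF dX], of p p] tan[OF that]
      by (simp add: sphere_div_def sum.distrib inner_sum_right[symmetric] sum_double_cross)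
  qed
  then have "AE p in sphere_measure. sphere_div X p = (\<Sum>k\<in>UNIV. ?a' k p (?L k p))"
    using AE_sphere by (auto elim: eventually_mono)
  moreover have "sphere_div X \<in> borel_measurable borel"
    by (rule borel_measurable_continuous_onI[OF Ck_1_sphere_div_continuous[OF X]])
  ultimately have "(\<integral>\<^sub>S p. sphere_div X p) =
      (\<integral>\<^sub>S p. (\<Sum>k\<in>UNIV. ?a' k p (?L k p)))"
    using borel_measurable_continuous_onI[OF c] by (intro integral_cong_AE) (auto simp del: sum.distrib)
  also have "\<dots> = (\<Sum>k\<in>UNIV. \<integral>\<^sub>S p. ?a' k p (?L k p))"
    by (rule Bochner_Integration.integral_sum) (rule continuous_integrable[OF c])
  also have "\<dots> = 0"
    using integral_rotation_derivative[OF a' c] by simp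
  finally show ?thesis .
qed

lemma divergence_theorem_smooth:
  assumes "smooth_field X" "\<And>p. p \<in> sphere 0 1 \<Longrightarrow> X p \<bullet> p = 0"
  shows "(\<integral>\<^sub>S p. sphere_div X p) = 0"
  using smooth_field_Ck[OF assms(1)] assms(2) by (rule divergence_theorem)

lemma smooth_sphere_div:
  assumes "smooth_field X" shows "smooth (sphere_div X)"
proof -
  obtain Y where Y: "\<And>i. has_grad (\<lambda>p. X p $ i) (Y i)" "\<And>i. smooth_field (Y i)"
    using smooth_field_derivative[OF assms] by metis
  have "smooth (\<lambda>p. Y i p \<bullet> p)" for i
    using smooth_inner[OF Y(2) smooth_field_id] .
  then have "smooth (\<lambda>p. (\<Sum>i\<in>UNIV. Y i p $ i) - (\<Sum>i\<in>UNIV. (Y i p \<bullet> p) * p $ i))"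
    using Y(2) unfolding smooth_field_def by (intro smooth_intros) auto
  moreover have "sphere_div X = (\<lambda>p. (\<Sum>i\<in>UNIV. Y i p $ i) - (\<Sum>i\<in>UNIV. (Y i p \<bullet> p) * p $ i))"
    using sphere_div_components[OF Y(1)] by (rule ext)
  ultimately show ?thesis by (simp only:)
qed

lemma integral_rotation_smooth:
  assumes "has_grad f g" "smooth_field g"
  shows "(\<integral>\<^sub>S p. g p \<bullet> cross3 (axis k 1) p) = 0"
proof (rule integral_rotation_derivative)
  show "(f has_derivative (\<lambda>v. g p \<bullet> v)) (at p)" for p
    using assms by (simp add: has_grad_def)
  show "continuous_on UNIV (\<lambda>p. g p \<bullet> cross3 (axis k 1) p)"
    by (intro continuous_intros smooth_field_continuous assms linear_continuous_on bounded_linear_cross)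
qed

section \<open>Testing across the crack\<close>

text \<open>
  The integral identity of a weak gradient, for a function and a field that live on the whole sphere,
  such as extensions by zero. Sums, multiples and reflections can then be formed without reference
  to \<open>\<Omega>\<close>.
\<close>

definition weak_pair :: "(real^3) set \<Rightarrow> (real^3 \<Rightarrow> real) \<Rightarrow> (real^3 \<Rightarrow> real^3) \<Rightarrow> bool" where
  "weak_pair \<Omega> w G \<longleftrightarrow> square_integrable w \<and> square_integrable G \<and>
     (\<forall>X. test_field \<Omega> X \<longrightarrow>
        (\<integral>\<^sub>S p. w p * sphere_div X p) = - (\<integral>\<^sub>S p. G p \<bullet> X p))"

text \<open>
  The sign function for \<open>e = -1\<close> and the constant \<open>1\<close> off the origin for \<open>e = 1\<close>. Products of two
  of these are the functions that are constant on each quarter of the sphere and have a parity.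
\<close>

definition side_weight :: "real \<Rightarrow> real \<Rightarrow> real" where
  "side_weight e t = (if 0 < t then 1 else if t < 0 then e else 0)"

text \<open>
  A smooth version of \<open>side_weight e\<close> that vanishes for \<open>n * \<bar>t\<bar> \<le> 1\<close>.
\<close>

definition crack_cutoff :: "real \<Rightarrow> real \<Rightarrow> real \<Rightarrow> real" where
  "crack_cutoff e n t = flat 0 (n * t + (-1)) + e * flat 0 (- n * t + (-1))"

definition crack_cutoff' :: "real \<Rightarrow> real \<Rightarrow> real \<Rightarrow> real" where
  "crack_cutoff' e n t = n * flat 2 (n * t + (-1)) - e * n * flat 2 (- n * t + (-1))"

lemma side_weight_measurable [measurable]: "side_weight e \<in> borel_measurable borel"
  unfolding side_weight_def by measurable

lemma flat_0_bounds: "0 \<le> flat 0 t" "flat 0 t \<le> 1"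
  by (auto simp: flat_def)

lemma flat_2_bounds:
  assumes "t > 0"
  shows "0 \<le> flat 2 t" "(t + 1) * flat 2 t \<le> 3" "(t + 1) * flat 2 t \<le> 1 / t + 1 / t\<^sup>2"
proof -
  define u where "u = 1 / t"
  have u: "u > 0" "t = 1 / u" using assms by (auto simp: u_def)
  have eq: "(t + 1) * flat 2 t = (u + u\<^sup>2) * exp (- u)"
    unfolding u_def using assms by (simp add: flat_def power2_eq_square field_simps)
  show "0 \<le> flat 2 t" using assms by (simp add: flat_def)
  have "u + u\<^sup>2 \<le> 3 * exp u"
    using exp_lower_Taylor_quadratic[of u] u(1) zero_le_power2[of u] by linarith
  then have "(u + u\<^sup>2) * exp (- u) \<le> 3 * exp u * exp (- u)"
    by (intro mult_right_mono) auto
  then show "(t + 1) * flat 2 t \<le> 3"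
    unfolding eq by (simp add: exp_minus_inverse mult.assoc)
  have "(u + u\<^sup>2) * exp (- u) \<le> (u + u\<^sup>2) * 1"
    using u by (intro mult_left_mono) auto
  then show "(t + 1) * flat 2 t \<le> 1 / t + 1 / t\<^sup>2"
    unfolding eq by (simp add: u(2) power_divide)
qed

lemma crack_cutoff_bound: "\<bar>e\<bar> \<le> 1 \<Longrightarrow> \<bar>crack_cutoff e n t\<bar> \<le> 2"
proof -
  assume "\<bar>e\<bar> \<le> 1"
  then have "\<bar>e * flat 0 (- n * t + (-1))\<bar> \<le> 1 * 1"
    unfolding abs_mult using flat_0_bounds by (intro mult_mono) auto
  then show ?thesis
    unfolding crack_cutoff_def using flat_0_bounds[of "n * t + (-1)"] by linarith
qed

lemma flat_nonpos: "t \<le> 0 \<Longrightarrow> flat k t = 0"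
  by (simp add: flat_def)

lemma crack_cutoff_zero:
  assumes "n \<ge> 0" "n * \<bar>t\<bar> \<le> 1" shows "crack_cutoff e n t = 0"
proof -
  have "n * t \<le> 1" "- n * t \<le> 1"
    using assms mult_left_mono[of t "\<bar>t\<bar>" n] mult_left_mono[of "- t" "\<bar>t\<bar>" n]
      abs_ge_self[of t] abs_ge_minus_self[of t] by auto
  then show ?thesis by (simp add: crack_cutoff_def flat_nonpos)
qed

lemma flat_2_scaled_bounds:
  assumes "s = n * t + (-1)"
  shows "\<bar>n * t * flat 2 s\<bar> \<le> 3" "s > 0 \<Longrightarrow> \<bar>n * t * flat 2 s\<bar> \<le> 1 / s + 1 / s\<^sup>2"
proof -
  have *: "n * t = s + 1" using assms by simp
  show "\<bar>n * t * flat 2 s\<bar> \<le> 3"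
    unfolding * using flat_2_bounds[of s] by (cases "s > 0") (auto simp: abs_mult flat_def)
  show "\<bar>n * t * flat 2 s\<bar> \<le> 1 / s + 1 / s\<^sup>2" if "s > 0"
    unfolding * using flat_2_bounds[OF that] that by (auto simp: abs_mult)
qed

text \<open>
  The derivative grows like \<open>n\<close> but is felt only where \<open>t\<close> has order \<open>1 / n\<close>, or else where it is
  already small: multiplied by \<open>t\<close> it stays bounded, and it tends to zero pointwise.
\<close>

lemma crack_cutoff'_bound: "\<bar>e\<bar> \<le> 1 \<Longrightarrow> \<bar>t * crack_cutoff' e n t\<bar> \<le> 6"
proof -
  assume e: "\<bar>e\<bar> \<le> 1"
  have "t * crack_cutoff' e n t = n * t * flat 2 (n * t + (-1)) + e * ((- n) * t * flat 2 (- n * t + (-1)))"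
    by (simp add: crack_cutoff'_def algebra_simps)
  moreover have "\<bar>n * t * flat 2 (n * t + (-1))\<bar> \<le> 3"
    by (rule flat_2_scaled_bounds) simp
  moreover have "\<bar>e * ((- n) * t * flat 2 (- n * t + (-1)))\<bar> \<le> 1 * 3"
    unfolding abs_mult[of e] by (intro mult_mono e flat_2_scaled_bounds) auto
  ultimately show ?thesis by linarith
qed

lemma filterlim_scaled: "t > 0 \<Longrightarrow> filterlim (\<lambda>n. real n * t + (-1)) at_top sequentially"
  using filterlim_tendsto_add_at_top[OF tendsto_const[of "-1"]
      filterlim_tendsto_pos_mult_at_top[OF tendsto_const[of t] _ filterlim_real_sequentially]]
  by (simp add: add.commute mult.commute)

lemma inverse_tendsto_at_top: "((\<lambda>t::real. 1 / t) \<longlongrightarrow> 0) at_top"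
  using tendsto_inverse_0_at_top[OF filterlim_ident] by (simp add: inverse_eq_divide)

lemma flat_0_tendsto: "(flat 0 \<longlongrightarrow> 1) at_top"
proof (rule Lim_transform_eventually)
  show "((\<lambda>t::real. exp (- (1 / t))) \<longlongrightarrow> 1) at_top"
    using tendsto_exp[OF tendsto_minus[OF inverse_tendsto_at_top]] by simp
  show "\<forall>\<^sub>F t in at_top. exp (- (1 / t)) = flat 0 t"
    using eventually_gt_at_top[of 0] by eventually_elim (simp add: flat_def)
qed

lemma crack_cutoff_tendsto:
  assumes "t \<noteq> 0"
  shows "(\<lambda>n. crack_cutoff e (real n) t) \<longlonglongrightarrow> side_weight e t"
proof (cases "t > 0")
  case True
  have "crack_cutoff e (real n) t = flat 0 (real n * t + (-1))" for n
  proof -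
    have "0 \<le> real n * t" using True by simp
    then have "- real n * t + (-1) \<le> 0" by linarith
    from flat_nonpos[OF this, of 0] show ?thesis by (simp add: crack_cutoff_def)
  qed
  then show ?thesis
    using filterlim_compose[OF flat_0_tendsto filterlim_scaled[OF True]] True by (simp add: side_weight_def)
next
  case False
  then have t: "- t > 0" using assms by simp
  have "crack_cutoff e (real n) t = e * flat 0 (real n * (- t) + (-1))" for n
  proof -
    have "real n * t \<le> 0" using t by (simp add: mult_nonneg_nonpos)
    then have "real n * t + (-1) \<le> 0" by linarith
    from flat_nonpos[OF this, of 0] show ?thesis by (simp add: crack_cutoff_def)
  qed
  then show ?thesis
    using tendsto_mult[OF tendsto_const[of e] filterlim_compose[OF flat_0_tendsto filterlim_scaled[OF t]]] t
    by (simp add: side_weight_def)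
qed

lemma flat_2_scaled_tendsto: "t > 0 \<Longrightarrow> (\<lambda>n. real n * t * flat 2 (real n * t + (-1))) \<longlonglongrightarrow> 0"
proof (rule tendsto_rabs_zero_cancel, rule tendsto_sandwich[OF _ _ tendsto_const])
  assume t: "t > 0"
  show "\<forall>\<^sub>F n in sequentially. \<bar>real n * t * flat 2 (real n * t + (-1))\<bar> \<le>
      1 / (real n * t + (-1)) + 1 / (real n * t + (-1))\<^sup>2"
    using filterlim_scaled[OF t, unfolded filterlim_at_top_dense, rule_format, of 0]
    by eventually_elim (rule flat_2_scaled_bounds, auto)
  show "(\<lambda>n. 1 / (real n * t + (-1)) + 1 / (real n * t + (-1))\<^sup>2) \<longlonglongrightarrow> 0"
  proof -
    have "((\<lambda>s::real. 1 / s + 1 / s\<^sup>2) \<longlongrightarrow> 0 + 0\<^sup>2) at_top"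
      using tendsto_add[OF inverse_tendsto_at_top tendsto_power[OF inverse_tendsto_at_top, of 2]]
      by (simp add: power_divide)
    then show ?thesis
      using filterlim_compose[OF _ filterlim_scaled[OF t]] by fastforce
  qed
qed simp

lemma crack_cutoff'_tendsto:
  assumes "t \<noteq> 0"
  shows "(\<lambda>n. t * crack_cutoff' e (real n) t) \<longlonglongrightarrow> 0"
proof (cases "t > 0")
  case True
  have "t * crack_cutoff' e (real n) t = real n * t * flat 2 (real n * t + (-1))" for n
  proof -
    have "0 \<le> real n * t" using True by simp
    then have "- real n * t + (-1) \<le> 0" by linarith
    from flat_nonpos[OF this, of 2] show ?thesis by (simp add: crack_cutoff'_def)
  qed
  then show ?thesis using flat_2_scaled_tendsto[OF True] by (simp only:)
next
  case False
  then have t: "- t > 0" using assms by simp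
  have "t * crack_cutoff' e (real n) t = e * (real n * (- t) * flat 2 (real n * (- t) + (-1)))" for n
  proof -
    have "real n * t \<le> 0" using t by (simp add: mult_nonneg_nonpos)
    then have "real n * t + (-1) \<le> 0" by linarith
    from flat_nonpos[OF this, of 2] show ?thesis by (simp add: crack_cutoff'_def)
  qed
  then show ?thesis
    using tendsto_mult[OF tendsto_const[of e] flat_2_scaled_tendsto[OF t]] by (simp only: mult_zero_right)
qed

lemma has_grad_crack_cutoff: "has_grad (\<lambda>p. crack_cutoff e n (p $ i)) (\<lambda>p. crack_cutoff' e n (p $ i) *\<^sub>R axis i 1)"
proof -
  have "has_grad (\<lambda>p. flat 0 (n * p $ i + (-1)) + e * flat 0 ((- n) * p $ i + (-1)))
    (\<lambda>p. (flat (0 + 2) (n * p $ i + (-1)) - real 0 * flat (Suc 0) (n * p $ i + (-1))) *\<^sub>R (n *\<^sub>R axis i 1)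
      + e *\<^sub>R ((flat (0 + 2) ((- n) * p $ i + (-1)) - real 0 * flat (Suc 0) ((- n) * p $ i + (-1))) *\<^sub>R ((- n) *\<^sub>R axis i 1)))"
    by (intro has_grad_add has_grad_scale has_grad_flat)
  then show ?thesis
    unfolding crack_cutoff_def crack_cutoff'_def by (simp add: numeral_2_eq_2 algebra_simps)
qed

lemma smooth_crack_cutoff: "smooth (\<lambda>p. crack_cutoff e n (p $ i))"
  unfolding crack_cutoff_def by (intro smooth_intros)

definition tangential :: "(real^3 \<Rightarrow> real^3) \<Rightarrow> bool" where
  "tangential X \<longleftrightarrow> (\<forall>p\<in>sphere 0 1. X p \<bullet> p = 0)"

text \<open>
  The support keeps the distance \<open>1 / n\<close> from both planes, hence from the crack.
\<close>

lemma crack_cutoff_test_field: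
  assumes \<Omega>: "{p \<in> sphere 0 1. p $ 1 \<noteq> 0 \<and> p $ 2 \<noteq> 0} \<subseteq> \<Omega>"
    and X: "smooth_field X" "tangential X" and n: "n > 0"
  shows "test_field \<Omega> (\<lambda>p. (crack_cutoff e n (p $ 1) * crack_cutoff d n (p $ 2)) *\<^sub>R X p)"
  unfolding test_field_def
proof (intro conjI allI ballI exI)
  show "Ck k (\<lambda>p. (crack_cutoff e n (p $ 1) * crack_cutoff d n (p $ 2)) *\<^sub>R X p)" for k
    using X by (intro smooth_field_Ck smooth_field_scaleR smooth_mult smooth_crack_cutoff)
  show "((crack_cutoff e n (p $ 1) * crack_cutoff d n (p $ 2)) *\<^sub>R X p) \<bullet> p = 0" if "p \<in> sphere 0 1" for p
    using X that by (simp add: tangential_def)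
  let ?K = "sphere 0 1 \<inter> {p::real^3. 1 / n \<le> \<bar>p $ 1\<bar>} \<inter> {p. 1 / n \<le> \<bar>p $ 2\<bar>}"
  have "closed {p::real^3. 1 / n \<le> \<bar>p $ i\<bar>}" for i
    by (intro closed_Collect_le continuous_intros)
  then show "compact ?K" by (intro compact_Int_closed) auto
  show "?K \<subseteq> \<Omega>" using \<Omega> n by auto
  show "(crack_cutoff e n (p $ 1) * crack_cutoff d n (p $ 2)) *\<^sub>R X p = 0" if "p \<in> sphere 0 1 - ?K" for p
  proof -
    have "n * \<bar>p $ 1\<bar> \<le> 1 \<or> n * \<bar>p $ 2\<bar> \<le> 1"
      using that n by (auto simp: field_simps)
    then show ?thesis using crack_cutoff_zero[of n] n by auto
  qed
qed

text \<open>
  This replaces the theory of traces. Multiply \<open>X\<close> by cutoffs that vanish near the planes and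
  tend to the weights; the field becomes a test field. The product rule produces the term in which
  the derivative of a cutoff meets the component of \<open>X\<close> across the plane. That component is of the
  order of the distance to the plane, so the term is bounded and tends to zero, and dominated
  convergence applies. The weights may have different signs on the two sides of a plane because
  nothing flows through it.
\<close>

lemma weak_pair_cutoff:
  assumes wp: "weak_pair \<Omega> w G"
    and \<Omega>: "{p \<in> sphere 0 1. p $ 1 \<noteq> 0 \<and> p $ 2 \<noteq> 0} \<subseteq> \<Omega>"
    and X: "smooth_field X" "tangential X"
    and C: "\<And>p. p \<in> sphere 0 1 \<Longrightarrow> \<bar>X p $ 1\<bar> \<le> C * \<bar>p $ 1\<bar>"
           "\<And>p. p \<in> sphere 0 1 \<Longrightarrow> \<bar>X p $ 2\<bar> \<le> C * \<bar>p $ 2\<bar>"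
    and e: "\<bar>e\<bar> \<le> 1" "\<bar>d\<bar> \<le> 1"
  shows "(\<integral>\<^sub>S p. side_weight e (p $ 1) * side_weight d (p $ 2) * (w p * sphere_div X p)) =
    - (\<integral>\<^sub>S p. side_weight e (p $ 1) * side_weight d (p $ 2) * (G p \<bullet> X p))"
proof -
  have w: "square_integrable w" and G: "square_integrable G" using wp by (auto simp: weak_pair_def)
  note [measurable] = square_integrable_measurable[OF w] square_integrable_measurable[OF G]
    borel_measurable_continuous_onI[OF smooth_continuous[OF smooth_sphere_div[OF X(1)]]]
    borel_measurable_continuous_onI[OF smooth_field_continuous[OF X(1)]]
    borel_measurable_continuous_onI[OF smooth_continuous[OF smooth_crack_cutoff]]
  let ?c = "\<lambda>n p. crack_cutoff e (real (Suc n)) (p $ 1) * crack_cutoff d (real (Suc n)) (p $ 2)"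
  let ?X = "\<lambda>n p. ?c n p *\<^sub>R X p"
  \<comment> \<open>the gradient of the product of the two cutoffs\<close>
  let ?g = "\<lambda>n p. crack_cutoff e (real (Suc n)) (p $ 1) *\<^sub>R (crack_cutoff' d (real (Suc n)) (p $ 2) *\<^sub>R axis 2 1)
    + crack_cutoff d (real (Suc n)) (p $ 2) *\<^sub>R (crack_cutoff' e (real (Suc n)) (p $ 1) *\<^sub>R axis 1 (1::real))"
  let ?s = "\<lambda>p. side_weight e (p $ 1) * side_weight d (p $ 2)"
  have div: "sphere_div (?X n) p = ?c n p * sphere_div X p + ?g n p \<bullet> X p"
    if "p \<in> sphere 0 1" for n p
  proof -
    have "has_grad (?c n) (?g n)"
      by (intro has_grad_mult has_grad_crack_cutoff)
    from sphere_div_scaleR[OF this smooth_field_differentiable[OF X(1)]]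
    show ?thesis using X(2) that by (simp add: tangential_def)
  qed
  have sdiv: "sphere_div (?X n) \<in> borel_measurable borel" for n
    by (intro borel_measurable_continuous_onI smooth_continuous smooth_sphere_div smooth_field_scaleR
        smooth_mult smooth_crack_cutoff X)
  have eq: "(\<integral>\<^sub>S p. w p * sphere_div (?X n) p) = - (\<integral>\<^sub>S p. G p \<bullet> ?X n p)" for n
    using wp crack_cutoff_test_field[OF \<Omega> X, of "real (Suc n)" e d] by (simp add: weak_pair_def)
  have clim: "(\<lambda>n. crack_cutoff e (real (Suc n)) t) \<longlonglongrightarrow> side_weight e t" if "t \<noteq> 0" for t e
    using LIMSEQ_Suc[OF crack_cutoff_tendsto[OF that]] .
  have c'lim: "(\<lambda>n. y * crack_cutoff' e (real (Suc n)) t) \<longlonglongrightarrow> 0" if "t \<noteq> 0" for t e y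
    using tendsto_mult[OF tendsto_const[of "y / t"] LIMSEQ_Suc[OF crack_cutoff'_tendsto[OF that, of e]]] that
    by simp
  have cb: "\<bar>?c n p\<bar> \<le> 4" for n p
    unfolding abs_mult
    using mult_mono[OF crack_cutoff_bound[OF e(1), of "real (Suc n)" "p $ 1"] crack_cutoff_bound[OF e(2), of "real (Suc n)" "p $ 2"]]
    by simp
  have c'b: "\<bar>crack_cutoff' e n t * x\<bar> \<le> 6 * C" if "\<bar>e\<bar> \<le> 1" "\<bar>x\<bar> \<le> C * \<bar>t\<bar>" "C \<ge> 0" for e n t x
  proof -
    have "\<bar>crack_cutoff' e n t * x\<bar> \<le> \<bar>crack_cutoff' e n t\<bar> * (C * \<bar>t\<bar>)"
      unfolding abs_mult using that by (intro mult_left_mono) auto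
    also have "\<dots> = C * \<bar>t * crack_cutoff' e n t\<bar>" by (simp add: abs_mult)
    also have "\<dots> \<le> C * 6" using crack_cutoff'_bound[OF that(1)] that(3) by (intro mult_left_mono) auto
    finally show ?thesis by simp
  qed
  have C0: "C \<ge> 0"
    using C(1)[of "axis 1 1"] by (auto simp: norm_axis_1 axis_nth)
  \<comment> \<open>the critical term: the gradient of the cutoff against the component of the field across the planes\<close>
  have gb: "\<bar>?g n p \<bullet> X p\<bar> \<le> 24 * C" if p: "p \<in> sphere 0 1" for n p
  proof -
    have "\<bar>crack_cutoff e (real (Suc n)) (p $ 1) * (crack_cutoff' d (real (Suc n)) (p $ 2) * X p $ 2)\<bar> \<le> 2 * (6 * C)"
      unfolding abs_mult[of "crack_cutoff _ _ _"] using c'b[OF e(2) C(2)[OF p] C0] crack_cutoff_bound[OF e(1)]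
      by (intro mult_mono) auto
    moreover have "\<bar>crack_cutoff d (real (Suc n)) (p $ 2) * (crack_cutoff' e (real (Suc n)) (p $ 1) * X p $ 1)\<bar> \<le> 2 * (6 * C)"
      unfolding abs_mult[of "crack_cutoff _ _ _"] using c'b[OF e(1) C(1)[OF p] C0] crack_cutoff_bound[OF e(2)]
      by (intro mult_mono) auto
    ultimately show ?thesis by (simp add: inner_add_left inner_axis')
  qed
  obtain B where B: "B \<ge> 0" "\<And>p. p \<in> sphere 0 1 \<Longrightarrow> norm (sphere_div X p) \<le> B"
    using continuous_bounded_on_sphere[OF smooth_continuous[OF smooth_sphere_div[OF X(1)]]] by blast
  have "(\<lambda>n. \<integral>\<^sub>S p. w p * sphere_div (?X n) p) \<longlonglongrightarrow>
      (\<integral>\<^sub>S p. ?s p * (w p * sphere_div X p))"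
  proof (rule integral_dominated_convergence[where w = "\<lambda>p. \<bar>w p\<bar> * (4 * B + 24 * C)"])
    show "integrable sphere_measure (\<lambda>p. \<bar>w p\<bar> * (4 * B + 24 * C))"
      using square_integrable_imp_integrable[OF w] by simp
    show "AE p in sphere_measure. (\<lambda>n. w p * sphere_div (?X n) p) \<longlonglongrightarrow> ?s p * (w p * sphere_div X p)"
      using AE_sphere AE_coord_nonzero[of 1] AE_coord_nonzero[of 2]
    proof eventually_elim
      case (elim p)
      have "(\<lambda>n. w p * (?c n p * sphere_div X p
          + (crack_cutoff e (real (Suc n)) (p $ 1) * (X p $ 2 * crack_cutoff' d (real (Suc n)) (p $ 2))
          + crack_cutoff d (real (Suc n)) (p $ 2) * (X p $ 1 * crack_cutoff' e (real (Suc n)) (p $ 1)))))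
        \<longlonglongrightarrow> w p * (?s p * sphere_div X p + (side_weight e (p $ 1) * 0 + side_weight d (p $ 2) * 0))"
        using elim by (intro tendsto_intros clim c'lim) auto
      then show ?case
        unfolding div[OF elim(1)] by (simp add: inner_add_left inner_axis' mult_ac)
    qed
    show "AE p in sphere_measure. norm (w p * sphere_div (?X n) p) \<le> \<bar>w p\<bar> * (4 * B + 24 * C)" for n
      using AE_sphere
    proof eventually_elim
      case (elim p)
      have "\<bar>?c n p * sphere_div X p\<bar> \<le> 4 * B"
        unfolding abs_mult[of "_ * _" "sphere_div X p"] using cb B(2)[OF elim] B(1) by (intro mult_mono) auto
      then have "\<bar>sphere_div (?X n) p\<bar> \<le> 4 * B + 24 * C"
        unfolding div[OF elim] using gb[OF elim, of n] by linarith
      then show ?case by (simp add: abs_mult mult_left_mono)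
    qed
  qed (use sdiv in measurable)
  moreover have "(\<lambda>n. \<integral>\<^sub>S p. G p \<bullet> ?X n p) \<longlonglongrightarrow>
      (\<integral>\<^sub>S p. ?s p * (G p \<bullet> X p))"
  proof (rule integral_dominated_convergence[where w = "\<lambda>p. 4 * \<bar>G p \<bullet> X p\<bar>"])
    show "integrable sphere_measure (\<lambda>p. 4 * \<bar>G p \<bullet> X p\<bar>)"
      using square_integrable_inner[OF G square_integrable_smooth_field[OF X(1)]] by simp
    show "AE p in sphere_measure. (\<lambda>n. G p \<bullet> ?X n p) \<longlonglongrightarrow> ?s p * (G p \<bullet> X p)"
      using AE_coord_nonzero[of 1] AE_coord_nonzero[of 2]
    proof eventually_elim
      case (elim p)
      have "(\<lambda>n. ?c n p * (G p \<bullet> X p)) \<longlonglongrightarrow> ?s p * (G p \<bullet> X p)"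
        using elim by (intro tendsto_intros clim) auto
      then show ?case by simp
    qed
    show "AE p in sphere_measure. norm (G p \<bullet> ?X n p) \<le> 4 * \<bar>G p \<bullet> X p\<bar>" for n
      using cb by (intro AE_I2) (auto simp: abs_mult intro!: mult_right_mono)
  qed measurable
  ultimately show ?thesis
    unfolding eq using LIMSEQ_unique tendsto_minus by blast
qed

section \<open>Density of polynomials and uniqueness of weak gradients\<close>

definition poly_approx :: "(real^3 \<Rightarrow> real) \<Rightarrow> bool" where
  "poly_approx f \<longleftrightarrow> square_integrable f \<and> (\<forall>e>0. \<exists>P. real_polynomial_function P \<and>
     (\<integral>\<^sub>S p. (f p - P p)\<^sup>2) < e)"

lemma real_polynomial_function_smooth: "real_polynomial_function P \<Longrightarrow> smooth P"
proof (induction rule: real_polynomial_function.induct)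
  case (linear f)
  have "f p = (\<Sum>i\<in>UNIV. f (axis i 1) * p $ i)" for p
  proof -
    have "(\<Sum>i\<in>UNIV. p $ i *\<^sub>R axis i 1) = p"
      by (subst vec_eq_iff) (simp add: forall_3 sum_3 axis_def)
    then have "f p = f (\<Sum>i\<in>UNIV. p $ i *\<^sub>R axis i 1)" by simp
    also have "\<dots> = (\<Sum>i\<in>UNIV. p $ i *\<^sub>R f (axis i 1))"
      using linear by (simp only: linear_sum[OF bounded_linear.linear] linear_scale[OF bounded_linear.linear])
    finally show ?thesis by (simp add: mult.commute)
  qed
  then have "f = (\<lambda>p. \<Sum>i\<in>UNIV. f (axis i 1) * p $ i)" by blast
  moreover have "smooth (\<lambda>p. \<Sum>i\<in>UNIV. f (axis i 1) * p $ i)" by (intro smooth_intros)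
  ultimately show ?case by (simp only:)
qed (auto intro: smooth_intros)

lemma square_integral_le_twice:
  fixes f g h :: "real^3 \<Rightarrow> real"
  assumes "square_integrable f" "square_integrable g" "square_integrable h"
  shows "(\<integral>\<^sub>S p. (f p - h p)\<^sup>2) \<le>
    2 * (\<integral>\<^sub>S p. (f p - g p)\<^sup>2) + 2 * (\<integral>\<^sub>S p. (g p - h p)\<^sup>2)"
proof -
  have i: "integrable sphere_measure (\<lambda>p. (u p - v p)\<^sup>2)" if "square_integrable u" "square_integrable v" for u v :: "real^3 \<Rightarrow> real"
    using square_integrable_integrable[OF square_integrable_diff[OF that]] by simp
  have "(\<integral>\<^sub>S p. (f p - h p)\<^sup>2) \<le>
    (\<integral>\<^sub>S p. 2 * (f p - g p)\<^sup>2 + 2 * (g p - h p)\<^sup>2)"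
  proof (rule integral_mono)
    fix p
    have "0 \<le> ((f p - g p) - (g p - h p))\<^sup>2" by simp
    then show "(f p - h p)\<^sup>2 \<le> 2 * (f p - g p)\<^sup>2 + 2 * (g p - h p)\<^sup>2"
      by (simp add: power2_eq_square algebra_simps)
  qed (use assms i in auto)
  also have "\<dots> = 2 * (\<integral>\<^sub>S p. (f p - g p)\<^sup>2) + 2 * (\<integral>\<^sub>S p. (g p - h p)\<^sup>2)"
    using assms i by simp
  finally show ?thesis .
qed

lemma poly_approx_limit:
  assumes f: "square_integrable f" and g: "\<And>n. poly_approx (g n)"
    and lim: "(\<lambda>n. \<integral>\<^sub>S p. (f p - g n p)\<^sup>2) \<longlonglongrightarrow> 0"
  shows "poly_approx f"
  unfolding poly_approx_def
proof (intro conjI allI impI f)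
  fix e :: real assume "e > 0"
  then have "\<forall>\<^sub>F n in sequentially. (\<integral>\<^sub>S p. (f p - g n p)\<^sup>2) < e / 4"
    using order_tendstoD(2)[OF lim, of "e / 4"] by simp
  then obtain n where n: "(\<integral>\<^sub>S p. (f p - g n p)\<^sup>2) < e / 4"
    using eventually_happens trivial_limit_sequentially by blast
  obtain P where P: "real_polynomial_function P" "(\<integral>\<^sub>S p. (g n p - P p)\<^sup>2) < e / 4"
    using g[of n] \<open>e > 0\<close> unfolding poly_approx_def by (meson zero_less_divide_iff zero_less_numeral)
  have "square_integrable (g n)" using g by (simp add: poly_approx_def)
  then have "(\<integral>\<^sub>S p. (f p - P p)\<^sup>2) < e"
    using square_integral_le_twice[OF f _ square_integrable_smooth[OF real_polynomial_function_smooth[OF P(1)]], of "g n"] n P(2)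
    by linarith
  then show "\<exists>P. real_polynomial_function P \<and> (\<integral>\<^sub>S p. (f p - P p)\<^sup>2) < e"
    using P(1) by blast
qed

lemma poly_approx_sequence:
  assumes "poly_approx f"
  obtains P where "\<And>n. real_polynomial_function (P n)"
    "(\<lambda>n. \<integral>\<^sub>S p. (f p - P n p)\<^sup>2) \<longlonglongrightarrow> 0"
proof -
  have "\<exists>P. real_polynomial_function P \<and> (\<integral>\<^sub>S p. (f p - P p)\<^sup>2) < 1 / real (Suc n)" for n
    using assms unfolding poly_approx_def by simp
  then obtain P where P: "\<And>n. real_polynomial_function (P n)"
    "\<And>n. (\<integral>\<^sub>S p. (f p - P n p)\<^sup>2) < 1 / real (Suc n)" by metis
  have "(\<lambda>n. \<integral>\<^sub>S p. (f p - P n p)\<^sup>2) \<longlonglongrightarrow> 0"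
  proof (rule tendsto_sandwich[OF _ _ tendsto_const])
    show "(\<lambda>n. 1 / real (Suc n)) \<longlonglongrightarrow> 0"
      using LIMSEQ_inverse_real_of_nat by (simp add: inverse_eq_divide)
    show "\<forall>\<^sub>F n in sequentially. (\<integral>\<^sub>S p. (f p - P n p)\<^sup>2) \<le> 1 / real (Suc n)"
      using P(2) less_imp_le by (intro always_eventually) blast
  qed simp
  with P(1) show thesis by (rule that)
qed

lemma poly_approx_polynomial: "real_polynomial_function P \<Longrightarrow> poly_approx P"
  unfolding poly_approx_def
  using square_integrable_smooth[OF real_polynomial_function_smooth] by (auto intro!: exI[of _ P])

lemma poly_approx_add:
  assumes f: "poly_approx f" and g: "poly_approx g"
  shows "poly_approx (\<lambda>p. f p + g p)"
  unfolding poly_approx_def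
proof (intro conjI allI impI)
  have s: "square_integrable f" "square_integrable g" using f g by (auto simp: poly_approx_def)
  then show "square_integrable (\<lambda>p. f p + g p)" by (rule square_integrable_add)
  fix e :: real assume "e > 0"
  obtain P where P: "real_polynomial_function P" "(\<integral>\<^sub>S p. (f p - P p)\<^sup>2) < e / 4"
    using f \<open>e > 0\<close> unfolding poly_approx_def by (meson zero_less_divide_iff zero_less_numeral)
  obtain Q where Q: "real_polynomial_function Q" "(\<integral>\<^sub>S p. (g p - Q p)\<^sup>2) < e / 4"
    using g \<open>e > 0\<close> unfolding poly_approx_def by (meson zero_less_divide_iff zero_less_numeral)
  have sP: "square_integrable P" "square_integrable Q"
    using P Q by (auto intro: square_integrable_smooth real_polynomial_function_smooth)
  have "(\<integral>\<^sub>S p. (f p + g p - (P p + Q p))\<^sup>2) \<le>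
    2 * (\<integral>\<^sub>S p. (f p + g p - (P p + g p))\<^sup>2) +
    2 * (\<integral>\<^sub>S p. (P p + g p - (P p + Q p))\<^sup>2)"
    by (rule square_integral_le_twice) (intro square_integrable_add s sP)+
  then have "(\<integral>\<^sub>S p. (f p + g p - (P p + Q p))\<^sup>2) < e"
    using P(2) Q(2) by simp
  then show "\<exists>P. real_polynomial_function P \<and> (\<integral>\<^sub>S p. (f p + g p - P p)\<^sup>2) < e"
    using real_polynomial_function.intros(3)[OF P(1) Q(1)] by blast
qed

lemma poly_approx_cmult:
  assumes f: "poly_approx f" shows "poly_approx (\<lambda>p. c * f p)"
proof -
  obtain P where P: "\<And>n. real_polynomial_function (P n)"
    "(\<lambda>n. \<integral>\<^sub>S p. (f p - P n p)\<^sup>2) \<longlonglongrightarrow> 0"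
    using poly_approx_sequence[OF f] by blast
  show ?thesis
  proof (rule poly_approx_limit)
    show "square_integrable (\<lambda>p. c * f p)" using f by (simp add: poly_approx_def square_integrable_cmult)
    show "poly_approx (\<lambda>p. c * P n p)" for n
      by (rule poly_approx_polynomial[OF real_polynomial_function.intros(4)[OF
              real_polynomial_function.intros(2) P(1)]])
    have "(c * f p - c * P n p)\<^sup>2 = c\<^sup>2 * (f p - P n p)\<^sup>2" for p n
      by (simp add: power_mult_distrib[symmetric] right_diff_distrib)
    then show "(\<lambda>n. \<integral>\<^sub>S p. (c * f p - c * P n p)\<^sup>2) \<longlonglongrightarrow> 0"
      using tendsto_mult[OF tendsto_const P(2), of "c\<^sup>2"] by simp
  qed
qed

lemma poly_approx_sum:
  "(\<And>i. i \<in> I \<Longrightarrow> poly_approx (f i)) \<Longrightarrow> poly_approx (\<lambda>p. \<Sum>i\<in>I. f i p)"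
proof (induction I rule: infinite_finite_induct)
  case (insert x F)
  then show ?case by (auto intro: poly_approx_add)
qed (auto intro: poly_approx_polynomial real_polynomial_function.intros)

text \<open>
  The Stone-Weierstrass theorem on the compact sphere, whose area is finite.
\<close>

lemma poly_approx_continuous:
  assumes f: "continuous_on UNIV f" shows "poly_approx f"
  unfolding poly_approx_def
proof (intro conjI allI impI square_integrable_continuous f)
  fix e :: real assume e: "e > 0"
  let ?m = "measure sphere_measure UNIV"
  \<comment> \<open>one is added to the area so that the denominator is visibly positive\<close>
  define \<delta> where "\<delta> = sqrt (e / (2 * (?m + 1)))"
  have m: "?m \<ge> 0" by simp
  have "0 < e / (2 * (?m + 1))" 
    using e add_nonneg_pos[OF m zero_less_one] by (intro divide_pos_pos mult_pos_pos) auto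
  then have \<delta>: "\<delta> > 0" "\<delta>\<^sup>2 = e / (2 * (?m + 1))" by (auto simp: \<delta>_def simp del: distrib_left_numeral)
  obtain P where P: "real_polynomial_function P" "\<And>p. p \<in> sphere 0 1 \<Longrightarrow> \<bar>f p - P p\<bar> < \<delta>"
    using Stone_Weierstrass_real_polynomial_function[OF compact_sphere continuous_on_subset[OF f subset_UNIV] \<delta>(1)]
    by metis
  have "(\<integral>\<^sub>S p. (f p - P p)\<^sup>2) \<le> (\<integral>\<^sub>S p. \<delta>\<^sup>2)"
  proof (rule integral_mono_AE)
    show "integrable sphere_measure (\<lambda>p. (f p - P p)\<^sup>2)"
      using f smooth_continuous[OF real_polynomial_function_smooth[OF P(1)]]
      by (intro continuous_integrable continuous_intros) auto
    show "AE p in sphere_measure. (f p - P p)\<^sup>2 \<le> \<delta>\<^sup>2"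
      using AE_sphere
    proof eventually_elim
      case (elim p)
      show ?case using P(2)[OF elim] by (metis abs_ge_zero less_imp_le power2_abs power_mono)
    qed
  qed simp
  also have "\<dots> = ?m * (e / (2 * (?m + 1)))" by (simp add: \<delta>)
  also have "\<dots> < e"
  proof -
    have "x * (e / (2 * (x + 1))) < e" if "x \<ge> 0" for x :: real
      using that e mult_nonneg_nonneg[of e x] by (simp add: field_simps add_nonneg_pos)
    then show ?thesis using m by blast
  qed
  finally show "\<exists>P. real_polynomial_function P \<and> (\<integral>\<^sub>S p. (f p - P p)\<^sup>2) < e"
    using P(1) by blast
qed

lemma square_integrable_bounded:
  fixes f :: "real^3 \<Rightarrow> real"
  assumes "f \<in> borel_measurable borel" "\<And>p. \<bar>f p\<bar> \<le> B" shows "square_integrable f"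
  using square_integrable_mult_bounded[OF square_integrable_continuous[of "\<lambda>_. 1::real"], of f B] assms by simp

lemma square_integrable_indicator: "A \<in> sets borel \<Longrightarrow> square_integrable (indicator A :: real^3 \<Rightarrow> real)"
  by (rule square_integrable_bounded[of _ 1]) (auto simp: indicator_def)

lemma poly_approx_indicator_closed:
  assumes C: "closed C" shows "poly_approx (indicator C)"
proof (cases "C = {}")
  case True
  then show ?thesis
    using poly_approx_polynomial[OF real_polynomial_function.intros(2)[of 0]] by (simp add: indicator_def[abs_def])
next
  case False
  \<comment> \<open>continuous functions that decrease to the indicator of \<open>C\<close>\<close>
  let ?g = "\<lambda>n p. max 0 (1 - real n * infdist p C)"
  show ?thesis
  proof (rule poly_approx_limit)
    have [measurable]: "C \<in> sets borel" using C by simp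
    show "square_integrable (indicator C :: real^3 \<Rightarrow> real)" by (rule square_integrable_indicator) simp
    have cont: "continuous_on UNIV (?g n)" for n by (intro continuous_intros)
    then show "poly_approx (?g n)" for n by (rule poly_approx_continuous)
    have [measurable]: "?g n \<in> borel_measurable borel" for n
      using cont by (rule borel_measurable_continuous_onI)
    have "(\<lambda>n. \<integral>\<^sub>S p. (indicator C p - ?g n p)\<^sup>2) \<longlonglongrightarrow> (\<integral>\<^sub>S p. 0)"
    proof (rule integral_dominated_convergence[where w = "\<lambda>_. 1"])
      show "AE p in sphere_measure. (\<lambda>n. (indicator C p - ?g n p)\<^sup>2) \<longlonglongrightarrow> 0"
      proof (intro AE_I2)
        fix p
        have "(\<lambda>n. ?g n p) \<longlonglongrightarrow> indicator C p"
        proof (cases "p \<in> C")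
          case True
          then show ?thesis by simp
        next
          case False
          then have d: "infdist p C > 0"
            using C \<open>C \<noteq> {}\<close> by (simp add: in_closed_iff_infdist_zero infdist_nonneg less_le)
          have "\<forall>\<^sub>F n in sequentially. ?g n p = 0"
            using eventually_ge_at_top[of "nat \<lceil>1 / infdist p C\<rceil>"]
          proof eventually_elim
            case (elim n)
            then have "1 / infdist p C \<le> real n" by linarith
            then show ?case using d by (simp add: field_simps)
          qed
          then show ?thesis using False by (simp add: tendsto_eventually)
        qed
        then have "(\<lambda>n. (indicator C p - ?g n p)\<^sup>2) \<longlonglongrightarrow> (indicator C p - indicator C p)\<^sup>2"
          by (intro tendsto_intros)
        then show "(\<lambda>n. (indicator C p - ?g n p)\<^sup>2) \<longlonglongrightarrow> 0" by simp
      qed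
      have "0 \<le> ?g n p \<and> ?g n p \<le> 1" for n p using infdist_nonneg[of p C] by simp
      then show "AE p in sphere_measure. norm ((indicator C p - ?g n p)\<^sup>2) \<le> 1" for n
        by (intro AE_I2) (auto simp: indicator_def power_le_one abs_square_le_1 abs_le_iff)
    qed auto
    then show "(\<lambda>n. \<integral>\<^sub>S p. (indicator C p - ?g n p)\<^sup>2) \<longlonglongrightarrow> 0" by simp
  qed
qed

text \<open>
  The class of approximable sets is closed under complements and disjoint unions, and it contains
  the closed sets, which generate the Borel sets and are stable under intersection.
\<close>

lemma poly_approx_indicator:
  assumes "A \<in> sets borel" shows "poly_approx (indicator A)"
proof -
  have "Int_stable (Collect closed :: (real^3) set set)" "Collect closed \<subseteq> Pow UNIV"
    "A \<in> sigma_sets UNIV (Collect closed)"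
    using assms unfolding borel_eq_closed by (auto simp: Int_stable_def)
  then show ?thesis
  proof (induction rule: sigma_sets_induct_disjoint)
    case (basic A)
    then show ?case by (simp add: poly_approx_indicator_closed)
  next
    case empty
    then show ?case using poly_approx_indicator_closed[OF closed_empty] by (simp only:)
  next
    case (compl A)
    have "poly_approx (\<lambda>p. 1 + (-1) * indicator A p)"
      by (intro poly_approx_add poly_approx_cmult compl poly_approx_polynomial real_polynomial_function.intros)
    moreover have "(\<lambda>p. 1 + (-1) * indicator A p) = (indicator (UNIV - A) :: real^3 \<Rightarrow> real)"
      by (auto simp: indicator_def)
    ultimately show ?case by simp
  next
    case (union A)
    have sA: "A n \<in> sets borel" for n
      using union(2) unfolding borel_eq_closed by auto
    then have [measurable]: "A n \<in> sets borel" for n .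
    show ?case
    proof (rule poly_approx_limit)
      show "square_integrable (indicator (\<Union> (range A)) :: real^3 \<Rightarrow> real)"
        using sA by (intro square_integrable_indicator) auto
      show "poly_approx (\<lambda>p. \<Sum>i<n. indicator (A i) p)" for n
        by (intro poly_approx_sum union)
      have ind: "(\<Sum>i<n. indicator (A i) p) = (indicator (\<Union>i<n. A i) p :: real)" for n p
        using union(1) by (subst indicator_UN_disjoint) (auto intro: disjoint_family_on_mono)
      have "(\<lambda>n. \<integral>\<^sub>S p. (indicator (\<Union> (range A)) p - (\<Sum>i<n. indicator (A i) p :: real))\<^sup>2)
        \<longlonglongrightarrow> (\<integral>\<^sub>S p. 0)"
      proof (rule integral_dominated_convergence[where w = "\<lambda>_. 1"])
        show "AE p in sphere_measure. (\<lambda>n. (indicator (\<Union> (range A)) p - (\<Sum>i<n. indicator (A i) p))\<^sup>2) \<longlonglongrightarrow> (0::real)"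
        proof (intro AE_I2)
          fix p
          have "(\<lambda>n. indicator (\<Union>i<n. A i) p) \<longlonglongrightarrow> (indicator (\<Union> (range A)) p :: real)"
            using LIMSEQ_indicator_UN[of A p] by simp
          then have "(\<lambda>n. (indicator (\<Union> (range A)) p - (\<Sum>i<n. indicator (A i) p))\<^sup>2)
            \<longlonglongrightarrow> (indicator (\<Union> (range A)) p - indicator (\<Union> (range A)) p :: real)\<^sup>2"
            unfolding ind by (intro tendsto_intros)
          then show "(\<lambda>n. (indicator (\<Union> (range A)) p - (\<Sum>i<n. indicator (A i) p))\<^sup>2) \<longlonglongrightarrow> (0::real)"
            by simp
        qed
        show "AE p in sphere_measure. norm ((indicator (\<Union> (range A)) p - (\<Sum>i<n. indicator (A i) p :: real))\<^sup>2) \<le> 1" for n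
          unfolding ind by (intro AE_I2) (auto simp: indicator_def)
      qed auto
      then show "(\<lambda>n. \<integral>\<^sub>S p. (indicator (\<Union> (range A)) p - (\<Sum>i<n. indicator (A i) p :: real))\<^sup>2) \<longlonglongrightarrow> 0"
        by simp
    qed
  qed
qed

text \<open>
  From indicators to simple functions by linearity, and from these by dominated convergence.
\<close>

theorem square_integrable_poly_approx:
  fixes f :: "real^3 \<Rightarrow> real"
  assumes f: "square_integrable f" shows "poly_approx f"
proof -
  have [measurable]: "f \<in> borel_measurable borel" using f by (rule square_integrable_measurable)
  then have "f \<in> borel_measurable sphere_measure" by measurable
  from borel_measurable_implies_sequence_metric[OF this, of 0]
  obtain F where F: "\<And>i. simple_function sphere_measure (F i)" "\<And>p. (\<lambda>i. F i p) \<longlonglongrightarrow> f p"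
    "\<And>i p. dist (F i p) 0 \<le> 2 * dist (f p) 0"
    by auto
  have [measurable]: "F i \<in> borel_measurable borel" for i
    using borel_measurable_simple_function[OF F(1)] by simp
  show ?thesis
  proof (rule poly_approx_limit[OF f])
    show "poly_approx (F i)" for i
    proof -
      have fin: "finite (range (F i))" using simple_functionD(1)[OF F(1), of i] by simp
      have eq: "F i = (\<lambda>p. \<Sum>y\<in>range (F i). y * indicator (F i -` {y}) p)"
      proof
        fix p
        have "(\<Sum>y\<in>range (F i). y * indicator (F i -` {y}) p) =
            (\<Sum>y\<in>range (F i). if y = F i p then y else 0)"
          by (intro sum.cong) (auto simp: indicator_def)
        then show "F i p = (\<Sum>y\<in>range (F i). y * indicator (F i -` {y}) p)"
          using fin by (simp add: sum.delta)
      qed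
      have "poly_approx (\<lambda>p. \<Sum>y\<in>range (F i). y * indicator (F i -` {y}) p)"
        using measurable_sets_borel[of "F i" borel]
        by (intro poly_approx_sum poly_approx_cmult poly_approx_indicator) auto
      then show ?thesis using eq by (simp only: )
    qed
    have "(\<lambda>i. \<integral>\<^sub>S p. (f p - F i p)\<^sup>2) \<longlonglongrightarrow> (\<integral>\<^sub>S p. 0)"
    proof (rule integral_dominated_convergence[where w = "\<lambda>p. 9 * (norm (f p))\<^sup>2"])
      show "integrable sphere_measure (\<lambda>p. 9 * (norm (f p))\<^sup>2)"
        using square_integrable_integrable[OF f] by simp
      show "AE p in sphere_measure. (\<lambda>i. (f p - F i p)\<^sup>2) \<longlonglongrightarrow> 0"
      proof (intro AE_I2)
        fix p
        have "(\<lambda>i. (f p - F i p)\<^sup>2) \<longlonglongrightarrow> (f p - f p)\<^sup>2" by (intro tendsto_intros F)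
        then show "(\<lambda>i. (f p - F i p)\<^sup>2) \<longlonglongrightarrow> 0" by simp
      qed
      have "(f p - F i p)\<^sup>2 \<le> 9 * (f p)\<^sup>2" for p i
      proof -
        have "\<bar>f p - F i p\<bar> \<le> 3 * \<bar>f p\<bar>" using F(3)[of i p] by (simp add: dist_real_def)
        then have "\<bar>f p - F i p\<bar>\<^sup>2 \<le> (3 * \<bar>f p\<bar>)\<^sup>2" by (rule power_mono) simp
        then show ?thesis by (simp add: power_mult_distrib)
      qed
      then show "AE p in sphere_measure. norm ((f p - F i p)\<^sup>2) \<le> 9 * (norm (f p))\<^sup>2" for i
        by simp
    qed auto
    then show "(\<lambda>i. \<integral>\<^sub>S p. (f p - F i p)\<^sup>2) \<longlonglongrightarrow> 0" by simp
  qed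
qed

lemma integral_square_zero:
  fixes f :: "real^3 \<Rightarrow> 'b::euclidean_space"
  assumes "square_integrable f" "(\<integral>\<^sub>S p. (norm (f p))\<^sup>2) = 0"
  shows "AE p in sphere_measure. f p = 0"
  using integral_nonneg_eq_0_iff_AE[OF square_integrable_integrable[OF assms(1)]] assms(2) by simp

lemma orthogonal_to_polynomials_zero:
  fixes f :: "real^3 \<Rightarrow> real"
  assumes f: "square_integrable f" and orth: "\<And>P. real_polynomial_function P \<Longrightarrow> (\<integral>\<^sub>S p. f p * P p) = 0"
  shows "AE p in sphere_measure. f p = 0"
proof -
  obtain P where P: "\<And>n. real_polynomial_function (P n)"
    "(\<lambda>n. \<integral>\<^sub>S p. (f p - P n p)\<^sup>2) \<longlonglongrightarrow> 0"
    using poly_approx_sequence[OF square_integrable_poly_approx[OF f]] by blast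
  have "(\<lambda>n. \<integral>\<^sub>S p. f p * P n p) \<longlonglongrightarrow> (\<integral>\<^sub>S p. f p * f p)"
    by (rule square_integrable_convergence(1)[OF f _ P(2) f]) (intro square_integrable_smooth real_polynomial_function_smooth P)
  then have "(\<integral>\<^sub>S p. f p * f p) = 0"
    using orth[OF P(1)] by (simp add: LIMSEQ_const_iff)
  then show ?thesis
    using integral_square_zero[OF f] by (simp add: power2_eq_square)
qed

lemma smooth_field_cross: "smooth_field (cross3 a)"
  unfolding smooth_field_def
proof
  fix i
  show "smooth (\<lambda>p. cross3 a p $ i)"
    using exhaust_3[of i] by (auto simp: cross_components intro!: smooth_intros)
qed

text \<open>
  Testing with a polynomial multiple of \<open>x * y\<close> times a rotation field is legitimate, since such a
  field vanishes on both planes. As the polynomials are dense, \<open>D\<close> is orthogonal to all rotation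
  fields almost everywhere, and these span the tangent plane.
\<close>

theorem weak_gradient_of_zero:
  assumes wp: "weak_pair \<Omega> (\<lambda>_. 0) D"
    and \<Omega>: "{p \<in> sphere 0 1. p $ 1 \<noteq> 0 \<and> p $ 2 \<noteq> 0} \<subseteq> \<Omega>"
    and tan: "AE p in sphere_measure. D p \<bullet> p = 0"
  shows "AE p in sphere_measure. D p = 0"
proof -
  have D: "square_integrable D" using wp by (simp add: weak_pair_def)
  have zero: "AE p in sphere_measure. D p \<bullet> cross3 (axis k 1) p = 0" for k
  proof -
    let ?L = "cross3 (axis k (1::real))"
    \<comment> \<open>the factor \<open>x * y\<close> makes the test fields vanish on the planes and is nonzero almost everywhere\<close>
    let ?f = "\<lambda>p. (p $ 1 * p $ 2) *\<^sub>R (D p \<bullet> ?L p)"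
    have DL: "square_integrable (\<lambda>p. D p \<bullet> ?L p)"
    proof -
      have s: "(\<lambda>p. D p \<bullet> ?L p) = (\<lambda>p. \<Sum>i\<in>UNIV. ?L p $ i * (D p $ i))"
        by (simp add: inner_vec_def mult.commute)
      have c: "square_integrable (\<lambda>p. D p $ i)" for i
      proof -
        have "(\<lambda>p. D p $ i) = (\<lambda>p. D p \<bullet> axis i 1)" by (simp add: inner_axis)
        then have [measurable]: "(\<lambda>p. D p $ i) \<in> borel_measurable borel"
          using square_integrable_measurable[OF D] by simp
        have "(D p $ i)\<^sup>2 \<le> (norm (D p))\<^sup>2" for p
          using component_le_norm_cart[of "D p" i] by (metis abs_ge_zero power2_abs power_mono)
        then have "integrable sphere_measure (\<lambda>p. (norm (D p $ i))\<^sup>2)"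
          by (intro Bochner_Integration.integrable_bound[OF square_integrable_integrable[OF D]]) auto
        then show ?thesis unfolding square_integrable_def by simp
      qed
      have "square_integrable (\<lambda>p. ?L p $ i * (D p $ i))" for i
        using square_integrable_mult_continuous[OF c, of "\<lambda>p. ?L p $ i" i]
          smooth_continuous[of "\<lambda>p. ?L p $ i"] smooth_field_cross
        by (simp add: smooth_field_def)
      then show ?thesis unfolding s by (intro square_integrable_sum)
    qed
    have f: "square_integrable ?f"
      by (intro square_integrable_mult_continuous DL continuous_intros)
    have "AE p in sphere_measure. ?f p = 0"
    proof (rule orthogonal_to_polynomials_zero[OF f])
      fix P :: "real^3 \<Rightarrow> real" assume "real_polynomial_function P"
      then have P: "smooth P" by (rule real_polynomial_function_smooth)
      let ?X = "\<lambda>p. (P p * (p $ 1 * p $ 2)) *\<^sub>R ?L p"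
      have X: "smooth_field ?X"
        by (intro smooth_field_scaleR smooth_mult P smooth_coord smooth_field_cross)
      have t: "tangential ?X" by (simp add: tangential_def dot_cross_self)
      obtain B where B: "B \<ge> 0" "\<And>p. p \<in> sphere 0 1 \<Longrightarrow> norm (P p) \<le> B"
        using continuous_bounded_on_sphere[OF smooth_continuous[OF P]] by blast
      have L1: "\<bar>?L p $ i\<bar> \<le> 1" and p1: "\<bar>p $ i\<bar> \<le> 1" if "p \<in> sphere 0 1" for p i
      proof -
        have n: "norm p = 1" using that by simp
        have "(norm (?L p))\<^sup>2 \<le> 1" 
        proof -
          have "(norm (?L p))\<^sup>2 + (axis k 1 \<bullet> p)\<^sup>2 = 1" using norm_cross_dot[of "axis k 1" p] n by simp
          then show ?thesis using zero_le_power2[of "axis k 1 \<bullet> p"] by linarith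
        qed
        then have "norm (?L p) \<le> 1" by (simp add: power_le_one_iff abs_square_le_1)
        then show "\<bar>?L p $ i\<bar> \<le> 1" using component_le_norm_cart[of "?L p" i] by linarith
        show "\<bar>p $ i\<bar> \<le> 1" using component_le_norm_cart[of p i] n by linarith
      qed
      have bd: "\<bar>?X p $ i\<bar> \<le> B * \<bar>p $ j\<bar>" if p: "p \<in> sphere 0 1" and "j = 1 \<or> j = 2" for p i j
      proof -
        obtain m where m: "p $ 1 * p $ 2 = p $ j * p $ m"
          using \<open>j = 1 \<or> j = 2\<close> by (metis mult.commute)
        have "\<bar>?X p $ i\<bar> = \<bar>P p\<bar> * \<bar>p $ j\<bar> * (\<bar>p $ m\<bar> * \<bar>?L p $ i\<bar>)"
          by (simp add: m abs_mult)
        also have "\<dots> \<le> (B * \<bar>p $ j\<bar>) * (1 * 1)"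
          using B(2)[OF p] L1[OF p] p1[OF p] B(1) by (intro mult_mono) auto
        finally show ?thesis by simp
      qed
      have "(\<integral>\<^sub>S p. side_weight 1 (p $ 1) * side_weight 1 (p $ 2) * (D p \<bullet> ?X p)) = 0"
        using weak_pair_cutoff[OF wp \<Omega> X t, where e = 1 and d = 1 and C = B] bd[of _ 1 1] bd[of _ 2 2]
        by auto
      moreover have "(\<integral>\<^sub>S p. side_weight 1 (p $ 1) * side_weight 1 (p $ 2) * (D p \<bullet> ?X p)) =
          (\<integral>\<^sub>S p. ?f p * P p)"
      proof -
        note [measurable] = square_integrable_measurable[OF f] square_integrable_measurable[OF D]
          borel_measurable_continuous_onI[OF smooth_continuous[OF P]]
          borel_measurable_continuous_onI[OF smooth_field_continuous[OF X]]
        show ?thesis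
        proof (rule integral_cong_AE)
          show "AE p in sphere_measure. side_weight 1 (p $ 1) * side_weight 1 (p $ 2) * (D p \<bullet> ?X p) = ?f p * P p"
            using AE_coord_nonzero[of 1] AE_coord_nonzero[of 2]
            by eventually_elim (simp add: side_weight_def mult_ac)
        qed measurable
      qed
      ultimately show "(\<integral>\<^sub>S p. ?f p * P p) = 0" by simp
    qed
    then show ?thesis
      using AE_coord_nonzero[of 1] AE_coord_nonzero[of 2] by eventually_elim simp
  qed
  show ?thesis
    using zero[of 1] zero[of 2] zero[of 3] tan AE_sphere
  proof eventually_elim
    case (elim p)
    have "D p \<bullet> cross3 (axis k 1) p = 0" for k
      using elim exhaust_3[of k] by auto
    then have "cross3 p (D p) $ k = 0" for k
      using exhaust_3[of k] by (auto simp: cross3_simps axis_def dest!: meta_spec[of _ k])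
    then have "cross3 p (D p) = 0" by (simp add: vec_eq_iff)
    then show ?case
      using elim norm_and_cross_eq_0[of p "D p"] by (auto simp: inner_commute)
  qed
qed

section \<open>Parity under the reflections in the planes of the crack\<close>

text \<open>
  Even powers of \<open>x\<close> are missing because \<open>x\<^sup>2 = 1 - y\<^sup>2 - z\<^sup>2\<close> on the sphere. This makes the
  representation by monomials unique and the later inductions on the degree short.
\<close>

inductive even_poly :: "(real^3 \<Rightarrow> real) \<Rightarrow> bool" where
  even_poly_monomial: "even_poly (\<lambda>p. p $ 2 ^ (2 * j) * p $ 3 ^ k)"
| even_poly_add: "even_poly f \<Longrightarrow> even_poly g \<Longrightarrow> even_poly (\<lambda>p. f p + g p)"
| even_poly_cmult: "even_poly f \<Longrightarrow> even_poly (\<lambda>p. c * f p)"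

lemma even_poly_const: "even_poly (\<lambda>p. c)"
  using even_poly_cmult[OF even_poly_monomial[of 0 0], of c] by simp

lemma even_poly_diff: "even_poly f \<Longrightarrow> even_poly g \<Longrightarrow> even_poly (\<lambda>p. f p - g p)"
  using even_poly_add[OF _ even_poly_cmult[of g "-1"], of f] by simp

lemma even_poly_monomial_mult:
  assumes "even_poly g" shows "even_poly (\<lambda>p. (p $ 2 ^ (2 * j) * p $ 3 ^ k) * g p)"
  using assms
proof induction
  case (even_poly_monomial j' k')
  have "(p $ 2 ^ (2 * j) * p $ 3 ^ k) * (p $ 2 ^ (2 * j') * p $ 3 ^ k') =
      p $ 2 ^ (2 * (j + j')) * p $ 3 ^ (k + k')" for p :: "real^3"
    by (simp add: power_add algebra_simps)
  then show ?case using even_poly.even_poly_monomial[of "j + j'" "k + k'"] by simp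
next
  case (even_poly_add f g)
  then show ?case using even_poly.even_poly_add by (fastforce simp: distrib_left)
next
  case (even_poly_cmult f c)
  then show ?case using even_poly.even_poly_cmult[OF even_poly_cmult.IH, of c] by (simp add: mult_ac)
qed

lemma even_poly_mult:
  assumes "even_poly f" "even_poly g" shows "even_poly (\<lambda>p. f p * g p)"
  using assms(1)
proof induction
  case (even_poly_monomial j k)
  then show ?case using even_poly_monomial_mult[OF assms(2)] by simp
next
  case (even_poly_add f f')
  then show ?case using even_poly.even_poly_add by (fastforce simp: distrib_right)
next
  case (even_poly_cmult f c)
  then show ?case using even_poly.even_poly_cmult[OF even_poly_cmult.IH, of c] by (simp add: mult_ac)
qed

lemma even_poly_smooth: "even_poly f \<Longrightarrow> smooth f"
proof (induction rule: even_poly.induct)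
  case (even_poly_monomial j k)
  show ?case by (intro smooth_mult smooth_power smooth_coord)
next
  case (even_poly_cmult f c)
  then show ?case by (intro smooth_mult smooth_const)
qed (rule smooth_add)

text \<open>
  The reflection in a coordinate plane.
\<close>

definition flip :: "3 \<Rightarrow> real^3 \<Rightarrow> real^3" where
  "flip i p = (\<chi> j. if j = i then - p $ j else p $ j)"

lemma flip_nth [simp]: "flip i p $ j = (if j = i then - p $ j else p $ j)"
  by (simp add: flip_def)

lemma flip_flip [simp]: "flip i (flip i p) = p"
  by (simp add: vec_eq_iff)

lemma flip_inner: "flip i p \<bullet> flip i q = p \<bullet> q"
  by (simp add: inner_vec_def) (rule sum.cong, auto)

lemma flip_linear: "linear (flip i)"
  by (rule linearI) (auto simp: vec_eq_iff)

lemma flip_orthogonal: "orthogonal_transformation (flip i)"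
  by (simp add: orthogonal_transformation_def flip_linear flip_inner)

lemma flip_norm [simp]: "norm (flip i p) = norm p"
  by (rule orthogonal_transformation_norm[OF flip_orthogonal])

lemma even_poly_flip:
  assumes "even_poly f"
  shows "f (flip 1 p) = f p" "f (flip 2 p) = f p"
  using assms by (induction rule: even_poly.induct) (auto simp: power_mult)

text \<open>
  Products of the four types reduce again to the four types, since \<open>x\<^sup>2\<close> and \<open>y\<^sup>2\<close> are even
  polynomials on the sphere.
\<close>

lemma polynomial_parity:
  assumes "real_polynomial_function P"
  obtains a b c d where "even_poly a" "even_poly b" "even_poly c" "even_poly d"
    "\<And>p. p \<in> sphere 0 1 \<Longrightarrow> P p = a p + p $ 1 * b p + p $ 2 * c p + p $ 1 * p $ 2 * d p"
proof -
  define par where "par P \<longleftrightarrow> (\<exists>a b c d. even_poly a \<and> even_poly b \<and> even_poly c \<and> even_poly d \<and>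
    (\<forall>p\<in>sphere 0 1. P p = a p + p $ 1 * b p + p $ 2 * c p + p $ 1 * p $ 2 * d p))"
    for P :: "real^3 \<Rightarrow> real"
  have add: "par (\<lambda>p. P p + Q p)" if P: "par P" and Q: "par Q" for P Q
  proof -
    obtain a b c d where 1: "even_poly a" "even_poly b" "even_poly c" "even_poly d"
      "\<forall>p\<in>sphere 0 1. P p = a p + p $ 1 * b p + p $ 2 * c p + p $ 1 * p $ 2 * d p"
      using P unfolding par_def by blast
    obtain a' b' c' d' where 2: "even_poly a'" "even_poly b'" "even_poly c'" "even_poly d'"
      "\<forall>p\<in>sphere 0 1. Q p = a' p + p $ 1 * b' p + p $ 2 * c' p + p $ 1 * p $ 2 * d' p"
      using Q unfolding par_def by blast
    show ?thesis
      unfolding par_def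
      by (rule exI[of _ "\<lambda>p. a p + a' p"], rule exI[of _ "\<lambda>p. b p + b' p"],
          rule exI[of _ "\<lambda>p. c p + c' p"], rule exI[of _ "\<lambda>p. d p + d' p"])
        (use 1 2 in \<open>auto intro: even_poly_add simp: algebra_simps\<close>)
  qed
  have mult: "par (\<lambda>p. P p * Q p)" if P: "par P" and Q: "par Q" for P Q
  proof -
    obtain a b c d where 1: "even_poly a" "even_poly b" "even_poly c" "even_poly d"
      "\<forall>p\<in>sphere 0 1. P p = a p + p $ 1 * b p + p $ 2 * c p + p $ 1 * p $ 2 * d p"
      using P unfolding par_def by blast
    obtain a' b' c' d' where 2: "even_poly a'" "even_poly b'" "even_poly c'" "even_poly d'"
      "\<forall>p\<in>sphere 0 1. Q p = a' p + p $ 1 * b' p + p $ 2 * c' p + p $ 1 * p $ 2 * d' p"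
      using Q unfolding par_def by blast
    \<comment> \<open>\<open>y\<^sup>2\<close> and \<open>x\<^sup>2\<close> on the sphere, in the shape of even polynomials\<close>
    define Y where "Y p = p $ 2 ^ (2 * 1) * p $ 3 ^ 0" for p :: "real^3"
    define X where "X p = 1 - p $ 2 ^ (2 * 1) * p $ 3 ^ 0 - p $ 2 ^ (2 * 0) * p $ 3 ^ 2" for p :: "real^3"
    have XY: "even_poly X" "even_poly Y"
      unfolding X_def Y_def by (intro even_poly_diff even_poly_const even_poly_monomial)+
    let ?A = "\<lambda>p. a p * a' p + X p * (b p * b' p) + Y p * (c p * c' p) + X p * (Y p * (d p * d' p))"
    let ?B = "\<lambda>p. a p * b' p + b p * a' p + Y p * (c p * d' p) + Y p * (d p * c' p)"
    let ?C = "\<lambda>p. a p * c' p + c p * a' p + X p * (b p * d' p) + X p * (d p * b' p)"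
    let ?D = "\<lambda>p. a p * d' p + d p * a' p + b p * c' p + c p * b' p"
    have "even_poly ?A" "even_poly ?B" "even_poly ?C" "even_poly ?D"
      by (intro even_poly_add even_poly_mult XY 1 2)+
    moreover have "P p * Q p = ?A p + p $ 1 * ?B p + p $ 2 * ?C p + p $ 1 * p $ 2 * ?D p"
      if p: "p \<in> sphere 0 1" for p
    proof -
      have "p \<bullet> p = 1" using p by (simp add: norm_eq_1)
      then have "X p = p $ 1 * p $ 1" "Y p = p $ 2 * p $ 2"
        by (auto simp: X_def Y_def inner_vec_def sum_3 power2_eq_square)
      moreover have "P p = a p + p $ 1 * b p + p $ 2 * c p + p $ 1 * p $ 2 * d p"
        "Q p = a' p + p $ 1 * b' p + p $ 2 * c' p + p $ 1 * p $ 2 * d' p"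
        using 1 2 p by auto
      ultimately show ?thesis by (simp only:) (simp add: algebra_simps)
    qed
    ultimately show ?thesis unfolding par_def by blast
  qed
  have const: "par (\<lambda>p. c)" for c
    unfolding par_def
    by (rule exI[of _ "\<lambda>p. c"], rule exI[of _ "\<lambda>p. 0"], rule exI[of _ "\<lambda>p. 0"], rule exI[of _ "\<lambda>p. 0"])
      (auto intro: even_poly_const)
  have coord: "par (\<lambda>p. p $ i)" for i
  proof -
    consider "i = 1" | "i = 2" | "i = 3" using exhaust_3 by blast
    then show ?thesis
    proof cases
      case 1
      show ?thesis unfolding par_def 1
        by (rule exI[of _ "\<lambda>p. 0"], rule exI[of _ "\<lambda>p. 1"], rule exI[of _ "\<lambda>p. 0"], rule exI[of _ "\<lambda>p. 0"])
          (auto intro: even_poly_const)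
    next
      case 2
      show ?thesis unfolding par_def 2
        by (rule exI[of _ "\<lambda>p. 0"], rule exI[of _ "\<lambda>p. 0"], rule exI[of _ "\<lambda>p. 1"], rule exI[of _ "\<lambda>p. 0"])
          (auto intro: even_poly_const)
    next
      case 3
      show ?thesis unfolding par_def 3
        by (rule exI[of _ "\<lambda>p. p $ 3"], rule exI[of _ "\<lambda>p. 0"], rule exI[of _ "\<lambda>p. 0"], rule exI[of _ "\<lambda>p. 0"])
          (use even_poly_monomial[of 0 1] in \<open>auto intro: even_poly_const\<close>)
    qed
  qed
  have "par P" using assms
  proof (induction rule: real_polynomial_function.induct)
    case (linear f)
    have "f p = (f (axis 1 1) * p $ 1 + f (axis 2 1) * p $ 2) + f (axis 3 1) * p $ 3" for p
    proof -
      have "p = p $ 1 *\<^sub>R axis 1 1 + p $ 2 *\<^sub>R axis 2 1 + p $ 3 *\<^sub>R axis 3 1"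
        by (subst vec_eq_iff) (simp add: forall_3 axis_def)
      then have "f p = f (p $ 1 *\<^sub>R axis 1 1 + p $ 2 *\<^sub>R axis 2 1 + p $ 3 *\<^sub>R axis 3 1)" by simp
      then show ?thesis
        using linear by (simp add: linear_add[OF bounded_linear.linear] linear_scale[OF bounded_linear.linear])
    qed
    then have f: "f = (\<lambda>p. (f (axis 1 1) * p $ 1 + f (axis 2 1) * p $ 2) + f (axis 3 1) * p $ 3)" by blast
    have "par (\<lambda>p. (f (axis 1 1) * p $ 1 + f (axis 2 1) * p $ 2) + f (axis 3 1) * p $ 3)"
      by (intro add mult const coord)
    then show ?case using f by simp
  qed (auto intro: const add mult)
  then show thesis unfolding par_def using that by blast
qed

text \<open>
  Averaging over the reflection is an orthogonal projection that fixes \<open>W\<close>, so it cannot increase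
  the distance to \<open>W\<close>.
\<close>

lemma symmetrise_approx:
  fixes W :: "real^3 \<Rightarrow> real"
  assumes T: "orthogonal_transformation T" and W: "square_integrable W" and f: "square_integrable f"
    and s: "\<bar>s\<bar> = 1" and inv: "\<And>p. W (T p) = s * W p"
  shows "(\<integral>\<^sub>S p. (W p - (f p + s * f (T p)) / 2)\<^sup>2) \<le> (\<integral>\<^sub>S p. (W p - f p)\<^sup>2)"
proof -
  let ?d = "\<lambda>p. W p - f p"
  have d: "square_integrable ?d" using W f by (rule square_integrable_diff)
  have i: "integrable sphere_measure (\<lambda>p. (?d p)\<^sup>2)" "integrable sphere_measure (\<lambda>p. (?d (T p))\<^sup>2)"
    using square_integrable_integrable[OF d] square_integrable_integrable[OF square_integrable_orthogonal[OF T d]] by auto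
  have ss: "s * s = 1" using s by (metis abs_mult_self_eq mult_1)
  have "(\<integral>\<^sub>S p. (W p - (f p + s * f (T p)) / 2)\<^sup>2) \<le>
      (\<integral>\<^sub>S p. (?d p)\<^sup>2 / 2 + (?d (T p))\<^sup>2 / 2)"
  proof (rule integral_mono)
    have "square_integrable (\<lambda>p. W p - (1/2) * (f p + s * f (T p)))"
      by (intro square_integrable_diff square_integrable_cmult square_integrable_add W f square_integrable_orthogonal[OF T])
    from square_integrable_integrable[OF this]
    show "integrable sphere_measure (\<lambda>p. (W p - (f p + s * f (T p)) / 2)\<^sup>2)" by simp
    fix p
    have "W p = s * W (T p)" using inv[of p] ss by (simp add: mult.assoc[symmetric])
    then have eq: "W p - (f p + s * f (T p)) / 2 = (?d p + s * ?d (T p)) / 2"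
      by (simp add: field_simps)
    have "0 \<le> (?d p - s * ?d (T p))\<^sup>2" by simp
    then have "(?d p + s * ?d (T p))\<^sup>2 \<le> 2 * (?d p)\<^sup>2 + 2 * ((s * s) * (?d (T p))\<^sup>2)"
      by (simp add: power2_eq_square algebra_simps)
    then show "(W p - (f p + s * f (T p)) / 2)\<^sup>2 \<le> (?d p)\<^sup>2 / 2 + (?d (T p))\<^sup>2 / 2"
      unfolding eq by (simp add: ss power_divide)
  qed (use i in auto)
  also have "\<dots> = (\<integral>\<^sub>S p. (?d p)\<^sup>2)"
  proof -
    note [measurable] = square_integrable_measurable[OF d]
    have "(\<integral>\<^sub>S p. (?d (T p))\<^sup>2) = (\<integral>\<^sub>S p. (?d p)\<^sup>2)"
      by (rule integral_orthogonal_transformation(1)[OF T, of "\<lambda>p. (?d p)\<^sup>2"]) measurable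
    then show ?thesis using i by simp
  qed
  finally show ?thesis .
qed

text \<open>
  Two symmetrisations of an approximating polynomial leave exactly the part with the parity of
  \<open>W\<close>. The cases \<open>s = 1\<close> and \<open>s = -1\<close> are the two that occur: even in both variables, and odd in
  both.
\<close>

lemma parity_approx:
  fixes W :: "real^3 \<Rightarrow> real"
  assumes W: "square_integrable W" and s: "\<bar>s\<bar> = 1"
    and inv: "\<And>p. W (flip 1 p) = s * W p" "\<And>p. W (flip 2 p) = s * W p"
  obtains f where "\<And>n. even_poly (f n)"
    "(\<lambda>n. \<integral>\<^sub>S p. (W p - (if s = 1 then f n p else p $ 1 * p $ 2 * f n p))\<^sup>2) \<longlonglongrightarrow> 0"
proof -
  obtain P where P: "\<And>n. real_polynomial_function (P n)"
    "(\<lambda>n. \<integral>\<^sub>S p. (W p - P n p)\<^sup>2) \<longlonglongrightarrow> 0"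
    using poly_approx_sequence[OF square_integrable_poly_approx[OF W]] by blast
  have "\<exists>f. even_poly f \<and>
    (\<integral>\<^sub>S p. (W p - (if s = 1 then f p else p $ 1 * p $ 2 * f p))\<^sup>2)
      \<le> (\<integral>\<^sub>S p. (W p - P n p)\<^sup>2)" for n
  proof -
    obtain a b c d where ev: "even_poly a" "even_poly b" "even_poly c" "even_poly d" and
      eq: "\<And>p. p \<in> sphere 0 1 \<Longrightarrow> P n p = a p + p $ 1 * b p + p $ 2 * c p + p $ 1 * p $ 2 * d p"
      using polynomial_parity[OF P(1)] by metis
    define f where "f = (if s = 1 then a else d)"
    let ?Q = "\<lambda>p. (P n p + s * P n (flip 1 p)) / 2"
    let ?R = "\<lambda>p. (?Q p + s * ?Q (flip 2 p)) / 2"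
    have sP: "square_integrable (P n)" by (intro square_integrable_smooth real_polynomial_function_smooth P)
    have sQ: "square_integrable ?Q"
    proof -
      have "square_integrable (\<lambda>p. (1/2) * (P n p + s * P n (flip 1 p)))"
        by (intro square_integrable_cmult square_integrable_add sP square_integrable_orthogonal[OF flip_orthogonal])
      then show ?thesis by simp
    qed
    have "s = 1 \<or> s = -1" using s by linarith
    have R: "?R p = (if s = 1 then f p else p $ 1 * p $ 2 * f p)" if p: "p \<in> sphere 0 1" for p
    proof -
      have "flip 1 p \<in> sphere 0 1" "flip 2 p \<in> sphere 0 1" "flip 1 (flip 2 p) \<in> sphere 0 1"
        using p by simp_all
      note e = this[THEN eq] eq[OF p]
      have n: "flip 1 p $ 1 = - p $ 1" "flip 1 p $ 2 = p $ 2" "flip 2 p $ 1 = p $ 1" "flip 2 p $ 2 = - p $ 2"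
        for p by simp_all
      \<comment> \<open>the computation in the four components, for \<open>s = 1\<close> and \<open>s = -1\<close>\<close>
      have alg: "((A + x * B + y * C + x * y * D + 1 * (A + - x * B + y * C + - x * y * D)) / 2
          + 1 * ((A + x * B + - y * C + x * - y * D + 1 * (A + - x * B + - y * C + - x * - y * D)) / 2)) / 2 = A"
        "((A + x * B + y * C + x * y * D + (-1) * (A + - x * B + y * C + - x * y * D)) / 2
          + (-1) * ((A + x * B + - y * C + x * - y * D + (-1) * (A + - x * B + - y * C + - x * - y * D)) / 2)) / 2
          = x * y * D"
        for A B C D x y :: real by (simp_all add: field_simps)
      note e' = e even_poly_flip[OF ev(1)] even_poly_flip[OF ev(2)] even_poly_flip[OF ev(3)]
          even_poly_flip[OF ev(4)] n
      show ?thesis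
      proof (cases "s = 1")
        case True
        show ?thesis
          unfolding e' True f_def by (simp only: alg(1) if_True refl)
      next
        case False
        then have s': "s = -1" using \<open>s = 1 \<or> s = -1\<close> by blast
        have "?R p = p $ 1 * p $ 2 * d p"
          unfolding e' s' by (rule alg(2))
        then show ?thesis using False by (simp only: f_def if_False)
      qed
    qed
    have "(\<integral>\<^sub>S p. (W p - (if s = 1 then f p else p $ 1 * p $ 2 * f p))\<^sup>2)
        = (\<integral>\<^sub>S p. (W p - ?R p)\<^sup>2)"
    proof (rule integral_cong_AE)
      have sf: "smooth f" using ev even_poly_smooth by (simp add: f_def)
      note [measurable] = square_integrable_measurable[OF W] square_integrable_measurable[OF sQ]
        orthogonal_transformation_measurable[OF flip_orthogonal]
        borel_measurable_continuous_onI[OF smooth_continuous[OF sf]]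
      show "(\<lambda>p. (W p - (if s = 1 then f p else p $ 1 * p $ 2 * f p))\<^sup>2) \<in> borel_measurable sphere_measure"
        by measurable
      have "(\<lambda>p. ?Q (flip 2 p)) \<in> borel_measurable borel"
        using measurable_compose[OF orthogonal_transformation_measurable[OF flip_orthogonal] square_integrable_measurable[OF sQ]] .
      then show "(\<lambda>p. (W p - ?R p)\<^sup>2) \<in> borel_measurable sphere_measure"
        by measurable
      show "AE p in sphere_measure. (W p - (if s = 1 then f p else p $ 1 * p $ 2 * f p))\<^sup>2 = (W p - ?R p)\<^sup>2"
        using AE_sphere
      proof eventually_elim
        case (elim p)
        then show ?case using R[of p] by (simp only:)
      qed
    qed
    also have "\<dots> \<le> (\<integral>\<^sub>S p. (W p - ?Q p)\<^sup>2)"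
      by (rule symmetrise_approx[OF flip_orthogonal W sQ s inv(2)])
    also have "\<dots> \<le> (\<integral>\<^sub>S p. (W p - P n p)\<^sup>2)"
      by (rule symmetrise_approx[OF flip_orthogonal W sP s inv(1)])
    finally have "(\<integral>\<^sub>S p. (W p - (if s = 1 then f p else p $ 1 * p $ 2 * f p))\<^sup>2)
      \<le> (\<integral>\<^sub>S p. (W p - P n p)\<^sup>2)" .
    moreover have "even_poly f" using ev by (simp add: f_def)
    ultimately show ?thesis by (intro exI[of _ f] conjI)
  qed
  then have "\<forall>n. \<exists>f. even_poly f \<and>
    (\<integral>\<^sub>S p. (W p - (if s = 1 then f p else p $ 1 * p $ 2 * f p))\<^sup>2)
      \<le> (\<integral>\<^sub>S p. (W p - P n p)\<^sup>2)" by (rule allI)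
  from choice[OF this] obtain f where f: "\<forall>n. even_poly (f n) \<and>
    (\<integral>\<^sub>S p. (W p - (if s = 1 then f n p else p $ 1 * p $ 2 * f n p))\<^sup>2)
      \<le> (\<integral>\<^sub>S p. (W p - P n p)\<^sup>2)" by (rule exE)
  have "(\<lambda>n. \<integral>\<^sub>S p. (W p - (if s = 1 then f n p else p $ 1 * p $ 2 * f n p))\<^sup>2) \<longlonglongrightarrow> 0"
  proof (rule tendsto_sandwich[OF _ _ tendsto_const P(2)])
    show "\<forall>\<^sub>F n in sequentially.
        (\<integral>\<^sub>S p. (W p - (if s = 1 then f n p else p $ 1 * p $ 2 * f n p))\<^sup>2)
        \<le> (\<integral>\<^sub>S p. (W p - P n p)\<^sup>2)"
      using f by (intro always_eventually allI) (rule conjunct2, rule spec)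
  qed simp
  with conjunct1[OF spec[OF f]] show thesis by (rule that)
qed

section \<open>Spherical harmonics that are even in both variables\<close>

lemma has_grad_power: "has_grad (\<lambda>p. p $ i ^ m) (\<lambda>p. (real m * p $ i ^ (m - 1)) *\<^sub>R axis i 1)"
  by (rule has_grad_comp[OF has_grad_coord]) (auto intro!: derivative_eq_intros)

lemma power_pred: "real m * (y * y ^ (m - 1)) = real m * (y::real) ^ m"
  "real m * (real (m - 1) * (y * y ^ (m - 2))) = real m * (real (m - 1) * (y::real) ^ (m - 1))"
proof -
  show 1: "real m * (y * y ^ (m - 1)) = real m * y ^ m" for m y by (cases m) auto
  show "real m * (real (m - 1) * (y * y ^ (m - 2))) = real m * (real (m - 1) * y ^ (m - 1))"
    using 1[of "m - 1" y] by (simp add: numeral_2_eq_2)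
qed

text \<open>
  A polynomial in the algebra above together with explicit formulas for its spherical gradient and
  its spherical Laplacian. For a homogeneous \<open>f\<close> of degree \<open>d\<close> the tangential gradient is
  \<open>\<nabla>f - d f p\<close>, and the spherical Laplacian is the Laplacian of \<open>f\<close> minus \<open>d (d + 1) f\<close>. The
  exponent \<open>m\<close> is a parameter of the first rule so that its formulas do not depend on how an even
  number is written; when \<open>m\<close> or \<open>k\<close> is too small for a truncated exponent, the coefficient in
  front is zero.
\<close>

inductive sphere_laplacian :: "(real^3 \<Rightarrow> real) \<Rightarrow> (real^3 \<Rightarrow> real^3) \<Rightarrow> (real^3 \<Rightarrow> real) \<Rightarrow> bool" where
  sphere_laplacian_monomial: "m = 2 * j \<Longrightarrow> sphere_laplacian (\<lambda>p. p $ 2 ^ m * p $ 3 ^ k)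
    (\<lambda>p. (real m * p $ 2 ^ (m - 1) * p $ 3 ^ k) *\<^sub>R axis 2 1
      + (real k * p $ 2 ^ m * p $ 3 ^ (k - 1)) *\<^sub>R axis 3 1
      - (real (m + k) * (p $ 2 ^ m * p $ 3 ^ k)) *\<^sub>R p)
    (\<lambda>p. real (m * (m - 1)) * (p $ 2 ^ (m - 2) * p $ 3 ^ k)
      + real (k * (k - 1)) * (p $ 2 ^ m * p $ 3 ^ (k - 2))
      - real ((m + k) * (m + k + 1)) * (p $ 2 ^ m * p $ 3 ^ k))"
| sphere_laplacian_add: "sphere_laplacian f X \<phi> \<Longrightarrow> sphere_laplacian g Y \<psi> \<Longrightarrow>
    sphere_laplacian (\<lambda>p. f p + g p) (\<lambda>p. X p + Y p) (\<lambda>p. \<phi> p + \<psi> p)"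
| sphere_laplacian_cmult: "sphere_laplacian f X \<phi> \<Longrightarrow> sphere_laplacian (\<lambda>p. c * f p) (\<lambda>p. c *\<^sub>R X p) (\<lambda>p. c * \<phi> p)"

lemma sphere_div_position: "p \<in> sphere 0 1 \<Longrightarrow> sphere_div (\<lambda>p. p) p = 2"
proof -
  assume "p \<in> sphere 0 1"
  then have "p \<bullet> p = 1" by (simp add: norm_eq_1)
  moreover have "sphere_div (\<lambda>p. p) p = (\<Sum>i\<in>UNIV. (axis i 1 :: real^3) $ i) - (\<Sum>i\<in>UNIV. (axis i 1 \<bullet> p) * p $ i)"
    by (rule sphere_div_components) (rule has_grad_coord)
  ultimately show ?thesis
    by (simp add: inner_axis' inner_vec_def[of p p])
qed

lemma sphere_div_const_direction:
  assumes "has_grad f g"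
  shows "sphere_div (\<lambda>p. f p *\<^sub>R axis i 1) p = g p $ i - (g p \<bullet> p) * p $ i"
proof -
  have "frechet_derivative (\<lambda>p. axis i 1 :: real^3) (at p) = (\<lambda>v. 0)"
    by (rule frechet_derivative_at[symmetric]) simp
  then have "sphere_div (\<lambda>p. axis i 1) p = 0" by (simp add: sphere_div_def)
  then show ?thesis
    using sphere_div_scaleR[OF assms, of "\<lambda>p. axis i 1" p] by (simp add: inner_axis inner_axis')
qed

text \<open>
  The two bounds on the components of \<open>X\<close> are what \<open>weak_pair_cutoff\<close> asks for. They hold because
  the polynomial is even in \<open>x\<close> and \<open>y\<close>, so its gradient is tangent to both planes.
\<close>

lemma sphere_laplacian_properties:
  assumes "sphere_laplacian f X \<phi>"
  shows "even_poly f \<and> smooth_field X \<and> tangential X \<and>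
    (\<exists>g c. has_grad f g \<and> (\<forall>p. X p = g p - c p *\<^sub>R p)) \<and>
    (\<exists>C. \<forall>p\<in>sphere 0 1. \<bar>X p $ 1\<bar> \<le> C * \<bar>p $ 1\<bar> \<and> \<bar>X p $ 2\<bar> \<le> C * \<bar>p $ 2\<bar>) \<and>
    (\<forall>p\<in>sphere 0 1. sphere_div X p = \<phi> p)"
  using assms
proof induction
  case (sphere_laplacian_monomial m j k)
  let ?f = "\<lambda>p::real^3. p $ 2 ^ m * p $ 3 ^ k"
  let ?g2 = "\<lambda>p::real^3. real m * p $ 2 ^ (m - 1) * p $ 3 ^ k"
  let ?g3 = "\<lambda>p::real^3. real k * p $ 2 ^ m * p $ 3 ^ (k - 1)"
  let ?c = "\<lambda>p::real^3. real (m + k) * ?f p"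
  let ?g = "\<lambda>p. ?g2 p *\<^sub>R axis 2 1 + ?g3 p *\<^sub>R axis 3 (1::real)"
  let ?X = "\<lambda>p. ?g p - ?c p *\<^sub>R p"
  have f: "has_grad ?f ?g"
    using has_grad_mult[OF has_grad_power[of 2 m] has_grad_power[of 3 k]]
    by (simp add: algebra_simps)
  have g2: "has_grad ?g2 (\<lambda>p. (real m * p $ 2 ^ (m - 1)) *\<^sub>R ((real k * p $ 3 ^ (k - 1)) *\<^sub>R axis 3 1)
      + p $ 3 ^ k *\<^sub>R (real m *\<^sub>R ((real (m - 1) * p $ 2 ^ (m - 1 - 1)) *\<^sub>R axis 2 1)))"
    by (rule has_grad_mult[OF has_grad_scale[OF has_grad_power] has_grad_power])
  have g3: "has_grad ?g3 (\<lambda>p. (real k * p $ 2 ^ m) *\<^sub>R ((real (k - 1) * p $ 3 ^ (k - 1 - 1)) *\<^sub>R axis 3 1)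
      + p $ 3 ^ (k - 1) *\<^sub>R (real k *\<^sub>R ((real m * p $ 2 ^ (m - 1)) *\<^sub>R axis 2 1)))"
    by (rule has_grad_mult[OF has_grad_scale[OF has_grad_power] has_grad_power])
  have sf: "smooth ?f" and sg: "smooth ?g2" "smooth ?g3"
    by (intro smooth_mult smooth_power smooth_coord smooth_const)+
  have sX: "smooth_field ?X"
    by (intro smooth_field_diff smooth_field_add smooth_field_scaleR sg smooth_field_const
        smooth_mult[OF smooth_const sf] smooth_field_id)
  have pow2: "p $ 2 ^ (m - 1) * p $ 2 * real m = real m * p $ 2 ^ m" for p :: "real^3"
    using power_pred(1)[of m "p $ 2"] by (simp add: mult_ac)
  have pow3: "p $ 3 ^ (k - 1) * p $ 3 * real k = real k * p $ 3 ^ k" for p :: "real^3"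
    using power_pred(1)[of k "p $ 3"] by (simp add: mult_ac)
  \<comment> \<open>the identity of Euler for homogeneous functions\<close>
  have Euler: "?g p \<bullet> p = real (m + k) * ?f p" for p
  proof -
    have "?g p \<bullet> p = (p $ 2 ^ (m - 1) * p $ 2 * real m) * p $ 3 ^ k + p $ 2 ^ m * (p $ 3 ^ (k - 1) * p $ 3 * real k)"
      by (simp add: inner_add_left inner_axis' mult_ac)
    then show ?thesis unfolding pow2 pow3 by (simp add: algebra_simps)
  qed
  have tan: "tangential ?X"
    unfolding tangential_def
  proof
    fix p :: "real^3" assume "p \<in> sphere 0 1"
    then have "p \<bullet> p = 1" by (simp add: norm_eq_1)
    then show "?X p \<bullet> p = 0" using Euler[of p] by (simp add: inner_diff_left)
  qed
  have bound: "\<bar>p $ 2 ^ i * p $ 3 ^ l\<bar> \<le> 1" if "p \<in> sphere 0 1" for i l and p :: "real^3"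
  proof -
    have "\<bar>p $ 2\<bar> \<le> 1" "\<bar>p $ 3\<bar> \<le> 1"
      using component_le_norm_cart[of p 2] component_le_norm_cart[of p 3] that by auto
    then show ?thesis unfolding abs_mult power_abs by (intro mult_le_one power_le_one) auto
  qed
  have C: "\<bar>?X p $ 1\<bar> \<le> real (2 * m + k) * \<bar>p $ 1\<bar> \<and> \<bar>?X p $ 2\<bar> \<le> real (2 * m + k) * \<bar>p $ 2\<bar>"
    if p: "p \<in> sphere 0 1" for p
  proof
    have cb: "\<bar>?c p\<bar> \<le> real (m + k)"
      using mult_left_mono[OF bound[OF p, of m k], of "real (m + k)"] unfolding abs_mult[of "real (m + k)"] by simp
    have "?X p $ 1 = - (?c p * p $ 1)" by (simp add: axis_def)
    then have "\<bar>?X p $ 1\<bar> = \<bar>?c p\<bar> * \<bar>p $ 1\<bar>" by (simp only: abs_minus abs_mult)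
    also have "\<dots> \<le> real (m + k) * \<bar>p $ 1\<bar>" using cb by (intro mult_right_mono) auto
    also have "\<dots> \<le> real (2 * m + k) * \<bar>p $ 1\<bar>" by (intro mult_right_mono) auto
    finally show "\<bar>?X p $ 1\<bar> \<le> real (2 * m + k) * \<bar>p $ 1\<bar>" .
    \<comment> \<open>here it matters that \<open>m\<close> is even: the derivative of \<open>y ^ m\<close> vanishes on \<open>y = 0\<close> also for the smallest positive \<open>m\<close>\<close>
    have g2p: "\<bar>?g2 p\<bar> \<le> real m * \<bar>p $ 2\<bar>"
    proof (cases "m = 0")
      case False
      then have "p $ 2 ^ (m - 1) = p $ 2 * p $ 2 ^ (m - 2)"
        using sphere_laplacian_monomial by (cases j) (auto simp: numeral_2_eq_2)
      then have "\<bar>?g2 p\<bar> = real m * \<bar>p $ 2\<bar> * \<bar>p $ 2 ^ (m - 2) * p $ 3 ^ k\<bar>"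
        by (simp add: abs_mult)
      also have "\<dots> \<le> real m * \<bar>p $ 2\<bar> * 1" using bound[OF p] by (intro mult_left_mono) auto
      finally show ?thesis by simp
    qed simp
    have "?X p $ 2 = ?g2 p - ?c p * p $ 2" by (simp add: axis_def)
    then have "\<bar>?X p $ 2\<bar> \<le> \<bar>?g2 p\<bar> + \<bar>?c p\<bar> * \<bar>p $ 2\<bar>" by (simp only: abs_mult[symmetric] abs_triangle_ineq4)
    also have "\<dots> \<le> real m * \<bar>p $ 2\<bar> + real (m + k) * \<bar>p $ 2\<bar>"
      using g2p cb by (intro add_mono mult_right_mono) auto
    finally show "\<bar>?X p $ 2\<bar> \<le> real (2 * m + k) * \<bar>p $ 2\<bar>" by (simp add: algebra_simps)
  qed
  have div: "sphere_div ?X p = real (m * (m - 1)) * (p $ 2 ^ (m - 2) * p $ 3 ^ k)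
      + real (k * (k - 1)) * (p $ 2 ^ m * p $ 3 ^ (k - 2))
      - real ((m + k) * (m + k + 1)) * ?f p" if p: "p \<in> sphere 0 1" for p
  proof -
    have pp: "p \<bullet> p = 1" using p by (simp add: norm_eq_1)
    have c: "has_grad (\<lambda>p. - ?c p) (\<lambda>p. (- real (m + k)) *\<^sub>R ?g p)"
      using has_grad_scale[OF f, of "- real (m + k)"] by (simp only: mult_minus_left)
    have dif: "(\<lambda>p. ?g2 p *\<^sub>R (axis 2 1 :: real^3)) differentiable (at p)"
      "(\<lambda>p. ?g3 p *\<^sub>R (axis 3 1 :: real^3)) differentiable (at p)"
      "(\<lambda>p. (- ?c p) *\<^sub>R p) differentiable (at p)"
      by (intro smooth_field_differentiable smooth_field_scaleR sg smooth_field_const smooth_neg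
          smooth_mult[OF smooth_const sf] smooth_field_id)+
    have "sphere_div ?X p = sphere_div (\<lambda>p. (?g2 p *\<^sub>R axis 2 1 + ?g3 p *\<^sub>R axis 3 1) + (- ?c p) *\<^sub>R p) p"
      by simp
    also have "\<dots> = sphere_div (\<lambda>p. ?g2 p *\<^sub>R axis 2 1) p + sphere_div (\<lambda>p. ?g3 p *\<^sub>R axis 3 1) p
        + sphere_div (\<lambda>p. (- ?c p) *\<^sub>R p) p"
      using dif by (subst sphere_div_add) (auto intro: differentiable_add simp: sphere_div_add)
    also have "sphere_div (\<lambda>p. (- ?c p) *\<^sub>R p) p = - 2 * ?c p"
      using sphere_div_scaleR[OF c, of "\<lambda>p. p" p] sphere_div_position[OF p] pp by simp
    finally have 1: "sphere_div ?X p =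
        sphere_div (\<lambda>p. ?g2 p *\<^sub>R axis 2 1) p + sphere_div (\<lambda>p. ?g3 p *\<^sub>R axis 3 1) p - 2 * ?c p"
      by simp
    have ax: "axis 3 (1::real) $ (2::3) = 0" "axis 2 (1::real) $ (3::3) = 0"
      by (simp_all add: axis_def)
    \<comment> \<open>from here on a computation with powers of \<open>y\<close> and \<open>z\<close>; the truncated exponents never matter because of the coefficients\<close>
    define y z where "y = p $ 2" and "z = p $ 3"
    have y: "y ^ (m - 1) * y * real m = real m * y ^ m"
      "real m * (real (m - 1) * (y * y ^ (m - 2))) = real m * (real (m - 1) * y ^ (m - 1))"
      using power_pred[of m y] by (simp_all add: mult_ac)
    have z: "z ^ (k - 1) * z * real k = real k * z ^ k"
      "real k * (real (k - 1) * (z * z ^ (k - 2))) = real k * (real (k - 1) * z ^ (k - 1))"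
      using power_pred[of k z] by (simp_all add: mult_ac)
    have 2: "sphere_div (\<lambda>p. ?g2 p *\<^sub>R axis 2 1) p =
        real m * real (m - 1) * y ^ (m - 2) * z ^ k - real m * (real (m - 1) + real k) * y ^ m * z ^ k"
    proof -
      have "sphere_div (\<lambda>p. ?g2 p *\<^sub>R axis 2 1) p = real m * real (m - 1) * y ^ (m - 2) * z ^ k
        - ((y ^ (m - 1) * y * real m) * (z ^ (k - 1) * z * real k)
          + (real m * (real (m - 1) * (y * y ^ (m - 2)))) * y * z ^ k)"
        unfolding sphere_div_const_direction[OF g2]
        by (simp add: inner_add_left inner_axis' ax y_def z_def algebra_simps numeral_2_eq_2)
      also have "\<dots> = real m * real (m - 1) * y ^ (m - 2) * z ^ k
        - ((y ^ (m - 1) * y * real m) * (z ^ (k - 1) * z * real k)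
          + (y ^ (m - 1) * y * real m) * real (m - 1) * z ^ k)"
        unfolding y(2) by (simp add: algebra_simps)
      finally show ?thesis unfolding y(1) z(1) by (simp add: algebra_simps)
    qed
    have 3: "sphere_div (\<lambda>p. ?g3 p *\<^sub>R axis 3 1) p =
        real k * real (k - 1) * y ^ m * z ^ (k - 2) - real k * (real (k - 1) + real m) * y ^ m * z ^ k"
    proof -
      have "sphere_div (\<lambda>p. ?g3 p *\<^sub>R axis 3 1) p = real k * real (k - 1) * y ^ m * z ^ (k - 2)
        - ((y ^ (m - 1) * y * real m) * (z ^ (k - 1) * z * real k)
          + (real k * (real (k - 1) * (z * z ^ (k - 2)))) * z * y ^ m)"
        unfolding sphere_div_const_direction[OF g3]
        by (simp add: inner_add_left inner_axis' ax y_def z_def algebra_simps numeral_2_eq_2)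
      also have "\<dots> = real k * real (k - 1) * y ^ m * z ^ (k - 2)
        - ((y ^ (m - 1) * y * real m) * (z ^ (k - 1) * z * real k)
          + (z ^ (k - 1) * z * real k) * real (k - 1) * y ^ m)"
        unfolding z(2) by (simp add: algebra_simps)
      finally show ?thesis unfolding y(1) z(1) by (simp add: algebra_simps)
    qed
    have m1: "real m * real (m - 1) = real m * (real m - 1)" for m by (cases m) auto
    have coef: "real m * (real (m - 1) + real k) + real k * (real (k - 1) + real m) + 2 * real (m + k)
        = real ((m + k) * (m + k + 1))"
      unfolding distrib_left m1 by (simp add: algebra_simps)
    have "sphere_div ?X p = real m * real (m - 1) * y ^ (m - 2) * z ^ k + real k * real (k - 1) * y ^ m * z ^ (k - 2)
      - (real m * (real (m - 1) + real k) + real k * (real (k - 1) + real m) + 2 * real (m + k)) * (y ^ m * z ^ k)"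
      unfolding 1 2 3 by (simp add: y_def z_def algebra_simps)
    then show ?thesis unfolding coef by (simp add: y_def z_def mult.assoc)
  qed
  show ?case
  proof (intro conjI)
    show "even_poly ?f" using even_poly_monomial[of j k] sphere_laplacian_monomial by simp
    show "\<exists>g c. has_grad ?f g \<and> (\<forall>p. ?X p = g p - c p *\<^sub>R p)"
      by (rule exI[of _ ?g], rule exI[of _ ?c], intro conjI f allI refl)
    show "\<exists>C. \<forall>p\<in>sphere 0 1. \<bar>?X p $ 1\<bar> \<le> C * \<bar>p $ 1\<bar> \<and> \<bar>?X p $ 2\<bar> \<le> C * \<bar>p $ 2\<bar>"
      by (rule exI[of _ "real (2 * m + k)"], rule ballI, rule C)
  qed (rule sX, rule tan, rule ballI, rule div)
next
  case (sphere_laplacian_add f X \<phi> g Y \<psi>)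
  obtain g1 c1 where 1: "has_grad f g1" "\<forall>p. X p = g1 p - c1 p *\<^sub>R p" using sphere_laplacian_add by blast
  obtain g2 c2 where 2: "has_grad g g2" "\<forall>p. Y p = g2 p - c2 p *\<^sub>R p" using sphere_laplacian_add by blast
  have "has_grad (\<lambda>p. f p + g p) (\<lambda>p. g1 p + g2 p)" "\<forall>p. X p + Y p = (g1 p + g2 p) - (c1 p + c2 p) *\<^sub>R p"
    using 1 2 by (auto intro: has_grad_add simp: algebra_simps)
  moreover
  obtain C where C: "\<forall>p\<in>sphere 0 1. \<bar>X p $ 1\<bar> \<le> C * \<bar>p $ 1\<bar> \<and> \<bar>X p $ 2\<bar> \<le> C * \<bar>p $ 2\<bar>"
    using sphere_laplacian_add by blast
  obtain D where D: "\<forall>p\<in>sphere 0 1. \<bar>Y p $ 1\<bar> \<le> D * \<bar>p $ 1\<bar> \<and> \<bar>Y p $ 2\<bar> \<le> D * \<bar>p $ 2\<bar>"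
    using sphere_laplacian_add by blast
  have "\<forall>p\<in>sphere 0 1. \<bar>(X p + Y p) $ 1\<bar> \<le> (C + D) * \<bar>p $ 1\<bar> \<and> \<bar>(X p + Y p) $ 2\<bar> \<le> (C + D) * \<bar>p $ 2\<bar>"
    using C D by (force simp: distrib_right intro: order_trans[OF abs_triangle_ineq] add_mono)
  moreover have "\<forall>p\<in>sphere 0 1. sphere_div (\<lambda>p. X p + Y p) p = \<phi> p + \<psi> p"
    using sphere_laplacian_add by (simp add: sphere_div_add smooth_field_differentiable)
  moreover have "tangential (\<lambda>p. X p + Y p)"
    using sphere_laplacian_add by (simp add: tangential_def inner_add_left)
  moreover have "even_poly (\<lambda>p. f p + g p)" using sphere_laplacian_add.IH by (intro even_poly_add) blast+
  moreover have "smooth_field (\<lambda>p. X p + Y p)" using sphere_laplacian_add.IH by (intro smooth_field_add) blast+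
  ultimately show ?case by - (intro conjI exI, assumption+)
next
  case (sphere_laplacian_cmult f X \<phi> c)
  obtain g1 c1 where 1: "has_grad f g1" "\<forall>p. X p = g1 p - c1 p *\<^sub>R p" using sphere_laplacian_cmult by blast
  have "has_grad (\<lambda>p. c * f p) (\<lambda>p. c *\<^sub>R g1 p)" "\<forall>p. c *\<^sub>R X p = c *\<^sub>R g1 p - (c * c1 p) *\<^sub>R p"
    by (rule has_grad_scale[OF 1(1)]) (simp add: 1(2) scaleR_diff_right)
  moreover
  obtain C where C: "\<forall>p\<in>sphere 0 1. \<bar>X p $ 1\<bar> \<le> C * \<bar>p $ 1\<bar> \<and> \<bar>X p $ 2\<bar> \<le> C * \<bar>p $ 2\<bar>"
    using sphere_laplacian_cmult by blast
  then have "\<forall>p\<in>sphere 0 1. \<bar>(c *\<^sub>R X p) $ 1\<bar> \<le> (\<bar>c\<bar> * C) * \<bar>p $ 1\<bar> \<and> \<bar>(c *\<^sub>R X p) $ 2\<bar> \<le> (\<bar>c\<bar> * C) * \<bar>p $ 2\<bar>"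
    by (auto simp: abs_mult mult.assoc intro!: mult_left_mono)
  moreover have "\<forall>p\<in>sphere 0 1. sphere_div (\<lambda>p. c *\<^sub>R X p) p = c * \<phi> p"
    using sphere_laplacian_cmult by (simp add: sphere_div_cmult smooth_field_differentiable)
  moreover have "tangential (\<lambda>p. c *\<^sub>R X p)"
    using sphere_laplacian_cmult by (simp add: tangential_def)
  moreover have "even_poly (\<lambda>p. c * f p)" using sphere_laplacian_cmult.IH by (intro even_poly_cmult) blast
  moreover have "smooth_field (\<lambda>p. c *\<^sub>R X p)"
    using sphere_laplacian_cmult.IH by (intro smooth_field_scaleR smooth_const) blast
  ultimately show ?case by - (intro conjI exI, assumption+)
qed

lemma sphere_laplacian_zero: "sphere_laplacian (\<lambda>p. 0) (\<lambda>p. 0) (\<lambda>p. 0)"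
  using sphere_laplacian_cmult[OF sphere_laplacian_monomial[OF refl, of 0 0], of 0] by simp

lemma sphere_laplacian_sum:
  assumes "finite I" "\<And>i. i \<in> I \<Longrightarrow> sphere_laplacian (f i) (X i) (\<phi> i)"
  shows "sphere_laplacian (\<lambda>p. \<Sum>i\<in>I. f i p) (\<lambda>p. \<Sum>i\<in>I. X i p) (\<lambda>p. \<Sum>i\<in>I. \<phi> i p)"
  using assms by (induction I rule: finite_induct) (auto intro: sphere_laplacian_zero sphere_laplacian_add)

lemma sphere_laplacian_smooth: "sphere_laplacian f X \<phi> \<Longrightarrow> smooth f" "sphere_laplacian f X \<phi> \<Longrightarrow> smooth_field X" "sphere_laplacian f X \<phi> \<Longrightarrow> tangential X"
  using sphere_laplacian_properties even_poly_smooth by blast+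

text \<open>
  The divergence theorem for \<open>f *\<^sub>R Y\<close>.
\<close>

lemma sphere_laplacian_Green:
  assumes f: "sphere_laplacian f X \<phi>" and g: "sphere_laplacian g Y \<psi>"
  shows "(\<integral>\<^sub>S p. X p \<bullet> Y p) = - (\<integral>\<^sub>S p. f p * \<psi> p)"
proof -
  obtain h c where h: "has_grad f h" "\<And>p. X p = h p - c p *\<^sub>R p" using sphere_laplacian_properties[OF f] by blast
  have Y: "smooth_field Y" "tangential Y" "\<And>p. p \<in> sphere 0 1 \<Longrightarrow> sphere_div Y p = \<psi> p"
    using sphere_laplacian_properties[OF g] by blast+
  have sf: "smooth f" "smooth_field X" using sphere_laplacian_smooth[OF f] by auto
  have Z: "smooth_field (\<lambda>p. f p *\<^sub>R Y p)" using sf Y by (intro smooth_field_scaleR)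
  have div: "sphere_div (\<lambda>p. f p *\<^sub>R Y p) p = f p * sphere_div Y p + X p \<bullet> Y p" if "p \<in> sphere 0 1" for p
  proof -
    have t: "Y p \<bullet> p = 0" using Y(2) that by (simp add: tangential_def)
    then have "p \<bullet> Y p = 0" by (simp add: inner_commute)
    then show ?thesis
      using sphere_div_scaleR[OF h(1) smooth_field_differentiable[OF Y(1)], of p] t
      by (simp add: h(2) inner_diff_left)
  qed
  have c: "continuous_on UNIV (sphere_div Y)" "continuous_on UNIV f" "continuous_on UNIV X" "continuous_on UNIV Y"
    using sf Y by (auto intro: smooth_continuous smooth_field_continuous smooth_sphere_div)
  have "0 = (\<integral>\<^sub>S p. sphere_div (\<lambda>p. f p *\<^sub>R Y p) p)"
    using divergence_theorem_smooth[OF Z] Y(2) by (simp add: tangential_def)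
  also have "\<dots> = (\<integral>\<^sub>S p. f p * sphere_div Y p + X p \<bullet> Y p)"
  proof (rule integral_cong_AE)
    show "sphere_div (\<lambda>p. f p *\<^sub>R Y p) \<in> borel_measurable sphere_measure"
      using borel_measurable_continuous_onI[OF smooth_continuous[OF smooth_sphere_div[OF Z]]] by simp
    show "(\<lambda>p. f p * sphere_div Y p + X p \<bullet> Y p) \<in> borel_measurable sphere_measure"
      using borel_measurable_continuous_onI[of "\<lambda>p. f p * sphere_div Y p + X p \<bullet> Y p"] c
      by (simp add: continuous_intros)
    show "AE p in sphere_measure. sphere_div (\<lambda>p. f p *\<^sub>R Y p) p = f p * sphere_div Y p + X p \<bullet> Y p"
      using AE_sphere by eventually_elim (rule div)
  qed
  also have "\<dots> = (\<integral>\<^sub>S p. f p * sphere_div Y p) + (\<integral>\<^sub>S p. X p \<bullet> Y p)"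
    using c by (intro Bochner_Integration.integral_add continuous_integrable continuous_intros)
  also have "(\<integral>\<^sub>S p. f p * sphere_div Y p) = (\<integral>\<^sub>S p. f p * \<psi> p)"
  proof (rule Bochner_Integration.integral_cong_AE)
    have "AE p in sphere_measure. sphere_div Y p = \<psi> p"
      using AE_sphere by eventually_elim (rule Y(3))
    then show "AE p in sphere_measure. f p * sphere_div Y p = f p * \<psi> p" by eventually_elim simp
    show "(\<lambda>p. f p * sphere_div Y p) \<in> borel_measurable sphere_measure"
      using borel_measurable_continuous_onI[OF continuous_on_mult[OF c(2,1)]] by simp
    have "\<psi> \<in> borel_measurable borel" using g
    proof induction
      case (sphere_laplacian_monomial m j k)
      show ?case by (intro borel_measurable_continuous_onI continuous_intros)
    qed auto
    then show "(\<lambda>p. f p * \<psi> p) \<in> borel_measurable sphere_measure"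
      using borel_measurable_continuous_onI[OF c(2)] by simp
  qed
  finally show ?thesis by simp
qed

definition harmonic :: "nat \<Rightarrow> (real^3 \<Rightarrow> real) \<Rightarrow> (real^3 \<Rightarrow> real^3) \<Rightarrow> bool" where
  "harmonic l h X \<longleftrightarrow> sphere_laplacian h X (\<lambda>p. - real (l * (l + 1)) * h p)"

lemma harmonic_zero: "harmonic l (\<lambda>p. 0) (\<lambda>p. 0)"
  using sphere_laplacian_zero by (simp add: harmonic_def)

lemma harmonic_cmult: "harmonic l h X \<Longrightarrow> harmonic l (\<lambda>p. c * h p) (\<lambda>p. c *\<^sub>R X p)"
  unfolding harmonic_def using sphere_laplacian_cmult by (fastforce simp: mult_ac)

lemma harmonic_add:
  "harmonic l h X \<Longrightarrow> harmonic l g Y \<Longrightarrow> harmonic l (\<lambda>p. h p + g p) (\<lambda>p. X p + Y p)"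
  unfolding harmonic_def using sphere_laplacian_add by (fastforce simp: distrib_left)

lemma harmonic_const: "harmonic 0 (\<lambda>p. 1) (\<lambda>p. 0)"
  using sphere_laplacian_monomial[OF refl, of 0 0] by (simp add: harmonic_def)

lemma harmonic_z: "harmonic 1 (\<lambda>p. p $ 3) (\<lambda>p. axis 3 1 - p $ 3 *\<^sub>R p)"
  using sphere_laplacian_monomial[OF refl, of 0 1] by (simp add: harmonic_def)

text \<open>
  The components of degree \<open>0\<close> and \<open>1\<close> are made explicit because the orthogonality conditions of
  the Poincare inequality are stated with \<open>1\<close> and \<open>z\<close>.
\<close>

definition spectral_sum :: "nat \<Rightarrow> (real^3 \<Rightarrow> real) \<Rightarrow> bool" where
  "spectral_sum n f \<longleftrightarrow> (\<exists>h X. (\<forall>l. harmonic l (h l) (X l)) \<and> (\<forall>l>n. h l = (\<lambda>p. 0)) \<and>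
     (\<exists>c. h 0 = (\<lambda>p. c)) \<and> (\<exists>c. h 1 = (\<lambda>p. c * p $ 3)) \<and> (\<forall>p. f p = (\<Sum>l\<le>n. h l p)))"

lemma spectral_sum_zero: "spectral_sum n (\<lambda>p. 0)"
  unfolding spectral_sum_def
  by (rule exI[of _ "\<lambda>l p. 0"], rule exI[of _ "\<lambda>l p. 0"])
    (auto intro: harmonic_zero exI[of _ 0])

lemma spectral_sum_cmult: assumes "spectral_sum n f" shows "spectral_sum n (\<lambda>p. c * f p)"
proof -
  obtain h X where h: "\<forall>l. harmonic l (h l) (X l)" "\<forall>l>n. h l = (\<lambda>p. 0)"
    "\<exists>c. h 0 = (\<lambda>p. c)" "\<exists>c. h 1 = (\<lambda>p. c * p $ 3)" "\<forall>p. f p = (\<Sum>l\<le>n. h l p)"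
    using assms unfolding spectral_sum_def by blast
  obtain a b where "h 0 = (\<lambda>p. a)" "h 1 = (\<lambda>p. b * p $ 3)" using h by blast
  then have "\<exists>d. (\<lambda>p. c * h 0 p) = (\<lambda>p. d)" "\<exists>d. (\<lambda>p. c * h 1 p) = (\<lambda>p. d * p $ 3)"
    by (auto intro: exI[of _ "c * b"] simp: mult.assoc)
  then show ?thesis
    unfolding spectral_sum_def
    by (intro exI[of _ "\<lambda>l p. c * h l p"] exI[of _ "\<lambda>l p. c *\<^sub>R X l p"] conjI)
      (use h in \<open>auto intro: harmonic_cmult simp: sum_distrib_left\<close>)
qed

lemma spectral_sum_mono: assumes "spectral_sum n f" "n \<le> N" shows "spectral_sum N f"
proof -
  obtain h X where h: "\<forall>l. harmonic l (h l) (X l)" "\<forall>l>n. h l = (\<lambda>p. 0)"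
    "\<exists>c. h 0 = (\<lambda>p. c)" "\<exists>c. h 1 = (\<lambda>p. c * p $ 3)" "\<forall>p. f p = (\<Sum>l\<le>n. h l p)"
    using assms unfolding spectral_sum_def by blast
  have "(\<Sum>l\<le>N. h l p) = (\<Sum>l\<le>n. h l p)" for p
    using assms(2) h(2) by (intro sum.mono_neutral_right) auto
  then show ?thesis
    unfolding spectral_sum_def
    by (intro exI[of _ h] exI[of _ X] conjI) (use h assms(2) in auto)
qed

lemma spectral_sum_add:
  assumes "spectral_sum n f" "spectral_sum m g" shows "spectral_sum (max n m) (\<lambda>p. f p + g p)"
proof -
  obtain h X where h: "\<forall>l. harmonic l (h l) (X l)" "\<forall>l>max n m. h l = (\<lambda>p. 0)"
    "\<exists>c. h 0 = (\<lambda>p. c)" "\<exists>c. h 1 = (\<lambda>p. c * p $ 3)" "\<forall>p. f p = (\<Sum>l\<le>max n m. h l p)"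
    using spectral_sum_mono[OF assms(1), of "max n m"] unfolding spectral_sum_def by auto
  obtain k Y where k: "\<forall>l. harmonic l (k l) (Y l)" "\<forall>l>max n m. k l = (\<lambda>p. 0)"
    "\<exists>c. k 0 = (\<lambda>p. c)" "\<exists>c. k 1 = (\<lambda>p. c * p $ 3)" "\<forall>p. g p = (\<Sum>l\<le>max n m. k l p)"
    using spectral_sum_mono[OF assms(2), of "max n m"] unfolding spectral_sum_def by auto
  obtain a b a' b' where "h 0 = (\<lambda>p. a)" "h 1 = (\<lambda>p. b * p $ 3)" "k 0 = (\<lambda>p. a')" "k 1 = (\<lambda>p. b' * p $ 3)"
    using h k by blast
  then have "\<exists>d. (\<lambda>p. h 0 p + k 0 p) = (\<lambda>p. d)" "\<exists>d. (\<lambda>p. h 1 p + k 1 p) = (\<lambda>p. d * p $ 3)"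
    by (auto intro: exI[of _ "a + a'"] exI[of _ "b + b'"] simp: distrib_right)
  then show ?thesis
    unfolding spectral_sum_def
    by (intro exI[of _ "\<lambda>l p. h l p + k l p"] exI[of _ "\<lambda>l p. X l p + Y l p"] conjI)
      (use h k in \<open>auto intro: harmonic_add simp: sum.distrib\<close>)
qed

text \<open>
  The Laplacian is triangular with respect to the degree: it maps a monomial of degree \<open>d\<close> to
  \<open>- d (d + 1)\<close> times itself plus terms of degree \<open>d - 2\<close>. The remainder is a sum of harmonics
  \<open>h l\<close> with \<open>l < d\<close> by induction, and subtracting \<open>h l / (d (d + 1) - l (l + 1))\<close> for each of
  them from the monomial leaves a harmonic of degree \<open>d\<close>.
\<close>

lemma spectral_sum_monomial:
  "spectral_sum (2 * j + k) (\<lambda>p. p $ 2 ^ (2 * j) * p $ 3 ^ k)"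
proof (induction "2 * j + k" arbitrary: j k rule: less_induct)
  case less
  let ?d = "2 * j + k"
  let ?f = "\<lambda>p::real^3. p $ 2 ^ (2 * j) * p $ 3 ^ k"
  consider "?d = 0" | "?d = 1" | "?d \<ge> 2" by linarith
  then show ?case
  proof cases
    case 1
    then show ?thesis
      unfolding spectral_sum_def
      by (intro exI[of _ "\<lambda>l p. if l = 0 then 1 else 0"] exI[of _ "\<lambda>l p. 0"])
        (auto intro: harmonic_zero harmonic_const exI[of _ 0])
  next
    case 2
    then have "j = 0" by (cases j) auto
    with 2 have jk: "j = 0" "k = 1" by auto
    have "harmonic l (\<lambda>p. if l = 1 then p $ 3 else 0) (\<lambda>p. if l = 1 then axis 3 1 - p $ 3 *\<^sub>R p else 0)" for l
      using harmonic_z harmonic_zero by (cases "l = 1") auto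
    then show ?thesis
      unfolding spectral_sum_def jk
      by (intro exI[of _ "\<lambda>l p. if l = 1 then p $ 3 else 0"]
          exI[of _ "\<lambda>l p. if l = 1 then axis 3 1 - p $ 3 *\<^sub>R p else 0"])
        (auto intro: exI[of _ 1])
  next
    case 3
    \<comment> \<open>the terms of lower degree in the Laplacian of the monomial\<close>
    let ?r = "\<lambda>p::real^3. real (2 * j * (2 * j - 1)) * (p $ 2 ^ (2 * j - 2) * p $ 3 ^ k)
      + real (k * (k - 1)) * (p $ 2 ^ (2 * j) * p $ 3 ^ (k - 2))"
    have s1: "spectral_sum (?d - 1) (\<lambda>p. real (2 * j * (2 * j - 1)) * (p $ 2 ^ (2 * j - 2) * p $ 3 ^ k))"
    proof (cases "j = 0")
      case False
      have "spectral_sum (2 * (j - 1) + k) (\<lambda>p. p $ 2 ^ (2 * (j - 1)) * p $ 3 ^ k)"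
        by (rule less) (use False in auto)
      then have "spectral_sum (2 * (j - 1) + k) (\<lambda>p. p $ 2 ^ (2 * j - 2) * p $ 3 ^ k)"
        by (simp add: right_diff_distrib')
      then show ?thesis
        by (intro spectral_sum_cmult) (erule spectral_sum_mono, use False in auto)
    qed (simp add: spectral_sum_zero)
    have s2: "spectral_sum (?d - 1) (\<lambda>p. real (k * (k - 1)) * (p $ 2 ^ (2 * j) * p $ 3 ^ (k - 2)))"
    proof (cases "k < 2")
      case True
      then have "k * (k - 1) = 0" by auto
      then show ?thesis by (simp only: of_nat_0 mult_zero_left spectral_sum_zero)
    next
      case False
      have "spectral_sum (2 * j + (k - 2)) (\<lambda>p. p $ 2 ^ (2 * j) * p $ 3 ^ (k - 2))"
        by (rule less) (use False in auto)
      then show ?thesis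
        by (intro spectral_sum_cmult) (erule spectral_sum_mono, use False in auto)
    qed
    obtain h X where h: "\<And>l. harmonic l (h l) (X l)" "\<And>l. l > ?d - 1 \<Longrightarrow> h l = (\<lambda>p. 0)"
      "\<exists>c. h 0 = (\<lambda>p. c)" "\<exists>c. h 1 = (\<lambda>p. c * p $ 3)" "\<And>p. ?r p = (\<Sum>l\<le>?d - 1. h l p)"
      using spectral_sum_add[OF s1 s2] unfolding spectral_sum_def by auto
    let ?\<mu> = "\<lambda>l. real (l * (l + 1))"
    let ?c = "\<lambda>l. 1 / (?\<mu> ?d - ?\<mu> l)"
    let ?I = "{..<?d}"
    have \<mu>: "?\<mu> l < ?\<mu> ?d" if "l < ?d" for l
      using that mult_strict_mono[of l ?d "l + 1" "?d + 1"] by (simp only: of_nat_less_iff)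
    \<comment> \<open>the new harmonic of degree \<open>2 * j + k\<close>\<close>
    define top where "top p = ?f p + (-1) * (\<Sum>l\<in>?I. ?c l * h l p)" for p
    obtain Z where Z: "sphere_laplacian ?f Z (\<lambda>p. ?r p - ?\<mu> ?d * ?f p)"
      using sphere_laplacian_monomial[OF refl, of j k] by (simp add: add.assoc)
    have ltop: "sphere_laplacian top (\<lambda>p. Z p + (-1) *\<^sub>R (\<Sum>l\<in>?I. ?c l *\<^sub>R X l p))
        (\<lambda>p. (?r p - ?\<mu> ?d * ?f p) + (-1) * (\<Sum>l\<in>?I. ?c l * (- ?\<mu> l * h l p)))"
      unfolding top_def using h(1) unfolding harmonic_def
      by (intro sphere_laplacian_add Z sphere_laplacian_cmult sphere_laplacian_sum) auto
    have "(?r p - ?\<mu> ?d * ?f p) + (-1) * (\<Sum>l\<in>?I. ?c l * (- ?\<mu> l * h l p)) = - ?\<mu> ?d * top p" for p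
    proof -
      have "?I = {..?d - 1}" using 3 by auto
      then have r: "?r p = (\<Sum>l\<in>?I. h l p)" using h(5) by simp
      have "(\<Sum>l\<in>?I. h l p) = (\<Sum>l\<in>?I. ?c l * (- ?\<mu> l * h l p) + ?\<mu> ?d * (?c l * h l p))"
      proof (rule sum.cong[OF refl])
        fix l assume "l \<in> ?I"
        then have "?\<mu> ?d - ?\<mu> l \<noteq> 0" using \<mu>[of l] by simp
        then have "h l p = (?c l * (?\<mu> ?d - ?\<mu> l)) * h l p" by (simp only: nonzero_divide_eq_eq times_divide_eq_left mult_1_left divide_self simp_thms)
        then show "h l p = ?c l * (- ?\<mu> l * h l p) + ?\<mu> ?d * (?c l * h l p)"
          by (simp only: algebra_simps)
      qed
      then show ?thesis
        unfolding r top_def sum.distrib sum_distrib_left[symmetric] by (simp only: algebra_simps)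
    qed
    then have htop: "harmonic ?d top (\<lambda>p. Z p + (-1) *\<^sub>R (\<Sum>l\<in>?I. ?c l *\<^sub>R X l p))"
      using ltop unfolding harmonic_def by presburger
    define g where "g l = (if l < ?d then (\<lambda>p. ?c l * h l p) else if l = ?d then top else (\<lambda>p. 0))" for l
    define Y where "Y l = (if l < ?d then (\<lambda>p. ?c l *\<^sub>R X l p) else if l = ?d then
        (\<lambda>p. Z p + (-1) *\<^sub>R (\<Sum>l\<in>?I. ?c l *\<^sub>R X l p)) else (\<lambda>p. 0))" for l
    have "harmonic l (g l) (Y l)" for l
    proof -
      consider "l < ?d" | "l = ?d" | "l > ?d" by linarith
      then show ?thesis
      proof cases
        case 1
        then show ?thesis
          unfolding g_def Y_def by (simp only: if_True) (rule harmonic_cmult[OF h(1)])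
      next
        case 2
        then show ?thesis using htop by (simp add: g_def Y_def)
      next
        case 3
        then show ?thesis using harmonic_zero by (simp add: g_def Y_def)
      qed
    qed
    moreover have "\<forall>l>?d. g l = (\<lambda>p. 0)" by (simp add: g_def)
    moreover have "\<exists>c. g 0 = (\<lambda>p. c)" "\<exists>c. g 1 = (\<lambda>p. c * p $ 3)"
    proof -
      obtain a b where "h 0 = (\<lambda>p. a)" "h 1 = (\<lambda>p. b * p $ 3)" using h by blast
      then show "\<exists>c. g 0 = (\<lambda>p. c)" "\<exists>c. g 1 = (\<lambda>p. c * p $ 3)"
        using 3 by (auto simp: g_def intro: exI[of _ "?c 0 * a"] exI[of _ "?c 1 * b"])
    qed
    moreover have "?f p = (\<Sum>l\<le>?d. g l p)" for p
    proof -
      have "(\<Sum>l\<le>?d. g l p) = (\<Sum>l\<in>?I. g l p) + g ?d p"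
        by (simp add: lessThan_Suc_atMost[symmetric])
      also have "(\<Sum>l\<in>?I. g l p) = (\<Sum>l\<in>?I. ?c l * h l p)"
        by (rule sum.cong) (auto simp: g_def)
      also have "g ?d p = top p" by (simp add: g_def)
      finally show ?thesis by (simp add: top_def)
    qed
    ultimately show ?thesis unfolding spectral_sum_def by blast
  qed
qed

lemma even_poly_spectral_sum: "even_poly f \<Longrightarrow> \<exists>n. spectral_sum n f"
proof (induction rule: even_poly.induct)
  case (even_poly_monomial j k)
  then show ?case using spectral_sum_monomial by blast
next
  case (even_poly_add f g)
  then show ?case using spectral_sum_add by blast
next
  case (even_poly_cmult f c)
  then show ?case using spectral_sum_cmult by blast
qed

text \<open>
  Symmetry of the Laplacian and different eigenvalues.
\<close>

lemma harmonic_orthogonal: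
  assumes "harmonic l h X" "harmonic m g Y" "l \<noteq> m"
  shows "(\<integral>\<^sub>S p. h p * g p) = 0"
proof -
  let ?\<mu> = "\<lambda>l. real (l * (l + 1))"
  have "(\<integral>\<^sub>S p. X p \<bullet> Y p) = - (\<integral>\<^sub>S p. h p * (- ?\<mu> m * g p))"
    using assms unfolding harmonic_def by (intro sphere_laplacian_Green)
  moreover have "(\<integral>\<^sub>S p. Y p \<bullet> X p) = - (\<integral>\<^sub>S p. g p * (- ?\<mu> l * h p))"
    using assms unfolding harmonic_def by (intro sphere_laplacian_Green)
  moreover have "(\<integral>\<^sub>S p. h p * (- ?\<mu> m * g p)) = - ?\<mu> m * (\<integral>\<^sub>S p. h p * g p)"
    unfolding integral_mult_right_zero[symmetric] by (simp only: mult_ac)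
  moreover have "(\<integral>\<^sub>S p. g p * (- ?\<mu> l * h p)) = - ?\<mu> l * (\<integral>\<^sub>S p. h p * g p)"
    unfolding integral_mult_right_zero[symmetric] by (simp only: mult_ac)
  ultimately have "?\<mu> m * (\<integral>\<^sub>S p. h p * g p) = ?\<mu> l * (\<integral>\<^sub>S p. h p * g p)"
    by (simp only: inner_commute mult_minus_left minus_minus)
  moreover have "?\<mu> m \<noteq> ?\<mu> l"
  proof -
    have "m * (m + 1) < l * (l + 1)" if "m < l" for m l :: nat
      using that by (intro mult_strict_mono) auto
    then show ?thesis using \<open>l \<noteq> m\<close> by (metis less_irrefl nat_neq_iff of_nat_eq_iff)
  qed
  ultimately show ?thesis by simp
qed

text \<open>
  The identity of Parseval for finite sums.
\<close>

lemma integral_orthogonal_combination: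
  fixes h :: "nat \<Rightarrow> real^3 \<Rightarrow> real"
  assumes "finite I" and h: "\<And>i. square_integrable (h i)"
    and orth: "\<And>i j. i \<noteq> j \<Longrightarrow> (\<integral>\<^sub>S p. h i p * h j p) = 0"
  shows "(\<integral>\<^sub>S p. (\<Sum>i\<in>I. a i * h i p) * (\<Sum>i\<in>I. b i * h i p)) =
    (\<Sum>i\<in>I. a i * b i * (\<integral>\<^sub>S p. (h i p)\<^sup>2))"
proof -
  have "(\<integral>\<^sub>S p. (\<Sum>i\<in>I. a i * h i p) * (\<Sum>i\<in>I. b i * h i p)) =
      (\<integral>\<^sub>S p. (\<Sum>i\<in>I. \<Sum>j\<in>I. (a i * b j) * (h i p * h j p)))"
    by (simp add: sum_product mult_ac)
  also have "\<dots> = (\<Sum>i\<in>I. \<Sum>j\<in>I. (a i * b j) * (\<integral>\<^sub>S p. h i p * h j p))"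
    using square_integrable_mult[OF h h] by (subst Bochner_Integration.integral_sum) (auto intro!: sum.cong)
  also have "\<dots> = (\<Sum>i\<in>I. \<Sum>j\<in>I. if j = i then a i * b i * (\<integral>\<^sub>S p. (h i p)\<^sup>2) else 0)"
    using orth by (intro sum.cong refl) (auto simp: power2_eq_square)
  finally show ?thesis using \<open>finite I\<close> by (simp add: sum.delta)
qed

lemma le_of_square_le:
  fixes a c e :: real
  assumes "c * a\<^sup>2 \<le> e * a" "0 \<le> a" "0 \<le> e" shows "c * a \<le> e"
proof (cases "a = 0")
  case False
  then have "a > 0" using assms by simp
  moreover have "(c * a) * a \<le> e * a" using assms(1) by (simp add: power2_eq_square mult.assoc)
  ultimately show ?thesis by (simp only: mult_le_cancel_right_pos)
qed (use assms in simp)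

text \<open>
  The Poincare inequality in dual form. Let \<open>F\<close> be \<open>f\<close> without its components of degree below
  \<open>N\<close>, to which \<open>W\<close> is orthogonal, and let \<open>u\<close> solve \<open>- \<Delta> u = F\<close>. Then \<open>\<integral> W f = \<integral> W F = \<integral> H \<bullet> \<nabla>u\<close>,
  and the energy of \<open>u\<close> is at most \<open>\<integral> F\<^sup>2 / (N (N + 1))\<close> since only eigenvalues from \<open>N (N + 1)\<close> on
  occur in \<open>F\<close>.
\<close>

lemma spectral_inequality:
  assumes W: "square_integrable W" and H: "square_integrable H"
    and pair: "\<And>f X \<phi>. sphere_laplacian f X \<phi> \<Longrightarrow>
      (\<integral>\<^sub>S p. H p \<bullet> X p) = - (\<integral>\<^sub>S p. W p * \<phi> p)"
    and N: "N = 1 \<or> N = 2"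
    and W0: "(\<integral>\<^sub>S p. W p) = 0"
    and W1: "N = 2 \<Longrightarrow> (\<integral>\<^sub>S p. W p * p $ 3) = 0"
    and f: "even_poly f"
  shows "real (N * (N + 1)) * (\<integral>\<^sub>S p. W p * f p)\<^sup>2 \<le>
    (\<integral>\<^sub>S p. (norm (H p))\<^sup>2) * (\<integral>\<^sub>S p. (f p)\<^sup>2)"
proof -
  let ?\<mu> = "\<lambda>l. real (l * (l + 1))"
  obtain n h X where h: "\<And>l. harmonic l (h l) (X l)"
      "\<exists>c. h 0 = (\<lambda>p. c)" "\<exists>c. h 1 = (\<lambda>p. c * p $ 3)" "\<And>p. f p = (\<Sum>l\<le>n. h l p)"
    using even_poly_spectral_sum[OF f] unfolding spectral_sum_def by blast
  have sh: "square_integrable (h l)" for l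
    using h(1)[of l] unfolding harmonic_def by (intro square_integrable_smooth sphere_laplacian_smooth)
  have orth: "i \<noteq> j \<Longrightarrow> (\<integral>\<^sub>S p. h i p * h j p) = 0" for i j
    by (rule harmonic_orthogonal[OF h(1) h(1)])
  have low: "(\<integral>\<^sub>S p. W p * h l p) = 0" if "l < N" for l
  proof -
    have "l = 0 \<or> (l = 1 \<and> N = 2)" using that N by auto
    then show ?thesis
    proof
      assume "l = 0"
      moreover obtain c where "h 0 = (\<lambda>p. c)" using h by blast
      ultimately show ?thesis using W0 by simp
    next
      assume "l = 1 \<and> N = 2"
      moreover obtain c where "h 1 = (\<lambda>p. c * p $ 3)" using h by blast
      moreover have "(\<lambda>p. W p * (c * p $ 3)) = (\<lambda>p. c * (W p * p $ 3))" by (auto simp: mult_ac)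
      ultimately show ?thesis using W1 by simp
    qed
  qed
  define I where "I = {l. N \<le> l \<and> l \<le> n}"
  have fin: "finite I" and IN: "I \<subseteq> {..n}" by (auto simp: I_def)
  \<comment> \<open>the factor \<open>1\<close> brings the sum into the form of \<open>integral_orthogonal_combination\<close>\<close>
  define F where "F p = (\<Sum>l\<in>I. 1 * h l p)" for p
  define u where "u p = (\<Sum>l\<in>I. (1 / ?\<mu> l) * h l p)" for p
  define Y where "Y p = (\<Sum>l\<in>I. (1 / ?\<mu> l) *\<^sub>R X l p)" for p
  have \<mu>pos: "?\<mu> l > 0" "?\<mu> l \<ge> ?\<mu> N" if "l \<in> I" for l
  proof -
    have "l > 0" "N \<le> l" using that N by (auto simp: I_def)
    then show "?\<mu> l > 0" unfolding of_nat_0_less_iff by simp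
    show "?\<mu> l \<ge> ?\<mu> N" using \<open>N \<le> l\<close> by (intro of_nat_mono mult_le_mono) auto
  qed
  have "sphere_laplacian u Y (\<lambda>p. \<Sum>l\<in>I. (1 / ?\<mu> l) * (- ?\<mu> l * h l p))"
    unfolding u_def Y_def using h(1) unfolding harmonic_def by (intro sphere_laplacian_sum fin sphere_laplacian_cmult)
  moreover have "(\<lambda>p. \<Sum>l\<in>I. (1 / ?\<mu> l) * (- ?\<mu> l * h l p)) = (\<lambda>p. (-1) * F p)"
  proof
    fix p
    have "(\<Sum>l\<in>I. (1 / ?\<mu> l) * (- ?\<mu> l * h l p)) = (\<Sum>l\<in>I. - h l p)"
    proof (rule sum.cong[OF refl])
      fix l assume "l \<in> I"
      from \<mu>pos(1)[OF this] have "?\<mu> l \<noteq> 0" by linarith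
      moreover have "(1 / x) * (- x * y) = - y" if "x \<noteq> 0" for x y :: real using that by simp
      ultimately show "(1 / ?\<mu> l) * (- ?\<mu> l * h l p) = - h l p" by blast
    qed
    then show "(\<Sum>l\<in>I. (1 / ?\<mu> l) * (- ?\<mu> l * h l p)) = (-1) * F p" by (simp add: F_def sum_negf)
  qed
  ultimately have lu: "sphere_laplacian u Y (\<lambda>p. (-1) * F p)" by (simp only:)
  have sF: "square_integrable F" unfolding F_def by (intro square_integrable_sum square_integrable_cmult sh)
  have sY: "square_integrable Y" using sphere_laplacian_smooth[OF lu] by (intro square_integrable_smooth_field)
  have "(\<integral>\<^sub>S p. W p * f p) = (\<Sum>l\<le>n. \<integral>\<^sub>S p. W p * h l p)"
    using square_integrable_mult[OF W sh] by (simp add: h(4) sum_distrib_left)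
  also have "\<dots> = (\<Sum>l\<in>I. \<integral>\<^sub>S p. W p * h l p)"
  proof (rule sum.mono_neutral_right)
    show "\<forall>l\<in>{..n} - I. (\<integral>\<^sub>S p. W p * h l p) = 0"
    proof
      fix l assume "l \<in> {..n} - I"
      then have "l < N" by (auto simp: I_def)
      then show "(\<integral>\<^sub>S p. W p * h l p) = 0" by (rule low)
    qed
  qed (use IN in auto)
  also have "\<dots> = (\<integral>\<^sub>S p. W p * F p)"
    using square_integrable_mult[OF W sh] by (simp add: F_def sum_distrib_left)
  also have "\<dots> = (\<integral>\<^sub>S p. H p \<bullet> Y p)"
    unfolding pair[OF lu] by simp
  finally have "(\<integral>\<^sub>S p. W p * f p)\<^sup>2 \<le>
      (\<integral>\<^sub>S p. (norm (H p))\<^sup>2) * (\<integral>\<^sub>S p. (norm (Y p))\<^sup>2)"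
    using Cauchy_Schwarz_sphere[OF H sY] by simp
  moreover have "?\<mu> N * (\<integral>\<^sub>S p. (norm (Y p))\<^sup>2) \<le> (\<integral>\<^sub>S p. (f p)\<^sup>2)"
  proof -
    have "(\<integral>\<^sub>S p. (norm (Y p))\<^sup>2) = (\<integral>\<^sub>S p. u p * F p)"
      using sphere_laplacian_Green[OF lu lu] by (simp add: power2_norm_eq_inner)
    also have "\<dots> = (\<Sum>l\<in>I. (1 / ?\<mu> l) * 1 * (\<integral>\<^sub>S p. (h l p)\<^sup>2))"
      unfolding u_def F_def by (rule integral_orthogonal_combination[OF fin sh orth])
    finally have "?\<mu> N * (\<integral>\<^sub>S p. (norm (Y p))\<^sup>2) =
        (\<Sum>l\<in>I. (?\<mu> N / ?\<mu> l) * (\<integral>\<^sub>S p. (h l p)\<^sup>2))"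
      by (simp only: sum_distrib_left times_divide_eq_left times_divide_eq_right mult_1_left mult_1_right mult.assoc)
    also have "\<dots> \<le> (\<Sum>l\<in>I. 1 * (\<integral>\<^sub>S p. (h l p)\<^sup>2))"
    proof (rule sum_mono, rule mult_right_mono)
      fix l assume "l \<in> I"
      from \<mu>pos[OF this] show "?\<mu> N / ?\<mu> l \<le> 1" by (simp only: divide_le_eq_1_pos)
    qed simp
    also have "\<dots> \<le> (\<Sum>l\<le>n. 1 * 1 * (\<integral>\<^sub>S p. (h l p)\<^sup>2))"
      using IN by (simp, intro sum_mono2) auto
    also have "\<dots> = (\<integral>\<^sub>S p. (\<Sum>l\<le>n. 1 * h l p) * (\<Sum>l\<le>n. 1 * h l p))"
      by (rule integral_orthogonal_combination[OF _ sh orth, symmetric]) auto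
    also have "\<dots> = (\<integral>\<^sub>S p. (f p)\<^sup>2)"
      by (simp add: h(4) power2_eq_square)
    finally show ?thesis .
  qed
  ultimately show ?thesis
  proof -
    assume a: "(\<integral>\<^sub>S p. W p * f p)\<^sup>2 \<le>
      (\<integral>\<^sub>S p. (norm (H p))\<^sup>2) * (\<integral>\<^sub>S p. (norm (Y p))\<^sup>2)"
    assume b: "?\<mu> N * (\<integral>\<^sub>S p. (norm (Y p))\<^sup>2) \<le> (\<integral>\<^sub>S p. (f p)\<^sup>2)"
    have "?\<mu> N * (\<integral>\<^sub>S p. W p * f p)\<^sup>2 \<le>
      ?\<mu> N * ((\<integral>\<^sub>S p. (norm (H p))\<^sup>2) * (\<integral>\<^sub>S p. (norm (Y p))\<^sup>2))"
      by (rule mult_left_mono[OF a]) simp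
    also have "\<dots> = (\<integral>\<^sub>S p. (norm (H p))\<^sup>2) * (?\<mu> N * (\<integral>\<^sub>S p. (norm (Y p))\<^sup>2))"
      by (simp only: mult_ac)
    also have "\<dots> \<le> (\<integral>\<^sub>S p. (norm (H p))\<^sup>2) * (\<integral>\<^sub>S p. (f p)\<^sup>2)"
      by (rule mult_left_mono[OF b]) simp
    finally show ?thesis .
  qed
qed

text \<open>
  The dual inequality with \<open>f\<close> tending to \<open>W\<close>.
\<close>

theorem even_Poincare:
  assumes W: "square_integrable W" and H: "square_integrable H"
    and inv: "\<And>p. W (flip 1 p) = W p" "\<And>p. W (flip 2 p) = W p"
    and pair: "\<And>f X \<phi>. sphere_laplacian f X \<phi> \<Longrightarrow>
      (\<integral>\<^sub>S p. H p \<bullet> X p) = - (\<integral>\<^sub>S p. W p * \<phi> p)"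
    and N: "N = 1 \<or> N = 2"
    and W0: "(\<integral>\<^sub>S p. W p) = 0"
    and W1: "N = 2 \<Longrightarrow> (\<integral>\<^sub>S p. W p * p $ 3) = 0"
  shows "real (N * (N + 1)) * (\<integral>\<^sub>S p. (W p)\<^sup>2) \<le> (\<integral>\<^sub>S p. (norm (H p))\<^sup>2)"
proof -
  obtain f where f: "\<And>n. even_poly (f n)"
    "(\<lambda>n. \<integral>\<^sub>S p. (W p - f n p)\<^sup>2) \<longlonglongrightarrow> 0"
    using parity_approx[OF W, of 1] inv by auto
  have sf: "square_integrable (f n)" for n by (intro square_integrable_smooth even_poly_smooth f)
  let ?A = "\<integral>\<^sub>S p. (W p)\<^sup>2"
  let ?E = "\<integral>\<^sub>S p. (norm (H p))\<^sup>2"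
  have "(\<lambda>n. \<integral>\<^sub>S p. W p * f n p) \<longlonglongrightarrow> ?A"
    using square_integrable_convergence(1)[OF W sf f(2) W] by (simp add: power2_eq_square)
  then have 1: "(\<lambda>n. real (N * (N + 1)) * (\<integral>\<^sub>S p. W p * f n p)\<^sup>2) \<longlonglongrightarrow> real (N * (N + 1)) * ?A\<^sup>2"
    by (intro tendsto_intros)
  have 2: "(\<lambda>n. ?E * (\<integral>\<^sub>S p. (f n p)\<^sup>2)) \<longlonglongrightarrow> ?E * ?A"
    by (intro tendsto_mult tendsto_const square_integrable_convergence(2)[OF W sf f(2)])
  have "real (N * (N + 1)) * ?A\<^sup>2 \<le> ?E * ?A"
    by (rule LIMSEQ_le[OF 1 2], intro exI allI impI)
      (rule spectral_inequality[OF W H pair N W0 W1 f(1)])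
  moreover have "?A \<ge> 0" "?E \<ge> 0" by simp_all
  ultimately show ?thesis by (rule le_of_square_le)
qed

section \<open>The Poincare inequality in a parity class\<close>

lemma conjugate_has_derivative:
  fixes T :: "real^3 \<Rightarrow> real^3"
  assumes T: "linear T" and X: "X differentiable (at (T x))"
  shows "((\<lambda>p. T (X (T p))) has_derivative (\<lambda>v. T (frechet_derivative X (at (T x)) (T v)))) (at x)"
proof -
  have bT: "bounded_linear T" using T by (simp add: linear_conv_bounded_linear)
  have "(X has_derivative frechet_derivative X (at (T x))) (at (T x))"
    using X by (simp add: frechet_derivative_works)
  from diff_chain_at[OF bounded_linear_imp_has_derivative[OF bT] this]
  have "((\<lambda>p. X (T p)) has_derivative (\<lambda>v. frechet_derivative X (at (T x)) (T v))) (at x)"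
    by (simp add: o_def)
  from bounded_linear.has_derivative[OF bT this] show ?thesis .
qed

lemma conjugate_Ck:
  fixes T :: "real^3 \<Rightarrow> real^3"
  assumes T: "linear T"
  shows "Ck k X \<Longrightarrow> Ck k (\<lambda>p. T (X (T p)))"
proof (induction k arbitrary: X)
  case 0
  have "continuous_on UNIV T" using T by (simp add: linear_continuous_on linear_conv_bounded_linear)
  then show ?case
    using 0 by (auto intro!: continuous_on_compose2[of UNIV T] continuous_on_compose2[of UNIV X])
next
  case (Suc k)
  have d: "((\<lambda>p. T (X (T p))) has_derivative (\<lambda>v. T (frechet_derivative X (at (T x)) (T v)))) (at x)" for x
    using Suc.prems by (intro conjugate_has_derivative[OF T]) simp
  have "frechet_derivative (\<lambda>p. T (X (T p))) (at x) h = T (frechet_derivative X (at (T x)) (T h))" for x h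
    using fun_cong[OF frechet_derivative_at[OF d]] by metis
  moreover have "Ck k (\<lambda>x. T (frechet_derivative X (at (T x)) (T h)))" for h
    using Suc.IH[of "\<lambda>x. frechet_derivative X (at x) (T h)"] Suc.prems by simp
  ultimately show ?case using differentiableI[OF d] by simp
qed

text \<open>
  The divergence is a trace, hence invariant under conjugation.
\<close>

lemma flip_sphere_div:
  assumes X: "X differentiable (at (flip i p))"
  shows "sphere_div (\<lambda>p. flip i (X (flip i p))) p = sphere_div X (flip i p)"
proof -
  let ?D = "frechet_derivative X (at (flip i p))"
  have "(X has_derivative ?D) (at (flip i p))" using X by (simp add: frechet_derivative_works)
  then have lin: "linear ?D" by (rule has_derivative_linear)
  have D: "frechet_derivative (\<lambda>p. flip i (X (flip i p))) (at p) = (\<lambda>v. flip i (?D (flip i v)))"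
    by (rule frechet_derivative_at[symmetric, OF conjugate_has_derivative[OF flip_linear X]])
  have sw: "flip i u \<bullet> v = u \<bullet> flip i v" for u v
    using flip_inner[of i u "flip i v"] by simp
  have "?D (flip i b) \<bullet> flip i b = ?D b \<bullet> b" if "b \<in> Basis" for b
  proof -
    obtain j where j: "b = axis j 1" using \<open>b \<in> Basis\<close> unfolding Basis_vec_def by auto
    have "flip i b = (if i = j then -1 else 1) *\<^sub>R b"
      unfolding j by (auto simp: vec_eq_iff axis_def)
    then show ?thesis by (simp add: linear_scale[OF lin])
  qed
  then show ?thesis
    unfolding sphere_div_def D sw by simp
qed

lemma test_fieldD:
  assumes "test_field \<Omega> X"
  shows "Ck k X" "p \<in> sphere 0 1 \<Longrightarrow> X p \<bullet> p = 0"
    "\<exists>K. compact K \<and> K \<subseteq> \<Omega> \<and> (\<forall>p \<in> sphere 0 1 - K. X p = 0)"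
  using assms unfolding test_field_def by blast+

lemma flip_test_field:
  assumes X: "test_field \<Omega> X" and \<Omega>: "\<And>p. p \<in> \<Omega> \<Longrightarrow> flip i p \<in> \<Omega>"
  shows "test_field \<Omega> (\<lambda>p. flip i (X (flip i p)))"
  unfolding test_field_def
proof (intro conjI allI ballI)
  show "Ck k (\<lambda>p. flip i (X (flip i p)))" for k
    by (rule conjugate_Ck[OF flip_linear test_fieldD(1)[OF X]])
  show "flip i (X (flip i p)) \<bullet> p = 0" if p: "p \<in> sphere 0 1" for p
  proof -
    have "flip i p \<in> sphere 0 1" using p by simp
    from test_fieldD(2)[OF X this] flip_inner[of i "X (flip i p)" "flip i p"]
    show ?thesis by (simp only: flip_flip)
  qed
  obtain K where K: "compact K" "K \<subseteq> \<Omega>" "\<forall>p \<in> sphere 0 1 - K. X p = 0"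
    using test_fieldD(3)[OF X] by (elim exE conjE)
  have z: "flip i 0 = 0" by (simp add: vec_eq_iff)
  show "\<exists>K. compact K \<and> K \<subseteq> \<Omega> \<and> (\<forall>p\<in>sphere 0 1 - K. flip i (X (flip i p)) = 0)"
  proof (intro exI[of _ "flip i ` K"] conjI ballI)
    have "continuous_on K (flip i)"
      using flip_linear by (simp add: linear_continuous_on linear_conv_bounded_linear)
    then show "compact (flip i ` K)" using K by (intro compact_continuous_image)
    show "flip i ` K \<subseteq> \<Omega>" by (intro image_subsetI \<Omega> subsetD[OF K(2)])
    fix p assume p: "p \<in> sphere 0 1 - flip i ` K"
    have "flip i p \<notin> K"
    proof
      assume "flip i p \<in> K"
      then have "flip i (flip i p) \<in> flip i ` K" by (rule imageI)
      then show False using p by simp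
    qed
    moreover have "flip i p \<in> sphere 0 1" using p by simp
    ultimately have "X (flip i p) = 0" using K(3) by (intro bspec[OF K(3)] DiffI)
    then show "flip i (X (flip i p)) = 0" by (simp only: z)
  qed
qed

text \<open>
  Change variables and test with the reflected field.
\<close>

lemma weak_pair_flip:
  assumes wp: "weak_pair \<Omega> w G" and \<Omega>: "\<And>p. p \<in> \<Omega> \<Longrightarrow> flip i p \<in> \<Omega>"
  shows "weak_pair \<Omega> (\<lambda>p. w (flip i p)) (\<lambda>p. flip i (G (flip i p)))"
  unfolding weak_pair_def
proof (intro conjI allI impI)
  have w: "square_integrable w" and G: "square_integrable G" using wp by (auto simp: weak_pair_def)
  note [measurable] = square_integrable_measurable[OF w] square_integrable_measurable[OF G]
    orthogonal_transformation_measurable[OF flip_orthogonal]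
  show "square_integrable (\<lambda>p. w (flip i p))" by (rule square_integrable_orthogonal[OF flip_orthogonal w])
  have "square_integrable (\<lambda>p. G (flip i p))" by (rule square_integrable_orthogonal[OF flip_orthogonal G])
  then show "square_integrable (\<lambda>p. flip i (G (flip i p)))" unfolding square_integrable_def by simp
  fix X assume X: "test_field \<Omega> X"
  have X1: "Ck 1 X" "Ck 0 X" using X unfolding test_field_def by blast+
  then have dX: "X differentiable (at p)" for p by simp
  note [measurable] = borel_measurable_continuous_onI[OF Ck_1_sphere_div_continuous[OF X1(1)]]
  have [measurable]: "X \<in> borel_measurable borel"
    using X1(2) by (simp add: borel_measurable_continuous_onI)
  let ?X = "\<lambda>p. flip i (X (flip i p))"
  have "(\<integral>\<^sub>S p. w (flip i p) * sphere_div X p) =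
      (\<integral>\<^sub>S p. w (flip i p) * sphere_div X (flip i (flip i p)))" by simp
  also have "\<dots> = (\<integral>\<^sub>S p. w p * sphere_div X (flip i p))"
    by (rule integral_orthogonal_transformation(1)[OF flip_orthogonal, of "\<lambda>p. w p * sphere_div X (flip i p)"]) measurable
  also have "\<dots> = (\<integral>\<^sub>S p. w p * sphere_div ?X p)"
    by (simp add: flip_sphere_div dX)
  \<comment> \<open>the reflected field is a test field as \<open>\<Omega>\<close> is invariant\<close>
  also have "\<dots> = - (\<integral>\<^sub>S p. G p \<bullet> ?X p)"
    using wp flip_test_field[OF X \<Omega>] by (simp add: weak_pair_def)
  also have "(\<integral>\<^sub>S p. G p \<bullet> ?X p) = (\<integral>\<^sub>S p. G (flip i p) \<bullet> flip i (X (flip i (flip i p))))"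
    by (rule integral_orthogonal_transformation(1)[OF flip_orthogonal, of "\<lambda>p. G p \<bullet> ?X p", symmetric]) measurable
  also have "\<dots> = (\<integral>\<^sub>S p. flip i (G (flip i p)) \<bullet> X p)"
  proof -
    have "u \<bullet> flip i v = flip i u \<bullet> v" for u v using flip_inner[of i u "flip i v"] by simp
    then show ?thesis by simp
  qed
  finally show "(\<integral>\<^sub>S p. w (flip i p) * sphere_div X p) =
      - (\<integral>\<^sub>S p. flip i (G (flip i p)) \<bullet> X p)" .
qed

lemma test_field_square_integrable: assumes "test_field \<Omega> X" shows "square_integrable X" "square_integrable (sphere_div X)"
proof -
  have "Ck 1 X" "Ck 0 X" using assms unfolding test_field_def by blast+
  then show "square_integrable X" "square_integrable (sphere_div X)"
    using Ck_1_sphere_div_continuous by (auto intro: square_integrable_continuous)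
qed

lemma weak_pair_add:
  assumes "weak_pair \<Omega> w G" "weak_pair \<Omega> u F"
  shows "weak_pair \<Omega> (\<lambda>p. w p + u p) (\<lambda>p. G p + F p)"
proof -
  have s: "square_integrable w" "square_integrable G" "square_integrable u" "square_integrable F" using assms by (auto simp: weak_pair_def)
  show ?thesis
    unfolding weak_pair_def
  proof (intro conjI allI impI square_integrable_add s)
    fix X assume X: "test_field \<Omega> X"
    note t = test_field_square_integrable[OF X]
    show "(\<integral>\<^sub>S p. (w p + u p) * sphere_div X p) = - (\<integral>\<^sub>S p. (G p + F p) \<bullet> X p)"
      using assms X square_integrable_mult[OF s(1) t(2)] square_integrable_mult[OF s(3) t(2)] square_integrable_inner[OF s(2) t(1)] square_integrable_inner[OF s(4) t(1)]
      by (simp add: distrib_right inner_add_left weak_pair_def)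
  qed
qed

lemma weak_pair_cmult:
  assumes "weak_pair \<Omega> w G" shows "weak_pair \<Omega> (\<lambda>p. c * w p) (\<lambda>p. c *\<^sub>R G p)"
  using assms unfolding weak_pair_def by (auto intro: square_integrable_cmult square_integrable_scaleR simp: mult.assoc)

lemma weak_pair_sum:
  assumes "\<And>i. i \<in> I \<Longrightarrow> weak_pair \<Omega> (w i) (G i)"
  shows "weak_pair \<Omega> (\<lambda>p. \<Sum>i\<in>I. w i p) (\<lambda>p. \<Sum>i\<in>I. G i p)"
proof -
  have "weak_pair \<Omega> (\<lambda>p. 0) (\<lambda>p. 0)" by (simp add: weak_pair_def square_integrable_zero)
  with assms show ?thesis
  proof (induction I rule: infinite_finite_induct)
    case (insert i I)
    have "weak_pair \<Omega> (\<lambda>p. w i p + (\<Sum>i\<in>I. w i p)) (\<lambda>p. G i p + (\<Sum>i\<in>I. G i p))"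
      by (rule weak_pair_add) (use insert in auto)
    then show ?case using insert(1,2) by simp
  qed simp_all
qed

definition parity_part :: "3 \<Rightarrow> real \<Rightarrow> (real^3 \<Rightarrow> real) \<Rightarrow> real^3 \<Rightarrow> real" where
  "parity_part i s w = (\<lambda>p. (1/2) * (w p + s * w (flip i p)))"

definition parity_part_field :: "3 \<Rightarrow> real \<Rightarrow> (real^3 \<Rightarrow> real^3) \<Rightarrow> real^3 \<Rightarrow> real^3" where
  "parity_part_field i s G = (\<lambda>p. (1/2) *\<^sub>R (G p + s *\<^sub>R flip i (G (flip i p))))"

lemma weak_pair_parity_part:
  assumes "weak_pair \<Omega> w G" "\<And>p. p \<in> \<Omega> \<Longrightarrow> flip i p \<in> \<Omega>"
  shows "weak_pair \<Omega> (parity_part i s w) (parity_part_field i s G)"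
  unfolding parity_part_def parity_part_field_def
  by (intro weak_pair_cmult weak_pair_add assms(1) weak_pair_flip assms(2))

lemma parity_part_flip: "s * s = 1 \<Longrightarrow> parity_part i s w (flip i p) = s * parity_part i s w p"
proof -
  assume "s * s = 1"
  then have "s * (s * x) = x" for x by (simp add: mult.assoc[symmetric])
  then show ?thesis by (simp add: parity_part_def distrib_left)
qed

lemma flip_commute: "flip i (flip j p) = flip j (flip i p)"
  by (simp add: vec_eq_iff)

lemma parity_part_flip_other:
  "(\<And>p. w (flip j p) = t * w p) \<Longrightarrow> parity_part i s w (flip j p) = t * parity_part i s w p"
proof -
  assume "\<And>p. w (flip j p) = t * w p"
  then have "w (flip i (flip j p)) = t * w (flip i p)" "w (flip j p) = t * w p"
    unfolding flip_commute[of i j] by simp_all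
  then show ?thesis by (simp add: parity_part_def distrib_left)
qed

text \<open>
  The parallelogram identity, in the form that is used for the two parity parts of a function and of
  a field.
\<close>

lemma norm_square_halves:
  fixes u u' :: "real^3 \<Rightarrow> 'b::euclidean_space"
  assumes u: "square_integrable u" "square_integrable u'"
    and eq: "(\<integral>\<^sub>S p. (norm (u' p))\<^sup>2) = (\<integral>\<^sub>S p. (norm (u p))\<^sup>2)"
  shows "(\<integral>\<^sub>S p. (norm (u p))\<^sup>2) =
    (\<integral>\<^sub>S p. (norm ((1/2) *\<^sub>R (u p + 1 *\<^sub>R u' p)))\<^sup>2) +
    (\<integral>\<^sub>S p. (norm ((1/2) *\<^sub>R (u p + (-1) *\<^sub>R u' p)))\<^sup>2)"
proof -
  have half: "(norm ((1/2) *\<^sub>R v))\<^sup>2 = (norm v)\<^sup>2 / 4" for v :: 'b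
    by (simp add: power_divide)
  show ?thesis
    unfolding half using norm_square_integral_add[OF u] norm_square_integral_add[OF u(1) square_integrable_minus[OF u(2)]] eq
    by (simp add: add_divide_distrib diff_divide_distrib)
qed

lemma parity_part_norm:
  assumes w: "square_integrable w"
  shows "(\<integral>\<^sub>S p. (w p)\<^sup>2) =
    (\<integral>\<^sub>S p. (parity_part i 1 w p)\<^sup>2) + (\<integral>\<^sub>S p. (parity_part i (-1) w p)\<^sup>2)"
proof -
  note [measurable] = square_integrable_measurable[OF w]
  have "(\<integral>\<^sub>S p. (w (flip i p))\<^sup>2) = (\<integral>\<^sub>S p. (w p)\<^sup>2)"
    by (rule integral_orthogonal_transformation(1)[OF flip_orthogonal, of "\<lambda>p. (w p)\<^sup>2"]) measurable
  then show ?thesis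
    using norm_square_halves[OF w square_integrable_orthogonal[OF flip_orthogonal w, of i]] by (simp add: parity_part_def power_divide)
qed

lemma parity_part_field_norm:
  assumes G: "square_integrable G"
  shows "(\<integral>\<^sub>S p. (norm (G p))\<^sup>2) =
    (\<integral>\<^sub>S p. (norm (parity_part_field i 1 G p))\<^sup>2) + (\<integral>\<^sub>S p. (norm (parity_part_field i (-1) G p))\<^sup>2)"
proof -
  note [measurable] = square_integrable_measurable[OF G] orthogonal_transformation_measurable[OF flip_orthogonal]
  have "(\<integral>\<^sub>S p. (norm (G (flip i p)))\<^sup>2) = (\<integral>\<^sub>S p. (norm (G p))\<^sup>2)"
    by (rule integral_orthogonal_transformation(1)[OF flip_orthogonal, of "\<lambda>p. (norm (G p))\<^sup>2"]) measurable
  moreover have "square_integrable (\<lambda>p. flip i (G (flip i p)))"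
    using square_integrable_orthogonal[OF flip_orthogonal G, of i] unfolding square_integrable_def by simp
  ultimately show ?thesis
    using norm_square_halves[OF G, of "\<lambda>p. flip i (G (flip i p))"] by (simp add: parity_part_field_def)
qed

definition quarter_sign :: "real \<Rightarrow> real \<Rightarrow> real^3 \<Rightarrow> real" where
  "quarter_sign e d p = side_weight e (p $ 1) * side_weight d (p $ 2)"

lemma quarter_sign_measurable [measurable]: "quarter_sign e d \<in> borel_measurable borel"
  unfolding quarter_sign_def by measurable

lemma quarter_sign_flip:
  assumes "e * e = 1" "d * d = 1"
  shows "quarter_sign e d (flip 1 p) = e * quarter_sign e d p"
    "quarter_sign e d (flip 2 p) = d * quarter_sign e d p"
  using assms by (auto simp: quarter_sign_def side_weight_def)

lemma quarter_sign_bound: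
  "e * e = 1 \<Longrightarrow> d * d = 1 \<Longrightarrow> \<bar>quarter_sign e d p\<bar> \<le> 1"
  by (auto simp: quarter_sign_def side_weight_def abs_mult square_eq_1_iff)

lemma AE_quarter_sign_square:
  assumes "e * e = 1" "d * d = 1"
  shows "AE p in sphere_measure. (quarter_sign e d p)\<^sup>2 = 1"
  using AE_coord_nonzero[of 1] AE_coord_nonzero[of 2]
  by eventually_elim (use assms in \<open>auto simp: quarter_sign_def side_weight_def power2_eq_square square_eq_1_iff\<close>)

lemma quarter_sign_square_integrable:
  fixes f :: "real^3 \<Rightarrow> 'b::euclidean_space"
  assumes f: "square_integrable f" and ed: "e * e = 1" "d * d = 1"
  shows "square_integrable (\<lambda>p. quarter_sign e d p *\<^sub>R f p)"
    "(\<integral>\<^sub>S p. (norm (quarter_sign e d p *\<^sub>R f p))\<^sup>2) = (\<integral>\<^sub>S p. (norm (f p))\<^sup>2)"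
proof -
  note [measurable] = square_integrable_measurable[OF f]
  show "square_integrable (\<lambda>p. quarter_sign e d p *\<^sub>R f p)"
    by (rule square_integrable_mult_bounded[OF f _ quarter_sign_bound[OF ed]]) measurable
  show "(\<integral>\<^sub>S p. (norm (quarter_sign e d p *\<^sub>R f p))\<^sup>2) = (\<integral>\<^sub>S p. (norm (f p))\<^sup>2)"
  proof (rule integral_cong_AE)
    show "AE p in sphere_measure. (norm (quarter_sign e d p *\<^sub>R f p))\<^sup>2 = (norm (f p))\<^sup>2"
      using AE_quarter_sign_square[OF ed] by eventually_elim (simp add: power_mult_distrib)
  qed measurable
qed

text \<open>
  After multiplication by a product of signs, \<open>w\<close> still has \<open>G\<close>, multiplied by the same signs, as a
  gradient for testing with gradients of even polynomials.
\<close>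

lemma weak_pair_even_pairing:
  assumes wp: "weak_pair \<Omega> w G"
    and \<Omega>: "{p \<in> sphere 0 1. p $ 1 \<noteq> 0 \<and> p $ 2 \<noteq> 0} \<subseteq> \<Omega>"
    and ed: "e * e = 1" "d * d = 1" and f: "sphere_laplacian f X \<phi>"
  shows "(\<integral>\<^sub>S p. (quarter_sign e d p *\<^sub>R G p) \<bullet> X p) =
    - (\<integral>\<^sub>S p. (quarter_sign e d p * w p) * \<phi> p)"
proof -
  obtain C where X: "smooth_field X" "tangential X"
    and C: "\<And>p. p \<in> sphere 0 1 \<Longrightarrow> \<bar>X p $ 1\<bar> \<le> C * \<bar>p $ 1\<bar>"
      "\<And>p. p \<in> sphere 0 1 \<Longrightarrow> \<bar>X p $ 2\<bar> \<le> C * \<bar>p $ 2\<bar>"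
    and div: "\<And>p. p \<in> sphere 0 1 \<Longrightarrow> sphere_div X p = \<phi> p"
    using sphere_laplacian_properties[OF f] by blast
  have abs: "\<bar>e\<bar> \<le> 1" "\<bar>d\<bar> \<le> 1" using ed by (auto simp: square_eq_1_iff)
  have w: "square_integrable w" using wp by (simp add: weak_pair_def)
  have "\<phi> \<in> borel_measurable borel" using f
  proof induction
    case (sphere_laplacian_monomial m j k)
    show ?case by (intro borel_measurable_continuous_onI continuous_intros)
  qed auto
  note [measurable] = this square_integrable_measurable[OF w]
    borel_measurable_continuous_onI[OF smooth_continuous[OF smooth_sphere_div[OF X(1)]]]
  have "(\<integral>\<^sub>S p. (quarter_sign e d p * w p) * \<phi> p) =
      (\<integral>\<^sub>S p. quarter_sign e d p * (w p * sphere_div X p))"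
  proof (rule integral_cong_AE)
    show "AE p in sphere_measure. (quarter_sign e d p * w p) * \<phi> p = quarter_sign e d p * (w p * sphere_div X p)"
      using AE_sphere by eventually_elim (simp add: div)
  qed measurable
  then show ?thesis
    using weak_pair_cutoff[OF wp \<Omega> X C abs] by (simp add: quarter_sign_def)
qed

text \<open>
  \<open>quarter_sign e d * w\<close> is even in both variables, so \<open>even_Poincare\<close> applies to it.
\<close>

lemma parity_Poincare:
  assumes wp: "weak_pair \<Omega> w G"
    and \<Omega>: "{p \<in> sphere 0 1. p $ 1 \<noteq> 0 \<and> p $ 2 \<noteq> 0} \<subseteq> \<Omega>"
    and ed: "e * e = 1" "d * d = 1"
    and inv: "\<And>p. w (flip 1 p) = e * w p" "\<And>p. w (flip 2 p) = d * w p"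
    and mean: "(\<integral>\<^sub>S p. quarter_sign e d p * w p) = 0"
  shows "2 * (\<integral>\<^sub>S p. (w p)\<^sup>2) \<le> (\<integral>\<^sub>S p. (norm (G p))\<^sup>2)"
proof -
  have s: "square_integrable w" "square_integrable G" using wp by (auto simp: weak_pair_def)
  have inv': "quarter_sign e d (flip 1 p) * w (flip 1 p) = quarter_sign e d p * w p"
    "quarter_sign e d (flip 2 p) * w (flip 2 p) = quarter_sign e d p * w p" for p
    using ed by (auto simp: quarter_sign_flip[OF ed] inv square_eq_1_iff)
  have "real (1 * (1 + 1)) * (\<integral>\<^sub>S p. (quarter_sign e d p * w p)\<^sup>2) \<le>
      (\<integral>\<^sub>S p. (norm (quarter_sign e d p *\<^sub>R G p))\<^sup>2)"
    by (rule even_Poincare[where N = 1])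
      (use quarter_sign_square_integrable(1)[OF s(1) ed] quarter_sign_square_integrable(1)[OF s(2) ed] inv' mean
        weak_pair_even_pairing[OF wp \<Omega> ed] in auto)
  then show ?thesis
    using quarter_sign_square_integrable(2)[OF s(1) ed] quarter_sign_square_integrable(2)[OF s(2) ed] by simp
qed

section \<open>The angular Wirtinger inequality below the crack\<close>

abbreviation north_cross :: "real^3 \<Rightarrow> real^3" where
  "north_cross \<equiv> cross3 (axis 3 1)"

text \<open>
  \<open>g\<close> is the derivative of \<open>f\<close> along the rotation about the axis through the poles, the derivative in
  the longitude \<open>\<phi>\<close>. As a relation it can be composed by rules, without choosing gradients.
\<close>

definition angular_deriv :: "(real^3 \<Rightarrow> real) \<Rightarrow> (real^3 \<Rightarrow> real) \<Rightarrow> bool" where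
  "angular_deriv f g \<longleftrightarrow> smooth f \<and> (\<exists>h. has_grad f h \<and> smooth_field h \<and> (\<forall>p. h p \<bullet> north_cross p = g p))"

lemma angular_derivI: "smooth f \<Longrightarrow> has_grad f h \<Longrightarrow> smooth_field h \<Longrightarrow> (\<And>p. h p \<bullet> north_cross p = g p) \<Longrightarrow> angular_deriv f g"
  unfolding angular_deriv_def by (intro conjI exI allI)

lemma angular_derivE:
  assumes "angular_deriv f g"
  obtains h where "smooth f" "has_grad f h" "smooth_field h" "\<And>p. h p \<bullet> north_cross p = g p"
  using assms unfolding angular_deriv_def by (elim conjE exE) simp

lemma angular_deriv_add: assumes "angular_deriv f f'" "angular_deriv g g'" shows "angular_deriv (\<lambda>p. f p + g p) (\<lambda>p. f' p + g' p)"
proof -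
  obtain h where h: "smooth f" "has_grad f h" "smooth_field h" "\<And>p. h p \<bullet> north_cross p = f' p"
    using angular_derivE[OF assms(1)] by metis
  obtain k where k: "smooth g" "has_grad g k" "smooth_field k" "\<And>p. k p \<bullet> north_cross p = g' p"
    using angular_derivE[OF assms(2)] by metis
  show ?thesis
    by (rule angular_derivI[OF smooth_add[OF h(1) k(1)] has_grad_add[OF h(2) k(2)] smooth_field_add[OF h(3) k(3)]])
      (simp add: inner_add_left h k)
qed

lemma angular_deriv_mult:
  assumes "angular_deriv f f'" "angular_deriv g g'" shows "angular_deriv (\<lambda>p. f p * g p) (\<lambda>p. f p * g' p + g p * f' p)"
proof -
  obtain h where h: "smooth f" "has_grad f h" "smooth_field h" "\<And>p. h p \<bullet> north_cross p = f' p"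
    using angular_derivE[OF assms(1)] by metis
  obtain k where k: "smooth g" "has_grad g k" "smooth_field k" "\<And>p. k p \<bullet> north_cross p = g' p"
    using angular_derivE[OF assms(2)] by metis
  have "smooth_field (\<lambda>p. f p *\<^sub>R k p + g p *\<^sub>R h p)"
    by (intro smooth_field_add smooth_field_scaleR h k)
  from angular_derivI[OF smooth_mult[OF h(1) k(1)] has_grad_mult[OF h(2) k(2)] this] show ?thesis
    by (simp add: inner_add_left h k)
qed

lemma angular_deriv_const: "angular_deriv (\<lambda>p. c) (\<lambda>p. 0)"
  by (rule angular_derivI[OF smooth_const has_grad_const smooth_field_const]) simp

lemma angular_deriv_cmult: "angular_deriv f f' \<Longrightarrow> angular_deriv (\<lambda>p. c * f p) (\<lambda>p. c * f' p)"
  using angular_deriv_mult[OF angular_deriv_const[of c]] by simp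

lemma angular_deriv_sum: "finite I \<Longrightarrow> (\<And>i. i \<in> I \<Longrightarrow> angular_deriv (f i) (g i)) \<Longrightarrow> angular_deriv (\<lambda>p. \<Sum>i\<in>I. f i p) (\<lambda>p. \<Sum>i\<in>I. g i p)"
  by (induction I rule: finite_induct) (auto intro: angular_deriv_const angular_deriv_add)

lemma north_cross_nth: "north_cross p $ 1 = - p $ 2" "north_cross p $ 2 = p $ 1" "north_cross p $ 3 = 0"
  by (simp_all add: cross_components axis_def)

lemma angular_deriv_coord: "angular_deriv (\<lambda>p. p $ i) (\<lambda>p. north_cross p $ i)"
  by (rule angular_derivI[OF smooth_coord has_grad_coord smooth_field_const]) (simp add: inner_axis')

lemma angular_deriv_x: "angular_deriv (\<lambda>p. p $ 1) (\<lambda>p. - p $ 2)" and angular_deriv_y: "angular_deriv (\<lambda>p. p $ 2) (\<lambda>p. p $ 1)"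
  and angular_deriv_z: "angular_deriv (\<lambda>p. p $ 3) (\<lambda>p. 0)"
  using angular_deriv_coord[of 1] angular_deriv_coord[of 2] angular_deriv_coord[of 3] by (simp_all add: north_cross_nth)

lemma angular_deriv_flat_z: "angular_deriv (\<lambda>p. flat k (c * p $ 3 + d)) (\<lambda>p. 0)"
proof (rule angular_derivI[OF smooth_flat has_grad_flat])
  show "smooth_field (\<lambda>p. (flat (k + 2) (c * p $ 3 + d) - real k * flat (Suc k) (c * p $ 3 + d)) *\<^sub>R
      (c *\<^sub>R axis 3 (1::real)))"
    by (intro smooth_field_scaleR smooth_field_const smooth_diff smooth_mult smooth_const smooth_flat)
qed (simp add: inner_axis' north_cross_nth)

lemma angular_deriv_power: "angular_deriv f f' \<Longrightarrow> angular_deriv (\<lambda>p. f p ^ n) (\<lambda>p. real n * f p ^ (n - 1) * f' p)"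
proof (induction n)
  case 0
  then show ?case using angular_deriv_const[of 1] by simp
next
  case (Suc n)
  have "f p * (real n * f p ^ (n - 1) * f' p) + f p ^ n * f' p = real (Suc n) * f p ^ (Suc n - 1) * f' p" for p
    by (cases n) (auto simp: algebra_simps)
  then show ?case using angular_deriv_mult[OF Suc.prems Suc.IH[OF Suc.prems]] by simp
qed

lemma angular_deriv_integral_zero: "angular_deriv f g \<Longrightarrow> (\<integral>\<^sub>S p. g p) = 0"
proof (erule angular_derivE)
  fix h assume h: "has_grad f h" "smooth_field h" "\<And>p. h p \<bullet> north_cross p = g p"
  show "(\<integral>\<^sub>S p. g p) = 0"
    using integral_rotation_smooth[OF h(1,2), of 3] by (simp add: h(3))
qed

lemma angular_deriv_smooth: "angular_deriv f g \<Longrightarrow> smooth f"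
  by (simp add: angular_deriv_def)

text \<open>
  An eigenfunction of the second derivative in longitude, for the eigenvalue \<open>- m\<close>, with its first
  derivative \<open>g\<close>.
\<close>

definition angular_mode :: "real \<Rightarrow> (real^3 \<Rightarrow> real) \<Rightarrow> (real^3 \<Rightarrow> real) \<Rightarrow> bool" where
  "angular_mode m f g \<longleftrightarrow> angular_deriv f g \<and> angular_deriv g (\<lambda>p. - m * f p)"

lemma angular_mode_zero: "angular_mode m (\<lambda>p. 0) (\<lambda>p. 0)"
  using angular_deriv_const by (simp add: angular_mode_def)

lemma angular_mode_add: assumes "angular_mode m f g" "angular_mode m f' g'" shows "angular_mode m (\<lambda>p. f p + f' p) (\<lambda>p. g p + g' p)"
proof -
  have "- m * (f p + f' p) = - m * f p + - m * f' p" for p by (rule distrib_left)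
  then show ?thesis
    unfolding angular_mode_def using assms angular_deriv_add[of f g f' g'] angular_deriv_add[of g "\<lambda>p. - m * f p" g' "\<lambda>p. - m * f' p"]
    by (simp add: angular_mode_def)
qed

lemma angular_mode_cmult: assumes "angular_mode m f g" shows "angular_mode m (\<lambda>p. c * f p) (\<lambda>p. c * g p)"
proof -
  have "angular_deriv f g" "angular_deriv g (\<lambda>p. - m * f p)" using assms by (simp_all only: angular_mode_def)
  note 1 = angular_deriv_cmult[OF this(1), of c] and 2 = angular_deriv_cmult[OF this(2), of c]
  have "(\<lambda>p. - m * (c * f p)) = (\<lambda>p. c * (- m * f p))" by (rule ext) (rule mult.left_commute)
  then show ?thesis unfolding angular_mode_def using 1 2 by (simp only: simp_thms)
qed

lemma angular_mode_derivative: "angular_mode m f g \<Longrightarrow> angular_mode m g (\<lambda>p. - m * f p)"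
  unfolding angular_mode_def using angular_deriv_cmult[of f g "- m"] by simp

text \<open>
  On a circle of latitude, functions that are odd in \<open>x\<close> and in \<open>y\<close> are combinations of
  \<open>sin (2 k \<phi>)\<close> with \<open>k \<ge> 1\<close>; here \<open>k\<close> is shifted to start at \<open>0\<close>.
\<close>

definition angular_eigenvalue :: "nat \<Rightarrow> real" where "angular_eigenvalue k = (2 * real (Suc k))\<^sup>2"

lemma angular_eigenvalue_ge: "angular_eigenvalue k \<ge> 4"
  using power_mono[of 2 "2 * real (Suc k)" 2] by (simp add: angular_eigenvalue_def)

lemma angular_eigenvalue_less: "k < l \<Longrightarrow> angular_eigenvalue k < angular_eigenvalue l"
  unfolding angular_eigenvalue_def by (intro power_strict_mono) auto

definition angular_mode_sum :: "nat \<Rightarrow> (real^3 \<Rightarrow> real) \<Rightarrow> bool" where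
  "angular_mode_sum n f \<longleftrightarrow> (\<exists>h g. (\<forall>k. angular_mode (angular_eigenvalue k) (h k) (g k)) \<and> (\<forall>k>n. h k = (\<lambda>p. 0)) \<and>
     (\<forall>p. f p = (\<Sum>k\<le>n. h k p)))"

lemma angular_mode_sum_cmult: assumes "angular_mode_sum n f" shows "angular_mode_sum n (\<lambda>p. c * f p)"
proof -
  obtain h g where h: "\<forall>k. angular_mode (angular_eigenvalue k) (h k) (g k)" "\<forall>k>n. h k = (\<lambda>p. 0)" "\<forall>p. f p = (\<Sum>k\<le>n. h k p)"
    using assms unfolding angular_mode_sum_def by blast
  show ?thesis
    unfolding angular_mode_sum_def
    by (rule exI[of _ "\<lambda>k p. c * h k p"], rule exI[of _ "\<lambda>k p. c * g k p"])
      (simp add: h angular_mode_cmult sum_distrib_left)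
qed

lemma angular_mode_sum_mono: assumes "angular_mode_sum n f" "n \<le> N" shows "angular_mode_sum N f"
proof -
  obtain h g where h: "\<forall>k. angular_mode (angular_eigenvalue k) (h k) (g k)" "\<forall>k>n. h k = (\<lambda>p. 0)" "\<forall>p. f p = (\<Sum>k\<le>n. h k p)"
    using assms unfolding angular_mode_sum_def by blast
  have "(\<Sum>k\<le>N. h k p) = (\<Sum>k\<le>n. h k p)" for p
    using assms(2) h(2) by (intro sum.mono_neutral_right) auto
  then show ?thesis
    unfolding angular_mode_sum_def
    by - (rule exI[of _ h], rule exI[of _ g], use h assms(2) in auto)
qed

lemma angular_mode_sum_add: assumes "angular_mode_sum n f" "angular_mode_sum m f'" shows "angular_mode_sum (max n m) (\<lambda>p. f p + f' p)"
proof -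
  obtain h g where h: "\<forall>k. angular_mode (angular_eigenvalue k) (h k) (g k)" "\<forall>k>max n m. h k = (\<lambda>p. 0)"
    "\<forall>p. f p = (\<Sum>k\<le>max n m. h k p)"
    using angular_mode_sum_mono[OF assms(1) max.cobounded1[of n m]] unfolding angular_mode_sum_def by blast
  obtain h' g' where h': "\<forall>k. angular_mode (angular_eigenvalue k) (h' k) (g' k)" "\<forall>k>max n m. h' k = (\<lambda>p. 0)"
    "\<forall>p. f' p = (\<Sum>k\<le>max n m. h' k p)"
    using angular_mode_sum_mono[OF assms(2) max.cobounded2[of m n]] unfolding angular_mode_sum_def by blast
  show ?thesis
    unfolding angular_mode_sum_def
  proof (rule exI[of _ "\<lambda>k p. h k p + h' k p"], rule exI[of _ "\<lambda>k p. g k p + g' k p"], intro conjI allI impI)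
    show "angular_mode (angular_eigenvalue k) (\<lambda>p. h k p + h' k p) (\<lambda>p. g k p + g' k p)" for k
      using h(1) h'(1) by (intro angular_mode_add) auto
    show "(\<lambda>p. h k p + h' k p) = (\<lambda>p. 0)" if "max n m < k" for k
      using h(2) h'(2) that by auto
    show "f p + f' p = (\<Sum>k\<le>max n m. h k p + h' k p)" for p
      using h(3) h'(3) by (simp add: sum.distrib)
  qed
qed

text \<open>
  The second derivative in longitude of \<open>x y\<^sup>m r\<close> for odd \<open>m = 2 j + 1\<close> and \<open>r\<close> independent of the
  longitude: it is \<open>- (m + 1)\<^sup>2\<close> times the function plus \<open>m (m - 1) x y\<^bsup>m - 2\<^esup> (x\<^sup>2 + y\<^sup>2) r\<close>, where
  \<open>x\<^sup>2 + y\<^sup>2\<close> is again independent of the longitude. For \<open>j = 0\<close> the second term has coefficient zero.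
\<close>

lemma angular_deriv_odd_monomial:
  assumes r: "angular_deriv r (\<lambda>p. 0)"
  shows "\<exists>g. angular_deriv (\<lambda>p. p $ 1 * p $ 2 ^ (2 * j + 1) * r p) g \<and>
    angular_deriv g (\<lambda>p. - angular_eigenvalue j * (p $ 1 * p $ 2 ^ (2 * j + 1) * r p)
      + real ((2 * j + 1) * (2 * j)) * (p $ 1 * p $ 2 ^ (2 * j - 1) * (r p * (p $ 1 * p $ 1 + p $ 2 * p $ 2))))"
proof -
  let ?x = "\<lambda>p::real^3. p $ 1" and ?y = "\<lambda>p::real^3. p $ 2"
  let ?m = "2 * j + 1"
  let ?g = "\<lambda>p. ?x p * ?y p ^ ?m * 0 + r p * (?x p * (real ?m * ?y p ^ (?m - 1) * ?x p) + ?y p ^ ?m * - ?y p)"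
  have 1: "angular_deriv (\<lambda>p. ?x p * ?y p ^ ?m * r p) ?g"
    by (rule angular_deriv_mult[OF angular_deriv_mult[OF angular_deriv_x angular_deriv_power[OF angular_deriv_y]] r])
  let ?g' = "\<lambda>p. r p * (real ?m * (?x p ^ 2 * ?y p ^ (2 * j)) + (-1) * ?y p ^ (2 * j + 2))"
  have g: "?g = ?g'"
    by (rule ext) (simp add: algebra_simps power2_eq_square)
  have 2: "angular_deriv ?g' (\<lambda>p. r p * (real ?m * (?x p ^ 2 * (real (2 * j) * ?y p ^ (2 * j - 1) * ?x p)
        + ?y p ^ (2 * j) * (real 2 * ?x p ^ (2 - 1) * - ?y p))
      + (-1) * (real (2 * j + 2) * ?y p ^ (2 * j + 2 - 1) * ?x p))
      + (real ?m * (?x p ^ 2 * ?y p ^ (2 * j)) + (-1) * ?y p ^ (2 * j + 2)) * 0)"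
    by (rule angular_deriv_mult[OF r angular_deriv_add[OF angular_deriv_cmult[OF angular_deriv_mult[OF angular_deriv_power[OF angular_deriv_x] angular_deriv_power[OF angular_deriv_y]]]
            angular_deriv_cmult[OF angular_deriv_power[OF angular_deriv_y]]]])
  have "r p * (real ?m * (?x p ^ 2 * (real (2 * j) * ?y p ^ (2 * j - 1) * ?x p)
        + ?y p ^ (2 * j) * (real 2 * ?x p ^ (2 - 1) * - ?y p))
      + (-1) * (real (2 * j + 2) * ?y p ^ (2 * j + 2 - 1) * ?x p))
      + (real ?m * (?x p ^ 2 * ?y p ^ (2 * j)) + (-1) * ?y p ^ (2 * j + 2)) * 0 =
      - angular_eigenvalue j * (?x p * ?y p ^ ?m * r p)
      + real (?m * (2 * j)) * (?x p * ?y p ^ (2 * j - 1) * (r p * (?x p * ?x p + ?y p * ?y p)))" for p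
  proof -
    define x y R where "x = ?x p" and "y = ?y p" and "R = r p"
    define Y where "Y = y ^ (2 * j)"
    define Y' where "Y' = real (2 * j) * y ^ (2 * j - 1)"
    have e: "y * Y' = real (2 * j) * Y" using power_pred(1)[of "2 * j" y] by (simp add: Y_def Y'_def mult_ac)
    have e2: "y * (y * Y') = real (2 * j) * (y * Y)" using e by (simp add: mult_ac)
    have "R * (real ?m * (x ^ 2 * (Y' * x) + Y * (2 * x * - y)) - real (2 * j + 2) * (y * Y) * x)
      = R * (real ?m * x ^ 3 * Y' - (2 * real ?m + real (2 * j + 2)) * (x * (y * Y)))"
      by (simp add: algebra_simps power2_eq_square power3_eq_cube)
    also have "\<dots> = - angular_eigenvalue j * (x * (y * Y) * R) + real ?m * (x * (R * (x * x * Y' + y * (y * Y'))))"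
      unfolding e2 by (simp add: angular_eigenvalue_def algebra_simps power2_eq_square power3_eq_cube)
    finally show ?thesis
      by (simp add: x_def[symmetric] y_def[symmetric] R_def[symmetric])
        (simp add: Y_def Y'_def algebra_simps power2_eq_square)
  qed
  then have "angular_deriv ?g' (\<lambda>p. - angular_eigenvalue j * (?x p * ?y p ^ ?m * r p)
      + real (?m * (2 * j)) * (?x p * ?y p ^ (2 * j - 1) * (r p * (?x p * ?x p + ?y p * ?y p))))"
    using 2 by (simp only:)
  with 1 g show ?thesis by (intro exI[of _ ?g']) (simp only:)
qed

text \<open>
  The second derivative is triangular in \<open>j\<close>, and its diagonal entries are distinct; the argument is
  that of \<open>spectral_sum_monomial\<close>.
\<close>

lemma angular_mode_sum_odd_monomial:
  assumes "angular_deriv r (\<lambda>p. 0)"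
  shows "angular_mode_sum j (\<lambda>p. p $ 1 * p $ 2 ^ (2 * j + 1) * r p)"
  using assms
proof (induction j arbitrary: r)
  case 0
  let ?f = "\<lambda>p. p $ 1 * p $ 2 ^ (2 * 0 + 1) * r p"
  obtain g where "angular_deriv ?f g" "angular_deriv g (\<lambda>p. - angular_eigenvalue 0 * ?f p)"
    using angular_deriv_odd_monomial[OF 0, of 0] by auto
  then have m: "angular_mode (angular_eigenvalue 0) ?f g" by (simp add: angular_mode_def)
  show ?case
    unfolding angular_mode_sum_def
  proof (rule exI[of _ "\<lambda>k. if k = 0 then ?f else (\<lambda>p. 0)"],
      rule exI[of _ "\<lambda>k. if k = 0 then g else (\<lambda>p. 0)"], intro conjI allI impI)
    show "angular_mode (angular_eigenvalue k) (if k = 0 then ?f else (\<lambda>p. 0)) (if k = 0 then g else (\<lambda>p. 0))" for k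
      using m angular_mode_zero by (cases "k = 0") (simp_all only: if_True if_False refl)
  qed auto
next
  case (Suc j)
  let ?f = "\<lambda>p. p $ 1 * p $ 2 ^ (2 * Suc j + 1) * r p"
  let ?r = "\<lambda>p. r p * (p $ 1 * p $ 1 + p $ 2 * p $ 2)"
  let ?A = "real ((2 * Suc j + 1) * (2 * Suc j))"
  have rr: "angular_deriv ?r (\<lambda>p. 0)"
    using angular_deriv_mult[OF Suc.prems angular_deriv_add[OF angular_deriv_mult[OF angular_deriv_x angular_deriv_x] angular_deriv_mult[OF angular_deriv_y angular_deriv_y]]]
    by (simp add: algebra_simps)
  obtain h g where h: "\<And>k. angular_mode (angular_eigenvalue k) (h k) (g k)" "\<And>k. k > j \<Longrightarrow> h k = (\<lambda>p. 0)"
    "\<And>p. p $ 1 * p $ 2 ^ (2 * j + 1) * ?r p = (\<Sum>k\<le>j. h k p)"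
    using Suc.IH[OF rr] unfolding angular_mode_sum_def by blast
  obtain G where G: "angular_deriv ?f G" "angular_deriv G (\<lambda>p. - angular_eigenvalue (Suc j) * ?f p + ?A * (\<Sum>k\<le>j. h k p))"
  proof -
    have e: "2 * Suc j - 1 = 2 * j + 1" by simp
    show thesis
      using angular_deriv_odd_monomial[OF Suc.prems, of "Suc j"] that unfolding e h(3) by blast
  qed
  let ?c = "\<lambda>k. ?A / (angular_eigenvalue (Suc j) - angular_eigenvalue k)"
  \<comment> \<open>the new mode, for the largest eigenvalue\<close>
  define top where "top p = ?f p + (-1) * (\<Sum>k\<le>j. ?c k * h k p)" for p
  define topg where "topg p = G p + (-1) * (\<Sum>k\<le>j. ?c k * g k p)" for p
  have rh: "angular_deriv (h k) (g k)" "angular_deriv (g k) (\<lambda>p. - angular_eigenvalue k * h k p)" for k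
    using h(1)[of k] by (simp_all add: angular_mode_def)
  have t1: "angular_deriv top topg"
    unfolding top_def topg_def by (intro angular_deriv_add G angular_deriv_cmult angular_deriv_sum finite_atMost rh)
  have t2: "angular_deriv topg (\<lambda>p. (- angular_eigenvalue (Suc j) * ?f p + ?A * (\<Sum>k\<le>j. h k p)) + (-1) * (\<Sum>k\<le>j. ?c k * (- angular_eigenvalue k * h k p)))"
    unfolding topg_def by (intro angular_deriv_add G angular_deriv_cmult angular_deriv_sum finite_atMost rh)
  have "(- angular_eigenvalue (Suc j) * ?f p + ?A * (\<Sum>k\<le>j. h k p)) + (-1) * (\<Sum>k\<le>j. ?c k * (- angular_eigenvalue k * h k p))
      = - angular_eigenvalue (Suc j) * top p" for p
  proof -
    have "?A * (\<Sum>k\<le>j. h k p) = (\<Sum>k\<le>j. ?c k * (- angular_eigenvalue k * h k p) + angular_eigenvalue (Suc j) * (?c k * h k p))"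
      unfolding sum_distrib_left
    proof (rule sum.cong[OF refl])
      fix k assume "k \<in> {..j}"
      then have "angular_eigenvalue (Suc j) - angular_eigenvalue k \<noteq> 0" using angular_eigenvalue_less[of k "Suc j"] by simp
      moreover have "a * x = a / (u - v) * (- v * x) + u * (a / (u - v) * x)" if "u - v \<noteq> 0" for a u v x :: real
      proof -
        define q where "q = a / (u - v)"
        then have "a = q * (u - v)" using that by simp
        then have "a * x = (q * (u - v)) * x" by (rule arg_cong)
        also have "\<dots> = q * (- v * x) + u * (q * x)" by (simp add: algebra_simps)
        finally show ?thesis unfolding q_def .
      qed
      ultimately show "?A * h k p = ?c k * (- angular_eigenvalue k * h k p) + angular_eigenvalue (Suc j) * (?c k * h k p)" by blast
    qed
    then show ?thesis
      unfolding top_def sum.distrib sum_distrib_left[symmetric] by (simp only: algebra_simps)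
  qed
  then have mtop: "angular_mode (angular_eigenvalue (Suc j)) top topg" using t1 t2 by (simp only: angular_mode_def)
  show ?case
    unfolding angular_mode_sum_def
  proof (rule exI[of _ "\<lambda>k. if k \<le> j then (\<lambda>p. ?c k * h k p) else if k = Suc j then top else (\<lambda>p. 0)"],
      rule exI[of _ "\<lambda>k. if k \<le> j then (\<lambda>p. ?c k * g k p) else if k = Suc j then topg else (\<lambda>p. 0)"], intro conjI allI impI)
    show "angular_mode (angular_eigenvalue k) (if k \<le> j then (\<lambda>p. ?c k * h k p) else if k = Suc j then top else (\<lambda>p. 0))
      (if k \<le> j then (\<lambda>p. ?c k * g k p) else if k = Suc j then topg else (\<lambda>p. 0))" for k
    proof -
      consider "k \<le> j" | "\<not> k \<le> j" "k = Suc j" | "\<not> k \<le> j" "k \<noteq> Suc j" by linarith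
      then show ?thesis
      proof cases
        case 1
        then show ?thesis by (simp only: if_True) (rule angular_mode_cmult[OF h(1)])
      next
        case 2
        then show ?thesis using mtop by (simp only: if_True if_False simp_thms)
      next
        case 3
        then show ?thesis using angular_mode_zero by (simp only: if_False simp_thms)
      qed
    qed
    show "?f p = (\<Sum>k\<le>Suc j. (if k \<le> j then (\<lambda>p. ?c k * h k p) else if k = Suc j then top else (\<lambda>p. 0)) p)" for p
    proof -
      have "(\<Sum>k\<le>j. (if k \<le> j then (\<lambda>p. ?c k * h k p) else if k = Suc j then top else (\<lambda>p. 0)) p) =
          (\<Sum>k\<le>j. ?c k * h k p)" by (rule sum.cong) auto
      then show ?thesis unfolding sum.atMost_Suc by (simp add: top_def)
    qed
  qed auto
qed

lemma odd_poly_angular_mode_sum: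
  assumes "even_poly d" shows "\<exists>n. angular_mode_sum n (\<lambda>p. p $ 1 * p $ 2 * d p)"
  using assms
proof induction
  case (even_poly_monomial j k)
  have "angular_deriv (\<lambda>p. p $ 3 ^ k) (\<lambda>p. 0)" using angular_deriv_power[OF angular_deriv_z, of k] by simp
  from angular_mode_sum_odd_monomial[OF this, of j] show ?case by (simp add: mult.assoc) blast
next
  case (even_poly_add f g)
  then obtain n m where "angular_mode_sum n (\<lambda>p. p $ 1 * p $ 2 * f p)" "angular_mode_sum m (\<lambda>p. p $ 1 * p $ 2 * g p)" by blast
  from angular_mode_sum_add[OF this] show ?case unfolding distrib_left by blast
next
  case (even_poly_cmult f c)
  then obtain n where "angular_mode_sum n (\<lambda>p. p $ 1 * p $ 2 * f p)" by blast
  from angular_mode_sum_cmult[OF this, of c] show ?case by (simp add: mult_ac) blast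
qed

text \<open>
  The weight \<open>t\<close> does not depend on the longitude, so the second derivative is symmetric for the
  measure weighted by its square.
\<close>

lemma angular_mode_orthogonal:
  assumes f: "angular_mode m f f'" and g: "angular_mode l g g'" and "m \<noteq> l" and t: "angular_deriv t (\<lambda>p. 0)"
  shows "(\<integral>\<^sub>S p. (t p * f p) * (t p * g p)) = 0"
proof -
  have r: "angular_deriv f f'" "angular_deriv f' (\<lambda>p. - m * f p)" "angular_deriv g g'" "angular_deriv g' (\<lambda>p. - l * g p)"
    using f g by (simp_all only: angular_mode_def)
  have "angular_deriv (\<lambda>p. (t p * t p) * (f' p * g p + (-1) * (f p * g' p)))
    (\<lambda>p. (t p * t p) * ((f' p * g' p + g p * (- m * f p)) + (-1) * (f p * (- l * g p) + g' p * f' p))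
      + (f' p * g p + (-1) * (f p * g' p)) * (t p * 0 + t p * 0))"
    by (intro angular_deriv_mult angular_deriv_add angular_deriv_cmult r t)
  from angular_deriv_integral_zero[OF this]
  have "(\<integral>\<^sub>S p. (l - m) * ((t p * f p) * (t p * g p))) = 0"
    by (rule trans[rotated]) (rule Bochner_Integration.integral_cong, auto simp: algebra_simps)
  then show ?thesis using \<open>m \<noteq> l\<close> by simp
qed

lemma sphere_div_north_cross:
  assumes "has_grad f h" shows "sphere_div (\<lambda>p. f p *\<^sub>R north_cross p) p = h p \<bullet> north_cross p"
proof -
  have d: "(north_cross has_derivative north_cross) (at p)"
    by (rule bounded_linear_imp_has_derivative[OF bounded_linear_cross])
  then have "frechet_derivative north_cross (at p) = north_cross"
    by (rule frechet_derivative_at[symmetric])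
  then have "sphere_div north_cross p = 0" by (simp add: sphere_div_def dot_cross_self)
  then show ?thesis
    using sphere_div_scaleR[OF assms differentiableI[OF d]] by (simp add: dot_cross_self)
qed

lemma norm_north_cross: "p \<in> sphere 0 1 \<Longrightarrow> norm (north_cross p) \<le> 1"
proof -
  assume "p \<in> sphere 0 1"
  then have "(norm (north_cross p))\<^sup>2 + (axis 3 1 \<bullet> p)\<^sup>2 = 1"
    using norm_cross_dot[of "axis 3 1" p] by simp
  then have "(norm (north_cross p))\<^sup>2 \<le> 1" using zero_le_power2[of "axis 3 1 \<bullet> p"] by linarith
  then show ?thesis by (simp add: power_le_one_iff abs_square_le_1)
qed

text \<open>
  A field along the circles of latitude that vanishes for \<open>z \<ge> c - 1 / n\<close>. Where the crack lies above
  the height \<open>c\<close> the field crosses the planes \<open>x = 0\<close> and \<open>y = 0\<close> freely.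
\<close>

lemma angular_deriv_test_field:
  assumes g: "angular_deriv g g'" and n: "n > 0"
    and \<Omega>: "\<And>p. p \<in> sphere 0 1 \<Longrightarrow> p $ 3 < c \<Longrightarrow> p \<in> \<Omega>"
  shows "test_field \<Omega> (\<lambda>p. (flat 0 ((- n) * p $ 3 + (n * c - 1)) * g p) *\<^sub>R north_cross p)"
  unfolding test_field_def
proof (intro conjI allI ballI)
  have "smooth g" using g by (rule angular_deriv_smooth)
  then show "Ck k (\<lambda>p. (flat 0 ((- n) * p $ 3 + (n * c - 1)) * g p) *\<^sub>R north_cross p)" for k
    by (intro smooth_field_Ck smooth_field_scaleR smooth_mult smooth_flat smooth_field_cross)
  show "((flat 0 ((- n) * p $ 3 + (n * c - 1)) * g p) *\<^sub>R north_cross p) \<bullet> p = 0" for p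
    by (simp add: dot_cross_self)
  show "\<exists>K. compact K \<and> K \<subseteq> \<Omega> \<and>
    (\<forall>p\<in>sphere 0 1 - K. (flat 0 ((- n) * p $ 3 + (n * c - 1)) * g p) *\<^sub>R north_cross p = 0)"
  proof (intro exI[of _ "sphere 0 1 \<inter> {p::real^3. p $ 3 \<le> c - 1 / n}"] conjI ballI)
    have "closed {p::real^3. p $ 3 \<le> c - 1 / n}" by (intro closed_Collect_le continuous_intros)
    then show "compact (sphere 0 1 \<inter> {p::real^3. p $ 3 \<le> c - 1 / n})" by (intro compact_Int_closed) auto
    have "c - 1 / n < c" using n by simp
    show "sphere 0 1 \<inter> {p::real^3. p $ 3 \<le> c - 1 / n} \<subseteq> \<Omega>"
    proof
      fix p :: "real^3" assume "p \<in> sphere 0 1 \<inter> {p. p $ 3 \<le> c - 1 / n}"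
      then have "p \<in> sphere 0 1" "p $ 3 \<le> c - 1 / n" by auto
      with \<open>c - 1 / n < c\<close> show "p \<in> \<Omega>" by (intro \<Omega>) (simp_all only: le_less_trans)
    qed
    fix p :: "real^3" assume "p \<in> sphere 0 1 - (sphere 0 1 \<inter> {p::real^3. p $ 3 \<le> c - 1 / n})"
    then have "c - 1 / n < p $ 3" by auto
    then have "n * (c - 1 / n) \<le> n * p $ 3" using n by (intro mult_left_mono) auto
    then have "(- n) * p $ 3 + (n * c - 1) \<le> 0" using n by (simp add: right_diff_distrib)
    then show "(flat 0 ((- n) * p $ 3 + (n * c - 1)) * g p) *\<^sub>R north_cross p = 0"
      by (simp add: flat_nonpos)
  qed
qed

text \<open>
  Wirtinger's inequality on the circles of latitude, in dual form as in \<open>spectral_inequality\<close>. Let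
  \<open>g\<close> be the derivative in longitude of the solution of \<open>- u'' = F\<close>. Then \<open>\<integral> w t F\<close> is the integral of
  \<open>G\<close> against the field \<open>t g\<close> along the latitudes, and \<open>4 \<integral> (t g)\<^sup>2 \<le> \<integral> (t F)\<^sup>2\<close> because all angular
  eigenvalues in \<open>F\<close> are at least \<open>4\<close>. The factor \<open>t\<close> keeps the field away from the crack.
\<close>

lemma latitude_inequality_cutoff:
  assumes wp: "weak_pair \<Omega> w G" and \<Omega>: "\<And>p. p \<in> sphere 0 1 \<Longrightarrow> p $ 3 < c \<Longrightarrow> p \<in> \<Omega>"
    and n: "n > 0" and F: "angular_mode_sum N F"
  defines "t \<equiv> \<lambda>p::real^3. flat 0 ((- n) * p $ 3 + (n * c - 1))"
  shows "4 * (\<integral>\<^sub>S p. w p * (t p * F p))\<^sup>2 \<le>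
    (\<integral>\<^sub>S p. (norm (G p))\<^sup>2) * (\<integral>\<^sub>S p. (t p * F p)\<^sup>2)"
proof -
  obtain h h' where h: "\<And>k. angular_mode (angular_eigenvalue k) (h k) (h' k)" "\<And>p. F p = (\<Sum>k\<le>N. h k p)"
    using F unfolding angular_mode_sum_def by blast
  have r: "angular_deriv (h k) (h' k)" "angular_deriv (h' k) (\<lambda>p. - angular_eigenvalue k * h k p)" for k
    using h(1)[of k] by (simp_all only: angular_mode_def)
  have rt: "angular_deriv t (\<lambda>p. 0)" unfolding t_def by (rule angular_deriv_flat_z)
  define g where "g p = (\<Sum>k\<le>N. (1 / angular_eigenvalue k) * h' k p)" for p
  have fk: "angular_eigenvalue k > 0" for k using angular_eigenvalue_ge[of k] by linarith
  have rg: "angular_deriv g (\<lambda>p. - F p)"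
  proof -
    have "angular_deriv g (\<lambda>p. \<Sum>k\<le>N. (1 / angular_eigenvalue k) * (- angular_eigenvalue k * h k p))"
      unfolding g_def by (intro angular_deriv_sum finite_atMost angular_deriv_cmult r)
    moreover have "(\<Sum>k\<le>N. (1 / angular_eigenvalue k) * (- angular_eigenvalue k * h k p)) = - F p" for p
    proof -
      have "angular_eigenvalue k \<noteq> 0" for k using fk[of k] by linarith
      then show ?thesis by (simp add: h(2) sum_negf)
    qed
    ultimately show ?thesis by (simp only:)
  qed
  have rF: "angular_deriv F (\<lambda>p. \<Sum>k\<le>N. h' k p)"
  proof -
    have "F = (\<lambda>p. \<Sum>k\<le>N. h k p)" using h(2) by blast
    then show ?thesis using angular_deriv_sum[of "{..N}" h h'] r(1) by simp
  qed
  have sm: "smooth t" "smooth g" "smooth F" "smooth (h' k)" for k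
    using angular_deriv_smooth rt rg rF r(2) by blast+
  let ?X = "\<lambda>p. (t p * g p) *\<^sub>R north_cross p"
  have X: "smooth_field ?X" by (intro smooth_field_scaleR smooth_mult sm smooth_field_cross)
  have test: "test_field \<Omega> ?X" unfolding t_def by (rule angular_deriv_test_field[OF rg n \<Omega>])
  obtain k where k: "has_grad (\<lambda>p. t p * g p) k" "\<And>p. k p \<bullet> north_cross p = t p * - F p + g p * 0"
    using angular_derivE[OF angular_deriv_mult[OF rt rg]] by metis
  have div: "sphere_div ?X p = - (t p * F p)" for p
    using sphere_div_north_cross[OF k(1), of p] k(2)[of p] by simp
  have w: "square_integrable w" and G: "square_integrable G" using wp by (auto simp: weak_pair_def)
  have "(\<integral>\<^sub>S p. w p * (t p * F p)) = (\<integral>\<^sub>S p. G p \<bullet> ?X p)"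
  proof -
    have "(\<integral>\<^sub>S p. w p * sphere_div ?X p) = - (\<integral>\<^sub>S p. G p \<bullet> ?X p)"
      using wp test unfolding weak_pair_def by blast
    then show ?thesis unfolding div by simp
  qed
  then have 1: "(\<integral>\<^sub>S p. w p * (t p * F p))\<^sup>2 \<le>
      (\<integral>\<^sub>S p. (norm (G p))\<^sup>2) * (\<integral>\<^sub>S p. (norm (?X p))\<^sup>2)"
    using Cauchy_Schwarz_sphere[OF G square_integrable_smooth_field[OF X]] by simp
  have 2: "(\<integral>\<^sub>S p. (norm (?X p))\<^sup>2) \<le> (\<integral>\<^sub>S p. (t p * g p)\<^sup>2)"
  proof (rule integral_mono_AE)
    show "integrable sphere_measure (\<lambda>p. (norm (?X p))\<^sup>2)" by (rule square_integrable_integrable[OF square_integrable_smooth_field[OF X]])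
    show "integrable sphere_measure (\<lambda>p. (t p * g p)\<^sup>2)"
      using square_integrable_integrable[OF square_integrable_smooth[OF smooth_mult[OF sm(1,2)]]] by simp
    show "AE p in sphere_measure. (norm (?X p))\<^sup>2 \<le> (t p * g p)\<^sup>2"
      using AE_sphere
    proof eventually_elim
      case (elim p)
      have "(norm (?X p))\<^sup>2 = (t p * g p)\<^sup>2 * (norm (north_cross p))\<^sup>2"
        by (simp add: power_mult_distrib)
      also have "\<dots> \<le> (t p * g p)\<^sup>2 * 1"
        using norm_north_cross[OF elim] by (intro mult_left_mono power_le_one) auto
      finally show ?case by simp
    qed
  qed
  have sth: "square_integrable (\<lambda>p. t p * h' k p)" for k by (intro square_integrable_smooth smooth_mult sm)
  have orth: "(\<integral>\<^sub>S p. (t p * h' i p) * (t p * h' j p)) = 0" if "i \<noteq> j" for i j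
  proof (rule angular_mode_orthogonal[OF angular_mode_derivative[OF h(1)] angular_mode_derivative[OF h(1)] _ rt])
    show "angular_eigenvalue i \<noteq> angular_eigenvalue j" using angular_eigenvalue_less[of i j] angular_eigenvalue_less[of j i] that by (cases "i < j") auto
  qed
  note comb = integral_orthogonal_combination[OF finite_atMost sth orth]
  have tg: "t p * g p = (\<Sum>k\<le>N. (1 / angular_eigenvalue k) * (t p * h' k p))" for p
    by (simp add: g_def sum_distrib_left mult.left_commute)
  \<comment> \<open>both square integrals in terms of the derivatives of the modes\<close>
  have 3: "(\<integral>\<^sub>S p. (t p * g p)\<^sup>2) =
      (\<Sum>k\<le>N. (1 / angular_eigenvalue k) * (1 / angular_eigenvalue k) * (\<integral>\<^sub>S p. (t p * h' k p)\<^sup>2))"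
    unfolding tg power2_eq_square[of "sum _ _"] by (rule comb)
  have 4: "(\<integral>\<^sub>S p. (t p * F p)\<^sup>2) =
      (\<Sum>k\<le>N. (1 / angular_eigenvalue k) * 1 * (\<integral>\<^sub>S p. (t p * h' k p)\<^sup>2))"
  proof -
    have "angular_deriv (\<lambda>p. (t p * t p) * (g p * F p))
      (\<lambda>p. (t p * t p) * (g p * (\<Sum>k\<le>N. h' k p) + F p * - F p) + (g p * F p) * (t p * 0 + t p * 0))"
      by (intro angular_deriv_mult rt rg rF)
    from angular_deriv_integral_zero[OF this]
    have "(\<integral>\<^sub>S p. (t p * g p) * (\<Sum>k\<le>N. 1 * (t p * h' k p)) - (t p * F p)\<^sup>2) = 0"
      by (rule trans[rotated]) (rule Bochner_Integration.integral_cong,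
          auto simp: algebra_simps sum_distrib_left power2_eq_square)
    moreover have "square_integrable (\<lambda>p. \<Sum>k\<le>N. 1 * (t p * h' k p))"
      by (intro square_integrable_sum square_integrable_cmult sth)
    ultimately have "(\<integral>\<^sub>S p. (t p * F p)\<^sup>2) =
        (\<integral>\<^sub>S p. (t p * g p) * (\<Sum>k\<le>N. 1 * (t p * h' k p)))"
      using square_integrable_mult[OF square_integrable_smooth[OF smooth_mult[OF sm(1,2)]], of "\<lambda>p. \<Sum>k\<le>N. 1 * (t p * h' k p)"]
        square_integrable_integrable[OF square_integrable_smooth[OF smooth_mult[OF sm(1,3)]]] by simp
    also have "\<dots> = (\<Sum>k\<le>N. (1 / angular_eigenvalue k) * 1 * (\<integral>\<^sub>S p. (t p * h' k p)\<^sup>2))"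
      unfolding tg by (rule comb)
    finally show ?thesis .
  qed
  have 5: "4 * (\<integral>\<^sub>S p. (t p * g p)\<^sup>2) \<le> (\<integral>\<^sub>S p. (t p * F p)\<^sup>2)"
    unfolding 3 4 sum_distrib_left
  proof (rule sum_mono)
    fix k
    have "4 * (1 / angular_eigenvalue k * (1 / angular_eigenvalue k)) \<le> 1 / angular_eigenvalue k * 1"
      using angular_eigenvalue_ge[of k] fk[of k] by (simp add: field_simps)
    then show "4 * (1 / angular_eigenvalue k * (1 / angular_eigenvalue k) * (\<integral>\<^sub>S p. (t p * h' k p)\<^sup>2))
      \<le> 1 / angular_eigenvalue k * 1 * (\<integral>\<^sub>S p. (t p * h' k p)\<^sup>2)"
      unfolding mult.assoc[symmetric, of 4] by (intro mult_right_mono) auto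
  qed
  let ?E = "\<integral>\<^sub>S p. (norm (G p))\<^sup>2"
  have "4 * (\<integral>\<^sub>S p. w p * (t p * F p))\<^sup>2 \<le> 4 * (?E * (\<integral>\<^sub>S p. (t p * g p)\<^sup>2))"
    using order_trans[OF 1 mult_left_mono[OF 2]] by simp
  also have "\<dots> = ?E * (4 * (\<integral>\<^sub>S p. (t p * g p)\<^sup>2))" by (rule mult.left_commute)
  also have "\<dots> \<le> ?E * (\<integral>\<^sub>S p. (t p * F p)\<^sup>2)"
    by (rule mult_left_mono[OF 5]) simp
  finally show ?thesis .
qed

lemma flat_cutoff_tendsto:
  "(\<lambda>n. flat 0 ((- real (Suc n)) * z + (real (Suc n) * c - 1))) \<longlonglongrightarrow> indicator {..<c} z"
proof (cases "z < c")
  case True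
  have "(\<lambda>n. flat 0 (real (Suc n) * (c - z) + (-1))) \<longlonglongrightarrow> 1"
    using LIMSEQ_Suc[OF filterlim_compose[OF flat_0_tendsto filterlim_scaled[of "c - z"]]] True by simp
  moreover have "real (Suc n) * (c - z) + (-1) = (- real (Suc n)) * z + (real (Suc n) * c - 1)" for n
    by (simp add: algebra_simps)
  ultimately have "(\<lambda>n. flat 0 ((- real (Suc n)) * z + (real (Suc n) * c - 1))) \<longlonglongrightarrow> 1" by (simp only:)
  moreover have "indicator {..<c} z = (1::real)" using True by simp
  ultimately show ?thesis by (simp only:)
next
  case False
  have "flat 0 ((- real (Suc n)) * z + (real (Suc n) * c - 1)) = 0" for n
  proof -
    have "real (Suc n) * c \<le> real (Suc n) * z" using False by (intro mult_left_mono) auto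
    then show ?thesis by (intro flat_nonpos) linarith
  qed
  then show ?thesis using False by simp
qed

text \<open>
  Two limits in the dual inequality: the cutoff tends to the indicator of the region below the height
  \<open>c\<close>, and the odd polynomials tend to \<open>w\<close>.
\<close>

theorem latitude_inequality:
  assumes wp: "weak_pair \<Omega> w G" and \<Omega>: "\<And>p. p \<in> sphere 0 1 \<Longrightarrow> p $ 3 < c \<Longrightarrow> p \<in> \<Omega>"
    and odd: "\<And>p. w (flip 1 p) = - w p" "\<And>p. w (flip 2 p) = - w p"
  shows "4 * (\<integral>\<^sub>S p. indicator {p. p $ 3 < c} p * (w p)\<^sup>2) \<le> (\<integral>\<^sub>S p. (norm (G p))\<^sup>2)"
proof -
  have w: "square_integrable w" and G: "square_integrable G" using wp by (auto simp: weak_pair_def)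
  let ?E = "\<integral>\<^sub>S p. (norm (G p))\<^sup>2"
  let ?C = "{p::real^3. p $ 3 < c}"
  let ?i = "\<lambda>p. indicator ?C p :: real"
  have [measurable]: "?C \<in> sets borel"
    by (intro borel_open open_Collect_less continuous_intros)
  have ineq: "4 * (\<integral>\<^sub>S p. (?i p * w p) * F p)\<^sup>2 \<le> ?E * (\<integral>\<^sub>S p. (?i p * F p)\<^sup>2)"
    if F: "angular_mode_sum N F" "smooth F" for N F
  proof -
    let ?t = "\<lambda>n p. flat 0 ((- real (Suc n)) * p $ 3 + (real (Suc n) * c - 1))"
    have lim: "(\<lambda>n. ?t n p) \<longlonglongrightarrow> ?i p" for p :: "real^3"
      using flat_cutoff_tendsto[of "p $ 3" c] by (simp add: indicator_def)
    have sF: "square_integrable F" using F by (intro square_integrable_smooth)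
    note [measurable] = square_integrable_measurable[OF w] square_integrable_measurable[OF sF]
      borel_measurable_continuous_onI[OF smooth_continuous[OF smooth_flat]]
    have b: "0 \<le> ?t n p" "?t n p \<le> 1" for n p by (rule flat_0_bounds)+
    have L1: "(\<lambda>n. \<integral>\<^sub>S p. w p * (?t n p * F p)) \<longlonglongrightarrow> (\<integral>\<^sub>S p. w p * (?i p * F p))"
    proof (rule integral_dominated_convergence[where w = "\<lambda>p. \<bar>w p * F p\<bar>"])
      show "integrable sphere_measure (\<lambda>p. \<bar>w p * F p\<bar>)" using square_integrable_mult[OF w sF] by simp
      show "AE p in sphere_measure. (\<lambda>n. w p * (?t n p * F p)) \<longlonglongrightarrow> w p * (?i p * F p)"
        by (intro AE_I2 tendsto_intros lim)
      show "AE p in sphere_measure. norm (w p * (?t n p * F p)) \<le> \<bar>w p * F p\<bar>" for n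
      proof (intro AE_I2)
        fix p
        have "norm (w p * (?t n p * F p)) = ?t n p * \<bar>w p * F p\<bar>" using b[of n p] by (simp add: abs_mult)
        also have "\<dots> \<le> 1 * \<bar>w p * F p\<bar>" using b by (intro mult_right_mono) auto
        finally show "norm (w p * (?t n p * F p)) \<le> \<bar>w p * F p\<bar>" by simp
      qed
    qed measurable
    have L2: "(\<lambda>n. \<integral>\<^sub>S p. (?t n p * F p)\<^sup>2) \<longlonglongrightarrow> (\<integral>\<^sub>S p. (?i p * F p)\<^sup>2)"
    proof (rule integral_dominated_convergence[where w = "\<lambda>p. (F p)\<^sup>2"])
      show "integrable sphere_measure (\<lambda>p. (F p)\<^sup>2)" using square_integrable_integrable[OF sF] by simp
      show "AE p in sphere_measure. (\<lambda>n. (?t n p * F p)\<^sup>2) \<longlonglongrightarrow> (?i p * F p)\<^sup>2"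
        by (intro AE_I2 tendsto_intros lim)
      show "AE p in sphere_measure. norm ((?t n p * F p)\<^sup>2) \<le> (F p)\<^sup>2" for n
      proof (intro AE_I2)
        fix p
        have "norm ((?t n p * F p)\<^sup>2) = (?t n p)\<^sup>2 * (F p)\<^sup>2" by (simp add: power_mult_distrib)
        also have "\<dots> \<le> 1 * (F p)\<^sup>2" using b by (intro mult_right_mono power_le_one) auto
        finally show "norm ((?t n p * F p)\<^sup>2) \<le> (F p)\<^sup>2" by simp
      qed
    qed measurable
    have "4 * (\<integral>\<^sub>S p. w p * (?i p * F p))\<^sup>2 \<le> ?E * (\<integral>\<^sub>S p. (?i p * F p)\<^sup>2)"
      by (rule LIMSEQ_le[OF tendsto_mult[OF tendsto_const tendsto_power[OF L1]] tendsto_mult[OF tendsto_const L2]],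
          intro exI allI impI, rule latitude_inequality_cutoff[OF wp \<Omega> _ F(1)]) auto
    then show ?thesis by (simp only: mult_ac)
  qed
  obtain d where d: "\<And>n. even_poly (d n)"
    "(\<lambda>n. \<integral>\<^sub>S p. (w p - (if (-1::real) = 1 then d n p else p $ 1 * p $ 2 * d n p))\<^sup>2) \<longlonglongrightarrow> 0"
    by (rule parity_approx[OF w, of "-1"]) (use odd in auto)
  let ?F = "\<lambda>n p. p $ 1 * p $ 2 * d n p"
  have smF: "smooth (?F n)" for n by (intro smooth_mult smooth_coord even_poly_smooth d)
  have sF: "square_integrable (?F n)" for n by (rule square_integrable_smooth[OF smF])
  have lim: "(\<lambda>n. \<integral>\<^sub>S p. (w p - ?F n p)\<^sup>2) \<longlonglongrightarrow> 0" using d(2) by simp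
  have ib: "\<bar>?i p\<bar> \<le> 1" for p by (simp add: indicator_def)
  have im: "?i \<in> borel_measurable borel" by measurable
  have iw: "square_integrable (\<lambda>p. ?i p * w p)" and iF: "square_integrable (\<lambda>p. ?i p * ?F n p)" for n
    using square_integrable_mult_bounded[OF w im ib] square_integrable_mult_bounded[OF sF im ib] by auto
  have lim2: "(\<lambda>n. \<integral>\<^sub>S p. (?i p * w p - ?i p * ?F n p)\<^sup>2) \<longlonglongrightarrow> 0"
  proof (rule tendsto_sandwich[OF _ _ tendsto_const lim])
    show "\<forall>\<^sub>F n in sequentially. (\<integral>\<^sub>S p. (?i p * w p - ?i p * ?F n p)\<^sup>2)
        \<le> (\<integral>\<^sub>S p. (w p - ?F n p)\<^sup>2)"
    proof (intro always_eventually allI integral_mono)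
      fix n
      show "integrable sphere_measure (\<lambda>p. (?i p * w p - ?i p * ?F n p)\<^sup>2)"
        using square_integrable_integrable[OF square_integrable_diff[OF iw iF]] by simp
      show "integrable sphere_measure (\<lambda>p. (w p - ?F n p)\<^sup>2)"
        using square_integrable_integrable[OF square_integrable_diff[OF w sF]] by simp
      show "(?i p * w p - ?i p * ?F n p)\<^sup>2 \<le> (w p - ?F n p)\<^sup>2" for p
        by (simp add: indicator_def)
    qed
  qed simp
  let ?A = "\<integral>\<^sub>S p. (?i p * w p)\<^sup>2"
  have idem: "(?i p * w p) * w p = (?i p * w p)\<^sup>2" for p
    by (simp add: indicator_def power2_eq_square)
  have l1: "(\<lambda>n. \<integral>\<^sub>S p. (?i p * w p) * ?F n p) \<longlonglongrightarrow> ?A"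
    using square_integrable_convergence(1)[OF w sF lim iw] unfolding idem .
  have l2: "(\<lambda>n. \<integral>\<^sub>S p. (?i p * ?F n p)\<^sup>2) \<longlonglongrightarrow> ?A"
    by (rule square_integrable_convergence(2)[OF iw iF lim2])
  have "4 * ?A\<^sup>2 \<le> ?E * ?A"
  proof (rule LIMSEQ_le[OF tendsto_mult[OF tendsto_const tendsto_power[OF l1]] tendsto_mult[OF tendsto_const l2]],
      intro exI allI impI)
    fix n
    obtain N where "angular_mode_sum N (?F n)" using odd_poly_angular_mode_sum[OF d(1)] by blast
    then show "4 * (\<integral>\<^sub>S p. (?i p * w p) * ?F n p)\<^sup>2 \<le> ?E * (\<integral>\<^sub>S p. (?i p * ?F n p)\<^sup>2)"
      by (rule ineq[OF _ smF])
  qed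
  then have "4 * ?A \<le> ?E" by (rule le_of_square_le) simp_all
  moreover have "(?i p * w p)\<^sup>2 = ?i p * (w p)\<^sup>2" for p by (simp add: indicator_def)
  ultimately show ?thesis by simp
qed

section \<open>The spectral gap of the cracked sphere\<close>

lemma total_area_pos: "measure sphere_measure UNIV > 0"
proof -
  have "emeasure sphere_measure UNIV = 3 * emeasure lborel (ball (0::real^3) 1)"
    unfolding sphere_measure_def
    by (simp add: emeasure_distr emeasure_density nn_integral_cmult_indicator)
  moreover have "emeasure lborel (ball (0::real^3) 1) \<noteq> 0"
    using content_ball_pos[of 1 "0::real^3"] by (auto simp: measure_def)
  ultimately have "emeasure sphere_measure UNIV \<noteq> 0" by simp
  then show ?thesis
    using sphere.emeasure_eq_measure[of UNIV] by (simp add: zero_less_measure_iff)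
qed

lemma not_AE_coord_zero: "\<not> (AE p in sphere_measure. p $ i = 0)"
proof
  assume "AE p in sphere_measure. p $ i = 0"
  then have "AE p in sphere_measure. False"
    using AE_coord_nonzero[of i] by eventually_elim simp
  then have "emeasure sphere_measure UNIV = 0"
    using AE_iff_null[of sphere_measure "\<lambda>_. False"] by (auto simp: null_sets_def)
  then show False using total_area_pos by (simp add: measure_def)
qed

lemma integral_z_square_pos: "(\<integral>\<^sub>S p. (p $ 3)\<^sup>2) > 0"
proof -
  have "square_integrable (\<lambda>p::real^3. p $ 3)" by (intro square_integrable_smooth smooth_coord)
  then have "(\<integral>\<^sub>S p. (p $ 3)\<^sup>2) \<noteq> 0"
    using integral_square_zero[of "\<lambda>p. p $ 3"] not_AE_coord_zero[of 3] by auto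
  moreover have "(\<integral>\<^sub>S p. (p $ 3)\<^sup>2) \<ge> 0" by simp
  ultimately show ?thesis by linarith
qed

lemma sphere_laplacian_value_smooth: "sphere_laplacian f X \<phi> \<Longrightarrow> smooth \<phi>"
proof (induction rule: sphere_laplacian.induct)
  case (sphere_laplacian_monomial m j k)
  show ?case by (intro smooth_diff smooth_add smooth_mult smooth_power smooth_coord smooth_const)
next
  case (sphere_laplacian_add f X \<phi> g Y \<psi>)
  then show ?case by (intro smooth_add)
next
  case (sphere_laplacian_cmult f X \<phi> c)
  then show ?case by (intro smooth_mult smooth_const)
qed

abbreviation z_field :: "real^3 \<Rightarrow> real^3" where
  "z_field \<equiv> \<lambda>p. axis 3 1 - p $ 3 *\<^sub>R p"

lemma sphere_laplacian_one: "sphere_laplacian (\<lambda>p. 1) (\<lambda>p. 0) (\<lambda>p. 0)"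
  using harmonic_const by (simp add: harmonic_def)

lemma sphere_laplacian_z: "sphere_laplacian (\<lambda>p. p $ 3) z_field (\<lambda>p. - 2 * p $ 3)"
  using harmonic_z by (simp add: harmonic_def)

text \<open>
  The factor comes from the bound \<open>10 (\<alpha>\<^sup>2 + \<beta>\<^sup>2)\<close> on the affine part in \<open>cap_estimate\<close>, and from the
  wish to keep its contribution below \<open>1 / 12\<close> of the square norm.
\<close>

definition cap_constant :: real where
  "cap_constant = 120 * (1 / measure sphere_measure UNIV + 1 / (\<integral>\<^sub>S p. (p $ 3)\<^sup>2))"

text \<open>
  Split \<open>W = v + (\<alpha> + \<beta> z)\<close> with \<open>v\<close> orthogonal to \<open>1\<close> and \<open>z\<close>. The next eigenvalue on even functions
  is \<open>6\<close>, so \<open>\<integral> v\<^sup>2\<close> is at most a sixth of the energy, on the whole sphere and a fortiori on \<open>C\<close>. The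
  affine part is bounded pointwise by the norm of \<open>W\<close>, so it contributes little over a set of small
  area. Using the eigenvalue \<open>6\<close> instead of \<open>2\<close> is essential: with \<open>2\<close> the factor in front of the
  energy would exceed \<open>1 / 2\<close>.
\<close>

lemma cap_estimate:
  assumes W: "square_integrable W" and H: "square_integrable H"
    and inv: "\<And>p. W (flip 1 p) = W p" "\<And>p. W (flip 2 p) = W p"
    and pair: "\<And>f X \<phi>. sphere_laplacian f X \<phi> \<Longrightarrow>
      (\<integral>\<^sub>S p. H p \<bullet> X p) = - (\<integral>\<^sub>S p. W p * \<phi> p)"
    and C: "C \<in> sets borel" and small: "cap_constant * measure sphere_measure C \<le> 1"
  shows "(\<integral>\<^sub>S p. indicator C p * (W p)\<^sup>2) \<le>
    5 / 24 * (\<integral>\<^sub>S p. (norm (H p))\<^sup>2) + 1 / 12 * (\<integral>\<^sub>S p. (W p)\<^sup>2)"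
proof -
  let ?m = "measure sphere_measure UNIV" and ?z = "\<integral>\<^sub>S p. (p $ 3)\<^sup>2"
  let ?A = "\<integral>\<^sub>S p. (W p)\<^sup>2" and ?E = "\<integral>\<^sub>S p. (norm (H p))\<^sup>2"
  have m: "?m > 0" by (rule total_area_pos)
  have z: "?z > 0" by (rule integral_z_square_pos)
  define \<alpha> where "\<alpha> = (\<integral>\<^sub>S p. W p) / ?m"
  define \<beta> where "\<beta> = (\<integral>\<^sub>S p. W p * p $ 3) / ?z"
  have s1: "square_integrable (\<lambda>p. 1 :: real)" and sz: "square_integrable (\<lambda>p::real^3. p $ 3)"
    by (intro square_integrable_smooth smooth_const smooth_coord)+
  have sX: "square_integrable z_field" by (rule square_integrable_smooth_field[OF sphere_laplacian_smooth(2)[OF sphere_laplacian_z]])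
  have Wm: "(\<integral>\<^sub>S p. W p) = \<alpha> * ?m" and Wz: "(\<integral>\<^sub>S p. W p * p $ 3) = \<beta> * ?z"
    using m z by (simp_all add: \<alpha>_def \<beta>_def)
  have iz: "(\<integral>\<^sub>S p. p $ 3) = 0"
    using harmonic_orthogonal[OF harmonic_const harmonic_z] by simp
  have aff: "square_integrable (\<lambda>p::real^3. \<alpha> + \<beta> * p $ 3)"
    by (intro square_integrable_smooth smooth_add smooth_mult smooth_const smooth_coord)
  define v where "v p = W p - (\<alpha> + \<beta> * p $ 3)" for p
  define K where "K p = H p - \<beta> *\<^sub>R z_field p" for p
  have sv: "square_integrable v" unfolding v_def by (intro square_integrable_diff W aff)
  have sK: "square_integrable K" unfolding K_def by (intro square_integrable_diff H square_integrable_scaleR sX)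
  \<comment> \<open>the second eigenvalue for even functions is \<open>2 * (2 + 1)\<close>\<close>
  have v6: "real (2 * (2 + 1)) * (\<integral>\<^sub>S p. (v p)\<^sup>2) \<le> (\<integral>\<^sub>S p. (norm (K p))\<^sup>2)"
  proof (rule even_Poincare[OF sv sK])
    show "v (flip 1 p) = v p" "v (flip 2 p) = v p" for p by (simp_all add: v_def inv)
    show "(\<integral>\<^sub>S p. K p \<bullet> X p) = - (\<integral>\<^sub>S p. v p * \<phi> p)" if f: "sphere_laplacian f X \<phi>" for f X \<phi>
    proof -
      have s: "square_integrable X" "square_integrable \<phi>"
        using sphere_laplacian_smooth(2)[OF f] sphere_laplacian_value_smooth[OF f] by (auto intro: square_integrable_smooth square_integrable_smooth_field)
      have 0: "(\<integral>\<^sub>S p. \<phi> p) = 0" using sphere_laplacian_Green[OF sphere_laplacian_one f] by simp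
      have "(\<integral>\<^sub>S p. K p \<bullet> X p) =
          (\<integral>\<^sub>S p. H p \<bullet> X p) - \<beta> * (\<integral>\<^sub>S p. z_field p \<bullet> X p)"
        using square_integrable_inner[OF H s(1)] square_integrable_inner[OF sX s(1)]
        by (simp only: K_def inner_diff_left[of "H _"] inner_scaleR_left Bochner_Integration.integral_diff
            integrable_mult_right integral_mult_right_zero)
      moreover have "(\<integral>\<^sub>S p. v p * \<phi> p) = (\<integral>\<^sub>S p. W p * \<phi> p)
          - (\<alpha> * (\<integral>\<^sub>S p. \<phi> p) + \<beta> * (\<integral>\<^sub>S p. p $ 3 * \<phi> p))"
        using square_integrable_mult[OF W s(2)] square_integrable_mult[OF sz s(2)] square_integrable_imp_integrable[OF s(2)]
        by (simp add: v_def left_diff_distrib distrib_right mult.assoc)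
      ultimately show ?thesis using pair[OF f] sphere_laplacian_Green[OF sphere_laplacian_z f] 0 by simp
    qed
    show "(\<integral>\<^sub>S p. v p) = 0"
      using square_integrable_imp_integrable[OF W] square_integrable_imp_integrable[OF sz] Wm iz
      by (simp add: v_def mult.commute)
    show "(\<integral>\<^sub>S p. v p * p $ 3) = 0"
      using square_integrable_mult[OF W sz] square_integrable_imp_integrable[OF sz] square_integrable_mult[OF sz sz] Wz iz
      by (simp add: v_def left_diff_distrib distrib_right mult.assoc power2_eq_square)
  qed simp
  \<comment> \<open>\<open>\<beta> z\<close> and \<open>v\<close> are orthogonal also in energy\<close>
  have KE: "(\<integral>\<^sub>S p. (norm (K p))\<^sup>2) \<le> ?E"
  proof -
    have "(\<integral>\<^sub>S p. H p \<bullet> z_field p) = 2 * (\<beta> * ?z)"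
    proof -
      have "W p * (- 2 * p $ 3) = - 2 * (W p * p $ 3)" for p by simp
      then show ?thesis using pair[OF sphere_laplacian_z] Wz by (simp only:) simp
    qed
    moreover have "(\<integral>\<^sub>S p. (norm (z_field p))\<^sup>2) = 2 * ?z"
    proof -
      have "p $ 3 * (- 2 * p $ 3) = - 2 * (p $ 3)\<^sup>2" for p :: "real^3" by (simp add: power2_eq_square)
      then show ?thesis using sphere_laplacian_Green[OF sphere_laplacian_z sphere_laplacian_z] by (simp only: power2_norm_eq_inner) simp
    qed
    moreover have "(\<integral>\<^sub>S p. (norm (K p))\<^sup>2) = ?E
        + 2 * (\<integral>\<^sub>S p. H p \<bullet> ((- \<beta>) *\<^sub>R z_field p)) + (\<integral>\<^sub>S p. (norm ((- \<beta>) *\<^sub>R z_field p))\<^sup>2)"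
      using norm_square_integral_add[OF H square_integrable_scaleR[OF sX, of "- \<beta>"]] by (simp only: K_def diff_conv_add_uminus scaleR_minus_left)
    moreover have "(norm ((- \<beta>) *\<^sub>R z_field p))\<^sup>2 = \<beta>\<^sup>2 * (norm (z_field p))\<^sup>2" for p
      by (simp add: power_mult_distrib)
    ultimately have "(\<integral>\<^sub>S p. (norm (K p))\<^sup>2) = ?E - 2 * \<beta>\<^sup>2 * ?z"
      by (simp only: inner_scaleR_right integral_mult_right_zero) (simp add: power2_eq_square)
    moreover have "0 \<le> 2 * \<beta>\<^sup>2 * ?z" using z by simp
    ultimately show ?thesis by linarith
  qed
  have \<alpha>A: "\<alpha>\<^sup>2 \<le> (1 / ?m) * ?A"
  proof -
    have "(\<alpha> * ?m)\<^sup>2 \<le> ?A * ?m" using Cauchy_Schwarz_sphere[OF W s1] by (simp add: Wm)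
    then have "(\<alpha>\<^sup>2 * ?m) * ?m \<le> ?A * ?m" by (simp add: power2_eq_square mult_ac)
    then have "\<alpha>\<^sup>2 * ?m \<le> ?A" using m by (simp only: mult_le_cancel_right_pos)
    then show ?thesis using m by (simp add: field_simps)
  qed
  have \<beta>A: "\<beta>\<^sup>2 \<le> (1 / ?z) * ?A"
  proof -
    have "(\<beta> * ?z)\<^sup>2 \<le> ?A * ?z" using Cauchy_Schwarz_sphere[OF W sz] by (simp add: Wz)
    then have "(\<beta>\<^sup>2 * ?z) * ?z \<le> ?A * ?z" by (simp add: power2_eq_square mult_ac)
    then have "\<beta>\<^sup>2 * ?z \<le> ?A" using z by (simp only: mult_le_cancel_right_pos)
    then show ?thesis using z by (simp add: field_simps)
  qed
  have pt: "indicator C p * (W p)\<^sup>2 \<le> 5 / 4 * (v p)\<^sup>2 + (10 * (\<alpha>\<^sup>2 + \<beta>\<^sup>2)) * indicator C p"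
    if p: "p \<in> sphere 0 1" for p
  proof (cases "p \<in> C")
    case True
    have "\<bar>p $ 3\<bar> \<le> 1" using component_le_norm_cart[of p 3] p by simp
    then have "(p $ 3)\<^sup>2 \<le> 1" by (simp add: abs_square_le_1)
    then have "\<beta>\<^sup>2 * (p $ 3)\<^sup>2 \<le> \<beta>\<^sup>2 * 1" by (intro mult_left_mono) auto
    moreover have "(\<alpha> + \<beta> * p $ 3)\<^sup>2 \<le> 2 * \<alpha>\<^sup>2 + 2 * (\<beta>\<^sup>2 * (p $ 3)\<^sup>2)"
    proof -
      have "0 \<le> (\<alpha> - \<beta> * p $ 3)\<^sup>2" by simp
      then show ?thesis by (simp add: power2_eq_square algebra_simps)
    qed
    moreover have "(W p)\<^sup>2 \<le> 5 / 4 * (v p)\<^sup>2 + 5 * (\<alpha> + \<beta> * p $ 3)\<^sup>2"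
    proof -
      have e: "W p = v p + (\<alpha> + \<beta> * p $ 3)" by (simp add: v_def)
      have "(x + y)\<^sup>2 \<le> 5 / 4 * x\<^sup>2 + 5 * y\<^sup>2" for x y :: real
      proof -
        \<comment> \<open>the weight \<open>5 / 4\<close> turns the factor \<open>1 / 6\<close> into \<open>5 / 24\<close>\<close>
        have "0 \<le> (x / 2 - 2 * y)\<^sup>2" by simp
        then show ?thesis by (simp add: power2_eq_square algebra_simps)
      qed
      then show ?thesis unfolding e .
    qed
    ultimately show ?thesis using True by simp
  qed simp
  have ic: "integrable sphere_measure (\<lambda>p. indicator C p * (W p)\<^sup>2)"
  proof (rule Bochner_Integration.integrable_bound[OF square_integrable_integrable[OF W]])
    note [measurable] = square_integrable_measurable[OF W] C
    show "(\<lambda>p. indicator C p * (W p)\<^sup>2) \<in> borel_measurable sphere_measure" by measurable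
    show "AE p in sphere_measure. norm (indicator C p * (W p)\<^sup>2) \<le> norm ((norm (W p))\<^sup>2)"
      by (simp add: indicator_def)
  qed
  have iC: "integrable sphere_measure (indicator C :: real^3 \<Rightarrow> real)"
    using square_integrable_imp_integrable[OF square_integrable_indicator[OF C]] .
  have iv: "integrable sphere_measure (\<lambda>p. (v p)\<^sup>2)" using square_integrable_integrable[OF sv] by simp
  have "(\<integral>\<^sub>S p. indicator C p * (W p)\<^sup>2) \<le>
      (\<integral>\<^sub>S p. 5 / 4 * (v p)\<^sup>2 + (10 * (\<alpha>\<^sup>2 + \<beta>\<^sup>2)) * indicator C p)"
  proof (rule integral_mono_AE[OF ic])
    show "integrable sphere_measure (\<lambda>p. 5 / 4 * (v p)\<^sup>2 + (10 * (\<alpha>\<^sup>2 + \<beta>\<^sup>2)) * indicator C p)"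
      using iv iC by (intro Bochner_Integration.integrable_add integrable_mult_right)
    show "AE p in sphere_measure. indicator C p * (W p)\<^sup>2 \<le> 5 / 4 * (v p)\<^sup>2 + (10 * (\<alpha>\<^sup>2 + \<beta>\<^sup>2)) * indicator C p"
      using AE_sphere by eventually_elim (rule pt)
  qed
  also have "\<dots> = 5 / 4 * (\<integral>\<^sub>S p. (v p)\<^sup>2) + (10 * (\<alpha>\<^sup>2 + \<beta>\<^sup>2)) * measure sphere_measure C"
    using iv iC C by (subst Bochner_Integration.integral_add) simp_all
  finally have 1: "(\<integral>\<^sub>S p. indicator C p * (W p)\<^sup>2) \<le>
      5 / 4 * (\<integral>\<^sub>S p. (v p)\<^sup>2) + (10 * (\<alpha>\<^sup>2 + \<beta>\<^sup>2)) * measure sphere_measure C" .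
  have 2: "5 / 4 * (\<integral>\<^sub>S p. (v p)\<^sup>2) \<le> 5 / 24 * ?E"
    using v6 KE by simp
  have "(10 * (\<alpha>\<^sup>2 + \<beta>\<^sup>2)) * measure sphere_measure C \<le>
      (10 * ((1 / ?m) * ?A + (1 / ?z) * ?A)) * measure sphere_measure C"
    using \<alpha>A \<beta>A by (intro mult_right_mono mult_left_mono add_mono) auto
  also have "\<dots> = 1 / 12 * (cap_constant * measure sphere_measure C) * ?A"
    by (simp add: cap_constant_def algebra_simps)
  also have "\<dots> \<le> 1 / 12 * 1 * ?A"
    using small by (intro mult_right_mono mult_left_mono) auto
  finally show ?thesis using 1 2 by linarith
qed

lemma cracked_sphere_iff:
  "p \<in> cracked_sphere a \<longleftrightarrow> p \<in> sphere 0 1 \<and> (p $ 1 \<noteq> 0 \<and> p $ 2 \<noteq> 0 \<or> p $ 3 < 1 - a)"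
  by (auto simp: cracked_sphere_def)

lemma cracked_sphere_off_planes: "{p \<in> sphere 0 1. p $ 1 \<noteq> 0 \<and> p $ 2 \<noteq> 0} \<subseteq> cracked_sphere a"
  by (auto simp: cracked_sphere_iff)

lemma cracked_sphere_flip: "i \<noteq> 3 \<Longrightarrow> p \<in> cracked_sphere a \<Longrightarrow> flip i p \<in> cracked_sphere a"
  by (auto simp: cracked_sphere_iff)

text \<open>
  The only smallness of \<open>a\<close> that is used.
\<close>

definition small_cap :: "real \<Rightarrow> bool" where
  "small_cap a \<longleftrightarrow> cap_constant * measure sphere_measure {p. 1 - a \<le> p $ 3} \<le> 1"

text \<open>
  Below the crack \<open>latitude_inequality\<close> bounds the mass by \<open>1 / 4\<close> of the energy \<open>E\<close>. In the cap,
  \<open>cap_estimate\<close> applies to the function multiplied by the sign of \<open>x y\<close>, which is even. Together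
  \<open>\<integral> w\<^sup>2 \<le> (1 / 4 + 5 / 24) E + 1 / 12 \<integral> w\<^sup>2\<close>, that is \<open>11 / 12 \<integral> w\<^sup>2 \<le> 11 / 24 E\<close>.
\<close>

theorem odd_odd_bound:
  assumes wp: "weak_pair (cracked_sphere a) w G" and a: "small_cap a"
    and odd: "\<And>p. w (flip 1 p) = - w p" "\<And>p. w (flip 2 p) = - w p"
  shows "2 * (\<integral>\<^sub>S p. (w p)\<^sup>2) \<le> (\<integral>\<^sub>S p. (norm (G p))\<^sup>2)"
proof -
  let ?C = "{p::real^3. 1 - a \<le> p $ 3}" and ?D = "{p::real^3. p $ 3 < 1 - a}"
  let ?q = "quarter_sign (-1) (-1)"
  let ?A = "\<integral>\<^sub>S p. (w p)\<^sup>2" and ?E = "\<integral>\<^sub>S p. (norm (G p))\<^sup>2"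
  have w: "square_integrable w" and G: "square_integrable G" using wp by (auto simp: weak_pair_def)
  have C: "?C \<in> sets borel" by (intro borel_closed closed_Collect_le continuous_intros)
  have D: "?D \<in> sets borel" by (intro borel_open open_Collect_less continuous_intros)
  have ed: "(-1) * (-1) = (1::real)" by simp
  have 1: "4 * (\<integral>\<^sub>S p. indicator ?D p * (w p)\<^sup>2) \<le> ?E"
    by (rule latitude_inequality[OF wp _ odd]) (simp add: cracked_sphere_iff)
  have 2: "(\<integral>\<^sub>S p. indicator ?C p * (?q p * w p)\<^sup>2) \<le>
    5 / 24 * (\<integral>\<^sub>S p. (norm (?q p *\<^sub>R G p))\<^sup>2) + 1 / 12 * (\<integral>\<^sub>S p. (?q p * w p)\<^sup>2)"
  proof (rule cap_estimate)
    show "square_integrable (\<lambda>p. ?q p * w p)" using quarter_sign_square_integrable(1)[OF w ed ed] by simp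
    show "square_integrable (\<lambda>p. ?q p *\<^sub>R G p)" by (rule quarter_sign_square_integrable(1)[OF G ed ed])
    show "?q (flip 1 p) * w (flip 1 p) = ?q p * w p" "?q (flip 2 p) * w (flip 2 p) = ?q p * w p" for p
      by (simp_all add: quarter_sign_flip odd)
    show "(\<integral>\<^sub>S p. (?q p *\<^sub>R G p) \<bullet> X p) = - (\<integral>\<^sub>S p. (?q p * w p) * \<phi> p)"
      if "sphere_laplacian f X \<phi>" for f X \<phi>
      by (rule weak_pair_even_pairing[OF wp cracked_sphere_off_planes ed ed that])
    show "cap_constant * measure sphere_measure ?C \<le> 1" using a by (simp add: small_cap_def)
  qed (rule C)
  have 3: "(\<integral>\<^sub>S p. (?q p * w p)\<^sup>2) = ?A"
    using quarter_sign_square_integrable(2)[OF w ed ed] by simp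
  have 4: "(\<integral>\<^sub>S p. indicator ?C p * (?q p * w p)\<^sup>2) = (\<integral>\<^sub>S p. indicator ?C p * (w p)\<^sup>2)"
  proof (rule integral_cong_AE)
    note [measurable] = square_integrable_measurable[OF w] C
    show "(\<lambda>p. indicator ?C p * (?q p * w p)\<^sup>2) \<in> borel_measurable sphere_measure"
      "(\<lambda>p. indicator ?C p * (w p)\<^sup>2) \<in> borel_measurable sphere_measure" by measurable
    show "AE p in sphere_measure. indicator ?C p * (?q p * w p)\<^sup>2 = indicator ?C p * (w p)\<^sup>2"
      using AE_quarter_sign_square[OF ed ed] by eventually_elim (simp add: power_mult_distrib)
  qed
  have i: "integrable sphere_measure (\<lambda>p. indicator B p * (w p)\<^sup>2)" if B: "B \<in> sets borel" for B
  proof (rule Bochner_Integration.integrable_bound[OF square_integrable_integrable[OF w]])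
    note [measurable] = square_integrable_measurable[OF w] B
    show "(\<lambda>p. indicator B p * (w p)\<^sup>2) \<in> borel_measurable sphere_measure" by measurable
    show "AE p in sphere_measure. norm (indicator B p * (w p)\<^sup>2) \<le> norm ((norm (w p))\<^sup>2)"
      by (simp add: indicator_def)
  qed
  have "?A = (\<integral>\<^sub>S p. indicator ?D p * (w p)\<^sup>2 + indicator ?C p * (w p)\<^sup>2)"
    by (rule Bochner_Integration.integral_cong) (auto simp: indicator_def)
  also have "\<dots> = (\<integral>\<^sub>S p. indicator ?D p * (w p)\<^sup>2) + (\<integral>\<^sub>S p. indicator ?C p * (w p)\<^sup>2)"
    by (rule Bochner_Integration.integral_add[OF i[OF D] i[OF C]])
  finally show ?thesis
    using 1 2 unfolding 3 4 quarter_sign_square_integrable(2)[OF G ed ed] by linarith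
qed

text \<open>
  Only the part of \<open>w\<close> with the parity of the weight contributes to the weighted mean.
\<close>

lemma parity_part_quarter_mean:
  assumes w: "square_integrable w" and ed: "e * e = 1" "d * d = 1" and s: "s * s = 1"
    and q: "\<And>p. quarter_sign e d (flip i p) = s * quarter_sign e d p"
  shows "(\<integral>\<^sub>S p. quarter_sign e d p * parity_part i s w p) =
    (\<integral>\<^sub>S p. quarter_sign e d p * w p)"
proof -
  let ?q = "quarter_sign e d"
  have qw: "integrable sphere_measure (\<lambda>p. ?q p * w p)"
    using square_integrable_imp_integrable quarter_sign_square_integrable(1)[OF w ed] by simp
  have qw': "integrable sphere_measure (\<lambda>p. ?q p * w (flip i p))"
    using square_integrable_imp_integrable quarter_sign_square_integrable(1)[OF square_integrable_orthogonal[OF flip_orthogonal w] ed] by simp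
  have "(\<integral>\<^sub>S p. ?q p * w (flip i p)) = (\<integral>\<^sub>S p. ?q (flip i p) * w p)"
  proof -
    note [measurable] = square_integrable_measurable[OF w] orthogonal_transformation_measurable[OF flip_orthogonal]
    have "(\<integral>\<^sub>S p. ?q (flip i (flip i p)) * w (flip i p)) = (\<integral>\<^sub>S p. ?q (flip i p) * w p)"
      by (rule integral_orthogonal_transformation(1)[OF flip_orthogonal, of "\<lambda>p. ?q (flip i p) * w p"]) measurable
    then show ?thesis by simp
  qed
  also have "\<dots> = s * (\<integral>\<^sub>S p. ?q p * w p)"
    by (simp add: q mult.assoc)
  finally have 1: "s * (\<integral>\<^sub>S p. ?q p * w (flip i p)) = (\<integral>\<^sub>S p. ?q p * w p)"
    using s by (simp add: mult.assoc[symmetric])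
  have "?q p * parity_part i s w p = (1/2) * (?q p * w p + s * (?q p * w (flip i p)))" for p
    by (simp add: parity_part_def algebra_simps)
  then have "(\<integral>\<^sub>S p. ?q p * parity_part i s w p) =
    (1/2) * ((\<integral>\<^sub>S p. ?q p * w p) + s * (\<integral>\<^sub>S p. ?q p * w (flip i p)))"
    using qw qw' by (simp only: integral_mult_right_zero Bochner_Integration.integral_add integrable_mult_right)
  then show ?thesis unfolding 1 by simp
qed

text \<open>
  The conditions are the weighted means of the three parity parts to which \<open>parity_Poincare\<close> applies.
  The part that is odd in both variables is covered by \<open>odd_odd_bound\<close>, without a condition.
\<close>

theorem spectral_gap:
  assumes wp: "weak_pair (cracked_sphere a) w G" and a: "small_cap a"
    and mean: "(\<integral>\<^sub>S p. quarter_sign 1 1 p * w p) = 0"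
      "(\<integral>\<^sub>S p. quarter_sign (-1) 1 p * w p) = 0"
      "(\<integral>\<^sub>S p. quarter_sign 1 (-1) p * w p) = 0"
  shows "2 * (\<integral>\<^sub>S p. (w p)\<^sup>2) \<le> (\<integral>\<^sub>S p. (norm (G p))\<^sup>2)"
proof -
  let ?w = "\<lambda>e d. parity_part 2 d (parity_part 1 e w)" and ?G = "\<lambda>e d. parity_part_field 2 d (parity_part_field 1 e G)"
  have fl: "\<And>p. p \<in> cracked_sphere a \<Longrightarrow> flip 1 p \<in> cracked_sphere a"
    "\<And>p. p \<in> cracked_sphere a \<Longrightarrow> flip 2 p \<in> cracked_sphere a"
    by (rule cracked_sphere_flip, simp, simp)+
  have wp1: "weak_pair (cracked_sphere a) (parity_part 1 e w) (parity_part_field 1 e G)" for e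
    by (rule weak_pair_parity_part[OF wp fl(1)])
  have wp2: "weak_pair (cracked_sphere a) (?w e d) (?G e d)" for e d
    by (rule weak_pair_parity_part[OF wp1 fl(2)])
  have s: "square_integrable w" "square_integrable G" "square_integrable (parity_part 1 e w)" "square_integrable (parity_part_field 1 e G)" for e
    using wp wp1 by (auto simp: weak_pair_def)
  have par: "?w e d (flip 1 p) = e * ?w e d p" "?w e d (flip 2 p) = d * ?w e d p"
    if "e * e = 1" "d * d = 1" for e d p
    by (rule parity_part_flip_other, rule parity_part_flip[OF that(1)], rule parity_part_flip[OF that(2)])
  have means: "(\<integral>\<^sub>S p. quarter_sign e d p * ?w e d p) = (\<integral>\<^sub>S p. quarter_sign e d p * w p)"
    if ed: "e * e = 1" "d * d = 1" for e d
    using parity_part_quarter_mean[OF s(3) ed ed(2) quarter_sign_flip(2)[OF ed]]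
      parity_part_quarter_mean[OF s(1) ed ed(1) quarter_sign_flip(1)[OF ed]] by simp
  have low: "2 * (\<integral>\<^sub>S p. (?w e d p)\<^sup>2) \<le> (\<integral>\<^sub>S p. (norm (?G e d p))\<^sup>2)"
    if ed: "e * e = 1" "d * d = 1" and z: "(\<integral>\<^sub>S p. quarter_sign e d p * w p) = 0" for e d
    by (rule parity_Poincare[OF wp2 cracked_sphere_off_planes ed par[OF ed]]) (simp only: means[OF ed] z)
  have 1: "2 * (\<integral>\<^sub>S p. (?w 1 1 p)\<^sup>2) \<le> (\<integral>\<^sub>S p. (norm (?G 1 1 p))\<^sup>2)"
    by (rule low[OF _ _ mean(1)]) simp_all
  have 2: "2 * (\<integral>\<^sub>S p. (?w (-1) 1 p)\<^sup>2) \<le> (\<integral>\<^sub>S p. (norm (?G (-1) 1 p))\<^sup>2)"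
    by (rule low[OF _ _ mean(2)]) simp_all
  have 3: "2 * (\<integral>\<^sub>S p. (?w 1 (-1) p)\<^sup>2) \<le> (\<integral>\<^sub>S p. (norm (?G 1 (-1) p))\<^sup>2)"
    by (rule low[OF _ _ mean(3)]) simp_all
  have 4: "2 * (\<integral>\<^sub>S p. (?w (-1) (-1) p)\<^sup>2) \<le> (\<integral>\<^sub>S p. (norm (?G (-1) (-1) p))\<^sup>2)"
    by (rule odd_odd_bound[OF wp2 a]) (use par[of "-1" "-1"] in simp_all)
  show ?thesis
    using 1 2 3 4 parity_part_norm[OF s(1), of 1] parity_part_norm[OF s(3), of 1 2] parity_part_norm[OF s(3), of "-1" 2]
      parity_part_field_norm[OF s(2), of 1] parity_part_field_norm[OF s(4), of 1 2] parity_part_field_norm[OF s(4), of "-1" 2]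
    by linarith
qed

text \<open>
  The closed caps shrink to the north pole, which has area zero.
\<close>

lemma small_cap_eventually: "\<exists>a0>0. a0 \<le> 1 \<and> (\<forall>a. 0 < a \<and> a < a0 \<longrightarrow> small_cap a)"
proof -
  let ?S = "\<lambda>a. {p::real^3. 1 - a \<le> p $ 3} \<inter> sphere 0 1"
  have cl: "closed (?S a)" for a
    by (intro closed_Int closed_sphere closed_Collect_le continuous_intros)
  have meas: "?S a \<in> sets sphere_measure" for a
    unfolding sets_sphere_measure by (rule borel_closed[OF cl])
  have eqS: "measure sphere_measure {p. 1 - a \<le> p $ 3} = measure sphere_measure (?S a)" for a
  proof (rule sphere.finite_measure_eq_AE)
    show "AE p in sphere_measure. (p \<in> {p. 1 - a \<le> p $ 3}) = (p \<in> ?S a)"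
      using AE_sphere by eventually_elim auto
    show "{p::real^3. 1 - a \<le> p $ 3} \<in> sets sphere_measure"
      unfolding sets_sphere_measure by (intro borel_closed closed_Collect_le continuous_intros)
  qed (rule meas)
  have mono: "?S x \<subseteq> ?S y" if "x \<le> y" for x y using that by auto
  let ?B = "\<lambda>n. ?S (inverse (real (Suc n)))"
  have dec: "decseq ?B"
  proof (rule decseq_SucI)
    fix n
    have "inverse (real (Suc (Suc n))) \<le> inverse (real (Suc n))" by (intro le_imp_inverse_le) auto
    then show "?B (Suc n) \<subseteq> ?B n" by (rule mono)
  qed
  have "(\<lambda>n. measure sphere_measure (?B n)) \<longlonglongrightarrow> measure sphere_measure (\<Inter>n. ?B n)"
    by (rule sphere.finite_Lim_measure_decseq[OF _ dec]) (rule image_subsetI, rule meas)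
  moreover have "measure sphere_measure (\<Inter>n. ?B n) = 0"
  proof -
    have "(\<Inter>n. ?B n) \<subseteq> {p. p $ 1 = 0}"
    proof
      fix p :: "real^3" assume p: "p \<in> (\<Inter>n. ?B n)"
      then have pn: "p \<in> ?B n" for n by (rule INT_D) (rule UNIV_I)
      then have "1 - inverse (real (Suc n)) \<le> p $ 3" for n by (simp only: Int_iff mem_Collect_eq)
      \<comment> \<open>in the limit \<open>z \<ge> 1\<close>, so the point is the north pole and lies in the null set \<open>x = 0\<close>\<close>
      then have "1 - 0 \<le> p $ 3"
        by (intro LIMSEQ_le_const2[OF tendsto_diff[OF tendsto_const LIMSEQ_inverse_real_of_nat]]) auto
      moreover have "p \<in> sphere 0 1" using pn[of 0] by (simp only: Int_iff)
      then have "p \<bullet> p = 1" by (simp add: norm_eq_1)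
      then have n: "p $ 1 * p $ 1 + p $ 2 * p $ 2 + p $ 3 * p $ 3 = 1" by (simp add: inner_vec_def sum_3)
      ultimately have "1 * 1 \<le> p $ 3 * p $ 3" by (intro mult_mono) auto
      then have "p $ 1 * p $ 1 \<le> 0" using n zero_le_square[of "p $ 2"] by linarith
      then show "p \<in> {p. p $ 1 = 0}" using zero_le_square[of "p $ 1"] by auto
    qed
    moreover have "{p::real^3. p $ 1 = 0} \<in> null_sets sphere_measure"
    proof -
      have "{p::real^3. p $ 1 = 0} \<in> sets sphere_measure"
        unfolding sets_sphere_measure by (intro borel_closed closed_Collect_eq continuous_intros)
      then show ?thesis using AE_coord_nonzero[of 1] by (simp add: AE_iff_null[of _ "\<lambda>p. p $ 1 \<noteq> 0"])
    qed
    ultimately have "(\<Inter>n. ?B n) \<in> null_sets sphere_measure"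
    proof (rule null_sets_subset[rotated 2])
      show "(\<Inter>n. ?B n) \<in> sets sphere_measure"
        unfolding sets_sphere_measure by (intro borel_closed closed_INT ballI cl)
    qed
    then show ?thesis by (simp add: measure_eq_0_null_sets)
  qed
  ultimately have "(\<lambda>n. cap_constant * measure sphere_measure (?B n)) \<longlonglongrightarrow> cap_constant * 0"
    by (intro tendsto_mult tendsto_const) simp
  then have "\<forall>\<^sub>F n in sequentially. cap_constant * measure sphere_measure (?B n) < 1"
    by (rule order_tendstoD) simp
  then obtain n where n: "cap_constant * measure sphere_measure (?B n) < 1"
    using eventually_happens trivial_limit_sequentially by blast
  have cc: "cap_constant \<ge> 0"
    using total_area_pos integral_z_square_pos by (simp add: cap_constant_def)
  show ?thesis
  proof (intro exI[of _ "inverse (real (Suc n))"] conjI allI impI)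
    show "0 < inverse (real (Suc n))" by simp
    show "inverse (real (Suc n)) \<le> 1" by (simp add: inverse_le_1_iff)
    fix a :: real assume a: "0 < a \<and> a < inverse (real (Suc n))"
    then have "a \<le> inverse (real (Suc n))" by (simp only: less_imp_le)
    then have "?S a \<subseteq> ?B n" by (rule mono)
    then have "measure sphere_measure (?S a) \<le> measure sphere_measure (?B n)"
      by (intro sphere.finite_measure_mono meas)
    then have "cap_constant * measure sphere_measure (?S a) \<le> cap_constant * measure sphere_measure (?B n)"
      using cc by (rule mult_left_mono)
    then show "small_cap a" unfolding small_cap_def eqS using n by linarith
  qed
qed

section \<open>Eigenfunctions of the Neumann Laplacian\<close>

text \<open>
  Values outside \<open>\<Omega>\<close> are arbitrary in the Sobolev space, so they are erased before a function is
  integrated over the whole sphere.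
\<close>

definition zero_extension :: "(real^3) set \<Rightarrow> (real^3 \<Rightarrow> 'b::real_vector) \<Rightarrow> real^3 \<Rightarrow> 'b" where
  "zero_extension \<Omega> f = (\<lambda>p. indicator \<Omega> p *\<^sub>R f p)"

lemma area_integral: "\<Omega> \<in> sets borel \<Longrightarrow>
    (\<integral>p. f p \<partial>area \<Omega>) = (\<integral>\<^sub>S p. zero_extension \<Omega> f p)"
  for f :: "real^3 \<Rightarrow> 'b::{banach, second_countable_topology}"
  unfolding area_def zero_extension_def by (subst integral_restrict_space) (auto simp: set_lebesgue_integral_def)

lemma L2_iff_square_integrable:
  fixes f :: "real^3 \<Rightarrow> 'b::euclidean_space"
  assumes \<Omega>: "\<Omega> \<in> sets borel" shows "L2 \<Omega> f \<longleftrightarrow> square_integrable (zero_extension \<Omega> f)"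
proof -
  have "f \<in> borel_measurable (area \<Omega>) \<longleftrightarrow> zero_extension \<Omega> f \<in> borel_measurable borel"
    unfolding area_def zero_extension_def using \<Omega> by (subst borel_measurable_restrict_space_iff) auto
  moreover have "integrable (area \<Omega>) (\<lambda>p. (norm (f p))\<^sup>2) \<longleftrightarrow> integrable sphere_measure (\<lambda>p. (norm (zero_extension \<Omega> f p))\<^sup>2)"
  proof -
    have "indicator \<Omega> p *\<^sub>R (norm (f p))\<^sup>2 = (norm (zero_extension \<Omega> f p))\<^sup>2" for p
      by (simp add: zero_extension_def indicator_def)
    then show ?thesis
      unfolding area_def using \<Omega> by (subst integrable_restrict_space) (auto simp: set_integrable_def)
  qed
  ultimately show ?thesis by (simp add: L2_def square_integrable_def)
qed

lemma weak_gradient_weak_pair: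
  assumes \<Omega>: "\<Omega> \<in> sets borel" and u: "L2 \<Omega> u" and G: "weak_gradient \<Omega> u G"
  shows "weak_pair \<Omega> (zero_extension \<Omega> u) (zero_extension \<Omega> G)"
  unfolding weak_pair_def
proof (intro conjI allI impI)
  show "square_integrable (zero_extension \<Omega> u)" using u L2_iff_square_integrable[OF \<Omega>] by blast
  show "square_integrable (zero_extension \<Omega> G)" using G L2_iff_square_integrable[OF \<Omega>] by (auto simp: weak_gradient_def)
  fix X assume "test_field \<Omega> X"
  then have "(\<integral>p. u p * sphere_div X p \<partial>area \<Omega>) = - (\<integral>p. G p \<bullet> X p \<partial>area \<Omega>)"
    using G by (simp add: weak_gradient_def)
  then show "(\<integral>\<^sub>S p. zero_extension \<Omega> u p * sphere_div X p) = - (\<integral>\<^sub>S p. zero_extension \<Omega> G p \<bullet> X p)"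
    unfolding area_integral[OF \<Omega>] by (simp add: zero_extension_def mult.assoc)
qed

lemma cracked_sphere_borel: "cracked_sphere a \<in> sets borel"
proof -
  have "closed {p::real^3. p $ 1 * p $ 2 = 0 \<and> 1 - p $ 3 \<le> a}"
    by (intro closed_Collect_conj closed_Collect_le closed_Collect_eq continuous_intros)
  moreover have "cracked_sphere a = sphere 0 1 - {p::real^3. p $ 1 * p $ 2 = 0 \<and> 1 - p $ 3 \<le> a}"
    by (auto simp: cracked_sphere_def)
  ultimately show ?thesis by (simp only:) (intro sets.Diff borel_closed closed_sphere)
qed

text \<open>
  The crack lies in two coordinate planes and has area zero, so that integrals over the cracked
  sphere and over the sphere agree.
\<close>

lemma AE_cracked_sphere: "AE p in sphere_measure. p \<in> cracked_sphere a"
  using AE_sphere AE_coord_nonzero[of 1] AE_coord_nonzero[of 2]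
  by eventually_elim (simp add: cracked_sphere_iff)

lemma AE_area_iff: "(AE p in area (cracked_sphere a). P p) \<longleftrightarrow> (AE p in sphere_measure. P p)"
proof -
  have "(AE p in area (cracked_sphere a). P p) \<longleftrightarrow> (AE p in sphere_measure. p \<in> cracked_sphere a \<longrightarrow> P p)"
    unfolding area_def using cracked_sphere_borel by (subst AE_restrict_space_iff) auto
  also have "\<dots> \<longleftrightarrow> (AE p in sphere_measure. P p)"
    using AE_cracked_sphere[of a] by (auto elim: eventually_mono eventually_elim2)
  finally show ?thesis .
qed

lemma integral_zero_extension_cracked:
  fixes f :: "real^3 \<Rightarrow> 'b::{banach, second_countable_topology}"
  assumes "f \<in> borel_measurable borel"
  shows "(\<integral>p. f p \<partial>area (cracked_sphere a)) = (\<integral>\<^sub>S p. f p)"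
  unfolding area_integral[OF cracked_sphere_borel]
proof (rule integral_cong_AE)
  note [measurable] = assms cracked_sphere_borel
  show "zero_extension (cracked_sphere a) f \<in> borel_measurable sphere_measure"
    unfolding zero_extension_def by measurable
  show "f \<in> borel_measurable sphere_measure" by measurable
  show "AE p in sphere_measure. zero_extension (cracked_sphere a) f p = f p"
    using AE_cracked_sphere[of a] by eventually_elim (simp add: zero_extension_def)
qed

lemma square_integrable_L2: assumes "square_integrable f" shows "L2 (cracked_sphere a) f"
  unfolding L2_iff_square_integrable[OF cracked_sphere_borel] zero_extension_def
  by (rule square_integrable_mult_bounded[OF assms, where B = 1]) (use cracked_sphere_borel in \<open>auto simp: indicator_def\<close>)

text \<open>
  The difference of two weak gradients is a weak gradient of zero. This gives access to the gradient
  that the Dirichlet form is built on, which is an arbitrary choice.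
\<close>

lemma weak_gradient_unique:
  assumes u: "L2 (cracked_sphere a) u"
    and G: "weak_gradient (cracked_sphere a) u G" and G': "weak_gradient (cracked_sphere a) u G'"
  shows "AE p in sphere_measure. G p = G' p"
proof -
  let ?\<Omega> = "cracked_sphere a"
  note wp = weak_gradient_weak_pair[OF cracked_sphere_borel u]
  have "weak_pair ?\<Omega> (\<lambda>p. zero_extension ?\<Omega> u p + (-1) * zero_extension ?\<Omega> u p) (\<lambda>p. zero_extension ?\<Omega> G p + (-1) *\<^sub>R zero_extension ?\<Omega> G' p)"
    by (intro weak_pair_add weak_pair_cmult wp G G')
  then have "weak_pair ?\<Omega> (\<lambda>_. 0) (\<lambda>p. zero_extension ?\<Omega> G p - zero_extension ?\<Omega> G' p)" by simp
  moreover have "AE p in sphere_measure. (zero_extension ?\<Omega> G p - zero_extension ?\<Omega> G' p) \<bullet> p = 0"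
    using G G' by (auto simp: zero_extension_def indicator_def weak_gradient_def inner_diff_left)
  ultimately have "AE p in sphere_measure. zero_extension ?\<Omega> G p - zero_extension ?\<Omega> G' p = 0"
    using weak_gradient_of_zero[OF _ cracked_sphere_off_planes] by blast
  then show ?thesis
    using AE_cracked_sphere[of a] by eventually_elim (simp add: zero_extension_def)
qed

lemma grad_weak_gradient: "H1 \<Omega> u \<Longrightarrow> weak_gradient \<Omega> u (grad \<Omega> u)"
  unfolding H1_def grad_def by (elim conjE) (rule someI_ex[where P = "weak_gradient \<Omega> u"])

lemma H1_weak_pair:
  "H1 (cracked_sphere a) u \<Longrightarrow>
    weak_pair (cracked_sphere a) (zero_extension (cracked_sphere a) u) (zero_extension (cracked_sphere a) (grad (cracked_sphere a) u))"
  by (rule weak_gradient_weak_pair[OF cracked_sphere_borel _ grad_weak_gradient]) (simp_all add: H1_def)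

text \<open>
  Integration by parts, for fields that are merely continuously differentiable: test fields need not
  belong to the inductive class of smooth fields.
\<close>

lemma divergence_product:
  assumes f: "has_grad f g" "smooth_field g" "smooth f" and Y: "Ck 1 Y"
    and tan: "\<And>p. p \<in> sphere 0 1 \<Longrightarrow> Y p \<bullet> p = 0"
  shows "(\<integral>\<^sub>S p. f p * sphere_div Y p) = - (\<integral>\<^sub>S p. g p \<bullet> Y p)"
proof -
  let ?Z = "\<lambda>p. f p *\<^sub>R Y p"
  have dY: "Y differentiable (at p)" for p using Y by simp
  have cY: "continuous_on UNIV Y"
    using dY by (simp add: continuous_at_imp_continuous_on differentiable_imp_continuous_within)
  have cD: "continuous_on UNIV (\<lambda>p. frechet_derivative Y (at p) h)" for h using Y by simp
  have cf: "continuous_on UNIV f" "continuous_on UNIV g"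
    using f by (auto intro: smooth_continuous smooth_field_continuous)
  have dZ: "(?Z has_derivative (\<lambda>v. f p *\<^sub>R frechet_derivative Y (at p) v + (g p \<bullet> v) *\<^sub>R Y p)) (at p)" for p
    using f dY unfolding has_grad_def frechet_derivative_works by (intro has_derivative_scaleR) auto
  have "frechet_derivative ?Z (at p) = (\<lambda>v. f p *\<^sub>R frechet_derivative Y (at p) v + (g p \<bullet> v) *\<^sub>R Y p)" for p
    by (rule frechet_derivative_at[OF dZ, symmetric])
  then have "Ck 1 ?Z"
    using differentiableI[OF dZ] by (auto intro!: continuous_intros cf cY cD)
  moreover have "?Z p \<bullet> p = 0" if "p \<in> sphere 0 1" for p using tan[OF that] by simp
  ultimately have "0 = (\<integral>\<^sub>S p. sphere_div ?Z p)" by (simp only: divergence_theorem)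
  also have "\<dots> = (\<integral>\<^sub>S p. f p * sphere_div Y p + g p \<bullet> Y p)"
  proof (rule integral_cong_AE)
    note cdiv = Ck_1_sphere_div_continuous
    show "sphere_div ?Z \<in> borel_measurable sphere_measure"
      using borel_measurable_continuous_onI[OF cdiv[OF \<open>Ck 1 ?Z\<close>]] by simp
    have "continuous_on UNIV (\<lambda>p. f p * sphere_div Y p + g p \<bullet> Y p)"
      by (intro continuous_intros cf cY cdiv[OF Y])
    from borel_measurable_continuous_onI[OF this]
    show "(\<lambda>p. f p * sphere_div Y p + g p \<bullet> Y p) \<in> borel_measurable sphere_measure" by simp
    show "AE p in sphere_measure. sphere_div ?Z p = f p * sphere_div Y p + g p \<bullet> Y p"
      using AE_sphere by eventually_elim (simp add: sphere_div_scaleR[OF f(1) dY] tan)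
  qed
  also have "\<dots> = (\<integral>\<^sub>S p. f p * sphere_div Y p) + (\<integral>\<^sub>S p. g p \<bullet> Y p)"
    by (intro Bochner_Integration.integral_add continuous_integrable continuous_intros cf cY
        Ck_1_sphere_div_continuous[OF Y])
  finally show ?thesis by simp
qed

lemma sphere_laplacian_weak_gradient:
  assumes f: "sphere_laplacian f X \<phi>" shows "weak_gradient (cracked_sphere a) f X"
  unfolding weak_gradient_def
proof (intro conjI allI impI ballI)
  have sX: "smooth_field X" "tangential X" and sf: "smooth f" using sphere_laplacian_smooth[OF f] by auto
  show "L2 (cracked_sphere a) X" by (intro square_integrable_L2 square_integrable_smooth_field sX)
  show "X p \<bullet> p = 0" if "p \<in> cracked_sphere a" for p
    using sX(2) that by (simp add: tangential_def cracked_sphere_iff)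
  fix Y assume Y: "test_field (cracked_sphere a) Y"
  have tan: "\<And>p. p \<in> sphere 0 1 \<Longrightarrow> Y p \<bullet> p = 0" by (rule test_fieldD(2)[OF Y])
  obtain g c where g: "has_grad f g" "\<And>p. X p = g p - c p *\<^sub>R p" using sphere_laplacian_properties[OF f] by blast
  obtain g' where g': "has_grad f g'" "smooth_field g'" using smooth_has_grad[OF sf] by blast
  have "g' p \<bullet> v = g p \<bullet> v" for p v
    using fun_cong[OF has_derivative_unique[of f _ p]] g(1) g'(1) unfolding has_grad_def by metis
  then have gg: "g' = g" using vector_eq_rdot by (intro ext) blast
  have sY: "square_integrable Y" "square_integrable (sphere_div Y)" by (rule test_field_square_integrable[OF Y])+
  note [measurable] = square_integrable_measurable[OF sY(1)] square_integrable_measurable[OF sY(2)]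
    square_integrable_measurable[OF square_integrable_smooth[OF sf]] square_integrable_measurable[OF square_integrable_smooth_field[OF sX(1)]]
    square_integrable_measurable[OF square_integrable_smooth_field[OF g'(2)]]
  have "(\<integral>p. f p * sphere_div Y p \<partial>area (cracked_sphere a)) = (\<integral>\<^sub>S p. f p * sphere_div Y p)"
    by (rule integral_zero_extension_cracked) measurable
  also have "\<dots> = - (\<integral>\<^sub>S p. g' p \<bullet> Y p)"
    by (rule divergence_product[OF g' sf test_fieldD(1)[OF Y] tan])
  also have "(\<integral>\<^sub>S p. g' p \<bullet> Y p) = (\<integral>\<^sub>S p. X p \<bullet> Y p)"
  proof (rule integral_cong_AE)
    show "AE p in sphere_measure. g' p \<bullet> Y p = X p \<bullet> Y p"
      using AE_sphere
    proof eventually_elim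
      case (elim p)
      then have "p \<bullet> Y p = 0" using tan[of p] by (simp add: inner_commute)
      then show ?case by (simp add: gg g(2) inner_diff_left)
    qed
  qed measurable
  also have "\<dots> = (\<integral>p. X p \<bullet> Y p \<partial>area (cracked_sphere a))"
    by (rule integral_zero_extension_cracked[symmetric]) measurable
  finally show "(\<integral>p. f p * sphere_div Y p \<partial>area (cracked_sphere a)) = - (\<integral>p. X p \<bullet> Y p \<partial>area (cracked_sphere a))" .
qed

lemma sphere_laplacian_H1: "sphere_laplacian f X \<phi> \<Longrightarrow> H1 (cracked_sphere a) f"
  unfolding H1_def
  by (intro conjI exI[where P = "weak_gradient (cracked_sphere a) f"])
    (rule square_integrable_L2[OF square_integrable_smooth[OF sphere_laplacian_smooth(1)]], assumption, rule sphere_laplacian_weak_gradient)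

text \<open>
  The Neumann condition: for an even polynomial Green's formula holds against every \<open>w\<close> in the Sobolev
  space of the cracked sphere, jumps across the crack included. It is \<open>weak_pair_even_pairing\<close> with
  trivial signs.
\<close>

lemma sphere_laplacian_dirichlet_form:
  assumes f: "sphere_laplacian f X \<phi>" and w: "H1 (cracked_sphere a) w"
  shows "dirichlet_form (cracked_sphere a) f w = - (\<integral>p. \<phi> p * w p \<partial>area (cracked_sphere a))"
proof -
  let ?\<Omega> = "cracked_sphere a"
  let ?w = "zero_extension ?\<Omega> w" and ?G = "zero_extension ?\<Omega> (grad ?\<Omega> w)"
  note wp = H1_weak_pair[OF w]
  have s: "square_integrable ?w" "square_integrable ?G" using wp by (auto simp: weak_pair_def)
  have fH: "H1 ?\<Omega> f" by (rule sphere_laplacian_H1[OF f])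
  have sX: "square_integrable X" by (rule square_integrable_smooth_field[OF sphere_laplacian_smooth(2)[OF f]])
  have sF: "square_integrable (zero_extension ?\<Omega> (grad ?\<Omega> f))" using H1_weak_pair[OF fH] by (simp add: weak_pair_def)
  have eq: "AE p in sphere_measure. grad ?\<Omega> f p = X p"
    by (rule weak_gradient_unique[OF _ grad_weak_gradient[OF fH] sphere_laplacian_weak_gradient[OF f]])
      (use fH in \<open>simp add: H1_def\<close>)
  have m\<phi>: "\<phi> \<in> borel_measurable borel"
    by (rule square_integrable_measurable[OF square_integrable_smooth[OF sphere_laplacian_value_smooth[OF f]]])
  note [measurable] = square_integrable_measurable[OF s(1)] square_integrable_measurable[OF s(2)] square_integrable_measurable[OF sX] square_integrable_measurable[OF sF] m\<phi>
  have "dirichlet_form ?\<Omega> f w = (\<integral>\<^sub>S p. zero_extension ?\<Omega> (grad ?\<Omega> f) p \<bullet> ?G p)"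
    unfolding dirichlet_form_def area_integral[OF cracked_sphere_borel]
    by (rule Bochner_Integration.integral_cong) (auto simp: zero_extension_def indicator_def)
  also have "\<dots> = (\<integral>\<^sub>S p. (quarter_sign 1 1 p *\<^sub>R ?G p) \<bullet> X p)"
  proof (rule integral_cong_AE)
    show "AE p in sphere_measure. zero_extension ?\<Omega> (grad ?\<Omega> f) p \<bullet> ?G p = (quarter_sign 1 1 p *\<^sub>R ?G p) \<bullet> X p"
      using eq AE_coord_nonzero[of 1] AE_coord_nonzero[of 2]
      by eventually_elim (simp add: quarter_sign_def side_weight_def zero_extension_def indicator_def inner_commute)
  qed measurable
  also have "\<dots> = - (\<integral>\<^sub>S p. (quarter_sign 1 1 p * ?w p) * \<phi> p)"
    by (rule weak_pair_even_pairing[OF wp cracked_sphere_off_planes _ _ f]) simp_all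
  also have "(\<integral>\<^sub>S p. (quarter_sign 1 1 p * ?w p) * \<phi> p) = (\<integral>\<^sub>S p. zero_extension ?\<Omega> (\<lambda>p. \<phi> p * w p) p)"
  proof (rule integral_cong_AE)
    have "zero_extension ?\<Omega> (\<lambda>p. \<phi> p * w p) = (\<lambda>p. \<phi> p * ?w p)" by (auto simp: zero_extension_def indicator_def)
    then show "zero_extension ?\<Omega> (\<lambda>p. \<phi> p * w p) \<in> borel_measurable sphere_measure" by simp
    show "AE p in sphere_measure. (quarter_sign 1 1 p * ?w p) * \<phi> p = zero_extension ?\<Omega> (\<lambda>p. \<phi> p * w p) p"
      using AE_coord_nonzero[of 1] AE_coord_nonzero[of 2]
      by eventually_elim (simp add: quarter_sign_def side_weight_def zero_extension_def indicator_def)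
  qed measurable
  finally show ?thesis unfolding area_integral[OF cracked_sphere_borel] .
qed

lemma harmonic_eigenfunction:
  assumes h: "harmonic l h X" and nz: "\<not> (AE p in sphere_measure. h p = 0)"
  shows "eigenfunction (cracked_sphere a) (real (l * (l + 1))) h"
proof -
  let ?\<mu> = "real (l * (l + 1))"
  have f: "sphere_laplacian h X (\<lambda>p. - ?\<mu> * h p)" using h by (simp only: harmonic_def)
  have "dirichlet_form (cracked_sphere a) h w = (\<integral>p. (?\<mu> * h p) * w p \<partial>area (cracked_sphere a))"
    if "H1 (cracked_sphere a) w" for w
    unfolding sphere_laplacian_dirichlet_form[OF f that] mult_minus_left integral_minus minus_minus ..
  moreover have "L2 (cracked_sphere a) (\<lambda>p. ?\<mu> * h p)"
    using sphere_laplacian_smooth(1)[OF f] by (intro square_integrable_L2 square_integrable_cmult square_integrable_smooth)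
  ultimately show ?thesis
    using sphere_laplacian_H1[OF f] nz unfolding eigenfunction_def neumann_laplacian_def AE_area_iff by blast
qed

lemma eigenfunction_one: "eigenfunction (cracked_sphere a) 0 (\<lambda>p. 1)"
proof -
  have "\<not> (AE p in sphere_measure. (1::real) = 0)"
    using not_AE_coord_zero[of 3] by (auto elim!: contrapos_nn)
  then show ?thesis using harmonic_eigenfunction[OF harmonic_const] by simp
qed

lemma eigenfunction_z: "eigenfunction (cracked_sphere a) 2 (\<lambda>p. p $ 3)"
  using harmonic_eigenfunction[OF harmonic_z not_AE_coord_zero] by simp

section \<open>The position of the eigenvalue two and the nodal domains\<close>

lemma homogeneous_system_solution:
  fixes L :: "3 \<Rightarrow> nat \<Rightarrow> real"
  obtains c :: "nat \<Rightarrow> real" where "\<exists>i<4. c i \<noteq> 0" "\<And>j. (\<Sum>i<4. c i * L j i) = 0"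
proof -
  define idx :: "4 \<Rightarrow> nat" where "idx i = (if i = 1 then 0 else if i = 2 then 1 else if i = 3 then 2 else 3)" for i
  \<comment> \<open>a matrix with three rows and four columns has a kernel\<close>
  define A :: "real^4^3" where "A = (\<chi> j i. L j (idx i))"
  have "rank A \<le> 3" using rank_bound[of A] by simp
  then have "\<not> inj ((*v) A)" using full_rank_injective[of A] by auto
  then obtain x y where xy: "A *v x = A *v y" "x \<noteq> y" by (auto simp: inj_def)
  define d where "d = x - y"
  have d: "A *v d = 0" "d \<noteq> 0" using xy by (auto simp: d_def matrix_vector_mult_diff_distrib)
  define c :: "nat \<Rightarrow> real" where
    "c i = (if i = 0 then d $ 1 else if i = 1 then d $ 2 else if i = 2 then d $ 3 else d $ 4)" for i
  have idx: "idx 1 = 0" "idx 2 = 1" "idx 3 = 2" "idx 4 = 3" by (simp_all add: idx_def)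
  have c: "c 0 = d $ 1" "c 1 = d $ 2" "c 2 = d $ 3" "c 3 = d $ 4" by (simp_all add: c_def)
  have s4: "(\<Sum>i<4. f i) = f 0 + f 1 + f 2 + f 3" for f :: "nat \<Rightarrow> real"
    by (simp add: eval_nat_numeral)
  have "(\<Sum>i<4. c i * L j i) = 0" for j
  proof -
    have "(A *v d) $ j = (\<Sum>i\<in>UNIV. L j (idx i) * d $ i)"
      by (simp add: matrix_vector_mult_def A_def)
    then have "(\<Sum>i\<in>UNIV. L j (idx i) * d $ i) = 0" by (simp add: d(1))
    then have "L j (idx 1) * d $ 1 + L j (idx 2) * d $ 2 + L j (idx 3) * d $ 3 + L j (idx 4) * d $ 4 = 0"
      by (simp only: sum_4)
    then show ?thesis unfolding s4 c idx by (simp only: mult.commute)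
  qed
  moreover have "\<exists>i<4. c i \<noteq> 0"
  proof (rule ccontr)
    assume "\<not> (\<exists>i<4. c i \<noteq> 0)"
    then have "c 0 = 0" "c 1 = 0" "c 2 = 0" "c 3 = 0" by simp_all
    then have "d = 0" unfolding c by (simp add: vec_eq_iff forall_4)
    then show False using d(2) by contradiction
  qed
  ultimately show thesis using that by blast
qed

lemma square_integral_combination:
  fixes f :: "nat \<Rightarrow> real^3 \<Rightarrow> 'b::euclidean_space"
  assumes "\<And>i. i < n \<Longrightarrow> square_integrable (f i)"
  shows "(\<integral>\<^sub>S p. (norm (\<Sum>i<n. c i *\<^sub>R f i p))\<^sup>2) =
    (\<Sum>i<n. \<Sum>j<n. c i * c j * (\<integral>\<^sub>S p. f i p \<bullet> f j p))"
proof -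
  have A: "(norm (\<Sum>i<n. c i *\<^sub>R f i p))\<^sup>2 = (\<Sum>i<n. \<Sum>j<n. c i * c j * (f i p \<bullet> f j p))" for p
    by (simp add: power2_norm_eq_inner inner_sum_left inner_sum_right sum_distrib_left mult.assoc)
      (intro sum.cong refl, simp add: inner_commute)
  have i: "integrable sphere_measure (\<lambda>p. c i * c j * (f i p \<bullet> f j p))"
    if "i \<in> {..<n}" "j \<in> {..<n}" for i j
    using square_integrable_inner[OF assms assms, of i j] that by simp
  have B: "(\<integral>\<^sub>S p. (\<Sum>i<n. \<Sum>j<n. c i * c j * (f i p \<bullet> f j p))) =
      (\<Sum>i<n. \<integral>\<^sub>S p. (\<Sum>j<n. c i * c j * (f i p \<bullet> f j p)))"
    by (intro Bochner_Integration.integral_sum Bochner_Integration.integrable_sum i)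
  have C: "(\<integral>\<^sub>S p. (\<Sum>j<n. c i * c j * (f i p \<bullet> f j p))) =
      (\<Sum>j<n. c i * c j * (\<integral>\<^sub>S p. f i p \<bullet> f j p))" if "i \<in> {..<n}" for i
  proof -
    have "(\<integral>\<^sub>S p. (\<Sum>j<n. c i * c j * (f i p \<bullet> f j p))) =
        (\<Sum>j<n. \<integral>\<^sub>S p. c i * c j * (f i p \<bullet> f j p))"
      by (intro Bochner_Integration.integral_sum i that)
    then show ?thesis by simp
  qed
  show ?thesis unfolding A B by (rule sum.cong[OF refl C])
qed

text \<open>
  The weak eigenvalue equation, written with extensions by zero.
\<close>

lemma eigenfunction_form:
  assumes u: "eigenfunction (cracked_sphere a) \<mu> u" and v: "H1 (cracked_sphere a) v"
  shows "(\<integral>\<^sub>S p. zero_extension (cracked_sphere a) (grad (cracked_sphere a) u) p \<bullet>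
      zero_extension (cracked_sphere a) (grad (cracked_sphere a) v) p) =
    \<mu> * (\<integral>\<^sub>S p. zero_extension (cracked_sphere a) u p * zero_extension (cracked_sphere a) v p)"
proof -
  let ?\<Omega> = "cracked_sphere a"
  have "dirichlet_form ?\<Omega> u v = (\<integral>p. (\<mu> * u p) * v p \<partial>area ?\<Omega>)"
    using u v by (simp add: eigenfunction_def neumann_laplacian_def)
  moreover have "zero_extension ?\<Omega> (\<lambda>p. grad ?\<Omega> u p \<bullet> grad ?\<Omega> v p) =
      (\<lambda>p. zero_extension ?\<Omega> (grad ?\<Omega> u) p \<bullet> zero_extension ?\<Omega> (grad ?\<Omega> v) p)"
    by (auto simp: zero_extension_def indicator_def)
  moreover have "zero_extension ?\<Omega> (\<lambda>p. (\<mu> * u p) * v p) = (\<lambda>p. \<mu> * (zero_extension ?\<Omega> u p * zero_extension ?\<Omega> v p))"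
    by (auto simp: zero_extension_def indicator_def)
  ultimately show ?thesis
    unfolding dirichlet_form_def area_integral[OF cracked_sphere_borel] by simp
qed

lemma eigenfunction_H1: "eigenfunction \<Omega> \<mu> u \<Longrightarrow> H1 \<Omega> u"
  by (simp add: eigenfunction_def neumann_laplacian_def)

lemma eigenfunction_square_integrable: "eigenfunction (cracked_sphere a) \<mu> u \<Longrightarrow> square_integrable (zero_extension (cracked_sphere a) u)"
  using H1_weak_pair[OF eigenfunction_H1] by (simp add: weak_pair_def)

lemma eigenfunctions_orthogonal:
  assumes u: "eigenfunction (cracked_sphere a) \<mu> u" and v: "eigenfunction (cracked_sphere a) \<nu> v" and "\<mu> \<noteq> \<nu>"
  shows "(\<integral>\<^sub>S p. zero_extension (cracked_sphere a) u p * zero_extension (cracked_sphere a) v p) = 0"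
proof -
  have "\<mu> * (\<integral>\<^sub>S p. zero_extension (cracked_sphere a) u p * zero_extension (cracked_sphere a) v p)
    = \<nu> * (\<integral>\<^sub>S p. zero_extension (cracked_sphere a) u p * zero_extension (cracked_sphere a) v p)"
    using eigenfunction_form[OF u eigenfunction_H1[OF v]] eigenfunction_form[OF v eigenfunction_H1[OF u]]
    by (simp add: inner_commute mult.commute)
  then show ?thesis using \<open>\<mu> \<noteq> \<nu>\<close> by simp
qed

lemma independent_ae_zero_extension:
  assumes ind: "independent_ae (cracked_sphere a) n u"
    and z: "AE p in sphere_measure. (\<Sum>i<n. c i * zero_extension (cracked_sphere a) (u i) p) = 0" and "i < n"
  shows "c i = (0::real)"
proof -
  have "AE p in sphere_measure. (\<Sum>i<n. c i * u i p) = 0"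
    using z AE_cracked_sphere[of a] by eventually_elim (simp add: zero_extension_def)
  then show ?thesis
    using ind \<open>i < n\<close> unfolding independent_ae_def AE_area_iff by blast
qed

text \<open>
  Four independent eigenfunctions have a nontrivial combination \<open>w\<close> that satisfies the three linear
  conditions of \<open>spectral_gap\<close>, so \<open>2 \<integral> w\<^sup>2 - E \<le> 0\<close> for its energy \<open>E\<close>. If all eigenvalues \<open>\<nu> i\<close> are
  below \<open>2\<close>, the left hand side is the square norm of \<open>\<Sum>i. c i * sqrt (2 - \<nu> i) * u i\<close>: terms with
  different eigenvalues are orthogonal, and for equal eigenvalues the product of the two roots is
  \<open>2 - \<nu> i\<close>. So that combination vanishes, against independence.
\<close>

theorem few_small_eigenvalues:
  assumes a: "small_cap a"
    and u: "\<And>i. i < n \<Longrightarrow> \<nu> i < 2 \<and> eigenfunction (cracked_sphere a) (\<nu> i) (u i)"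
    and ind: "independent_ae (cracked_sphere a) n u"
  shows "n \<le> 3"
proof (rule ccontr)
  assume "\<not> n \<le> 3"
  then have n: "4 \<le> n" by simp
  let ?\<Omega> = "cracked_sphere a"
  let ?u = "\<lambda>i. zero_extension ?\<Omega> (u i)" and ?G = "\<lambda>i. zero_extension ?\<Omega> (grad ?\<Omega> (u i))"
  have u4: "\<nu> i < 2" "eigenfunction ?\<Omega> (\<nu> i) (u i)" if "i < 4" for i
    using u[of i] that n by auto
  \<comment> \<open>the three weights of \<open>spectral_gap\<close>\<close>
  define q :: "3 \<Rightarrow> real^3 \<Rightarrow> real" where
    "q j = (if j = 1 then quarter_sign 1 1 else if j = 2 then quarter_sign (-1) 1 else quarter_sign 1 (-1))" for j
  obtain c :: "nat \<Rightarrow> real" where c: "\<exists>i<4. c i \<noteq> 0"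
    "\<And>j. (\<Sum>i<4. c i * (\<integral>\<^sub>S p. q j p * ?u i p)) = 0"
    using homogeneous_system_solution[of "\<lambda>j i. \<integral>\<^sub>S p. q j p * ?u i p"] by metis
  have su: "square_integrable (?u i)" if "i < 4" for i by (rule eigenfunction_square_integrable[OF u4(2)[OF that]])
  have wp: "weak_pair ?\<Omega> (?u i) (?G i)" if "i < 4" for i
    by (rule H1_weak_pair[OF eigenfunction_H1[OF u4(2)[OF that]]])
  then have sG: "square_integrable (?G i)" if "i < 4" for i using that by (simp add: weak_pair_def)
  let ?w = "\<lambda>p. \<Sum>i<4. c i * ?u i p" and ?H = "\<lambda>p. \<Sum>i<4. c i *\<^sub>R ?G i p"
  have wpw: "weak_pair ?\<Omega> ?w ?H"
    by (intro weak_pair_sum weak_pair_cmult wp) simp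
  have mean: "(\<integral>\<^sub>S p. q j p * ?w p) = 0" for j
  proof -
    have "integrable sphere_measure (\<lambda>p. q j p * ?u i p)" if "i < 4" for i
      using square_integrable_imp_integrable[OF quarter_sign_square_integrable(1)[OF su[OF that]]] by (auto simp: q_def)
    then have "(\<integral>\<^sub>S p. (\<Sum>i<4. c i * (q j p * ?u i p))) =
        (\<Sum>i<4. c i * (\<integral>\<^sub>S p. q j p * ?u i p))"
      by (subst Bochner_Integration.integral_sum) auto
    moreover have "q j p * ?w p = (\<Sum>i<4. c i * (q j p * ?u i p))" for p
      unfolding sum_distrib_left by (simp only: mult.left_commute)
    ultimately show ?thesis using c(2)[of j] by (simp only:)
  qed
  have gap: "2 * (\<integral>\<^sub>S p. (?w p)\<^sup>2) \<le> (\<integral>\<^sub>S p. (norm (?H p))\<^sup>2)"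
    using spectral_gap[OF wpw a] mean[of 1] mean[of 2] mean[of 3] by (simp add: q_def)
  define P where "P i j = (\<integral>\<^sub>S p. ?u i p * ?u j p)" for i j
  have W2: "(\<integral>\<^sub>S p. (?w p)\<^sup>2) = (\<Sum>i<4. \<Sum>j<4. c i * c j * P i j)"
    using square_integral_combination[of 4 ?u c, OF su] by (simp add: P_def)
  have H2: "(\<integral>\<^sub>S p. (norm (?H p))\<^sup>2) = (\<Sum>i<4. \<Sum>j<4. c i * c j * (\<nu> i * P i j))"
  proof -
    have "(\<integral>\<^sub>S p. (norm (?H p))\<^sup>2) = (\<Sum>i<4. \<Sum>j<4. c i * c j * (\<integral>\<^sub>S p. ?G i p \<bullet> ?G j p))"
      by (rule square_integral_combination) (rule sG)
    also have "\<dots> = (\<Sum>i<4. \<Sum>j<4. c i * c j * (\<nu> i * P i j))"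
      using eigenfunction_form[OF u4(2) eigenfunction_H1[OF u4(2)]] unfolding P_def
      by (intro sum.cong refl) simp
    finally show ?thesis .
  qed
  \<comment> \<open>the combination whose square norm is \<open>2 \<integral> w\<^sup>2 - E\<close>\<close>
  let ?s = "\<lambda>i. sqrt (2 - \<nu> i)"
  let ?y = "\<lambda>p. \<Sum>i<4. (c i * ?s i) * ?u i p"
  have "(\<integral>\<^sub>S p. (?y p)\<^sup>2) = (\<Sum>i<4. \<Sum>j<4. (c i * ?s i) * (c j * ?s j) * P i j)"
    using square_integral_combination[of 4 ?u "\<lambda>i. c i * ?s i", OF su] by (simp add: P_def)
  also have "\<dots> = (\<Sum>i<4. \<Sum>j<4. 2 * (c i * c j * P i j) - c i * c j * (\<nu> i * P i j))"
  proof (intro sum.cong refl)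
    fix i j :: nat assume ij: "i \<in> {..<4}" "j \<in> {..<4}"
    show "(c i * ?s i) * (c j * ?s j) * P i j = 2 * (c i * c j * P i j) - c i * c j * (\<nu> i * P i j)"
    proof (cases "\<nu> i = \<nu> j")
      case True
      have "?s i * ?s i = 2 - \<nu> i" using u4(1)[of i] ij by simp
      have "(c i * ?s i) * (c j * ?s j) * P i j = c i * c j * P i j * (?s i * ?s i)"
        using True by (simp add: mult_ac)
      also have "\<dots> = 2 * (c i * c j * P i j) - c i * c j * (\<nu> i * P i j)"
        unfolding \<open>?s i * ?s i = 2 - \<nu> i\<close> by (simp add: algebra_simps)
      finally show ?thesis .
    next
      case False
      then have "P i j = 0"
        unfolding P_def using u4(2) ij by (intro eigenfunctions_orthogonal[of a "\<nu> i" _ "\<nu> j"]) auto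
      then show ?thesis by simp
    qed
  qed
  also have "\<dots> = 2 * (\<integral>\<^sub>S p. (?w p)\<^sup>2) - (\<integral>\<^sub>S p. (norm (?H p))\<^sup>2)"
    unfolding W2 H2 by (simp add: sum_subtractf sum_distrib_left)
  finally have "(\<integral>\<^sub>S p. (?y p)\<^sup>2) \<le> 0" using gap by linarith
  moreover have "(\<integral>\<^sub>S p. (?y p)\<^sup>2) \<ge> 0" by simp
  ultimately have y0: "(\<integral>\<^sub>S p. (norm (?y p))\<^sup>2) = 0" by simp
  have sy: "square_integrable ?y" using su by (intro square_integrable_sum square_integrable_cmult) simp
  from integral_square_zero[OF sy y0] have AE0: "AE p in sphere_measure. ?y p = 0" .
  \<comment> \<open>padded by zeros, since the family may have more than four members\<close>
  define d where "d i = (if i < 4 then c i * ?s i else 0)" for i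
  have d4: "d i = c i * ?s i" if "i < 4" for i using that by (simp only: d_def if_True)
  have "(\<Sum>i<n. d i * ?u i p) = ?y p" for p
  proof -
    have "(\<Sum>i<n. d i * ?u i p) = (\<Sum>i<4. d i * ?u i p)"
    proof (rule sum.mono_neutral_right)
      show "\<forall>i\<in>{..<n} - {..<4}. d i * ?u i p = 0" by (simp add: d_def)
    qed (use n in simp_all)
    also have "\<dots> = ?y p" by (rule sum.cong[OF refl]) (simp only: lessThan_iff d4)
    finally show ?thesis .
  qed
  then have AEd: "AE p in sphere_measure. (\<Sum>i<n. d i * ?u i p) = 0" using AE0 by (simp only:)
  have dz: "d i = 0" if "i < n" for i by (rule independent_ae_zero_extension[OF ind AEd that])
  have "c i = 0" if "i < 4" for i
  proof -
    have "i < n" using that n by linarith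
    from dz[OF this] have "c i * ?s i = 0" by (simp only: d4[OF that])
    moreover have "?s i > 0" using u4(1)[OF that] by simp
    ultimately show ?thesis by simp
  qed
  then show False using c(1) by blast
qed

text \<open>
  The sizes over which the eigenvalue count takes a supremum.
\<close>

definition eigen_families :: "(real^3) set \<Rightarrow> real set \<Rightarrow> nat set" where
  "eigen_families \<Omega> S =
    {n. \<exists>u \<nu>. (\<forall>i<n. \<nu> i \<in> S \<and> eigenfunction \<Omega> (\<nu> i) (u i)) \<and> independent_ae \<Omega> n u}"

lemma eigenvalue_count_eq: "eigenvalue_count \<Omega> S = (SUP n \<in> eigen_families \<Omega> S. enat n)"
  by (simp add: eigenvalue_count_def eigen_families_def)

lemma eigenvalue_count_mono: "S \<subseteq> T \<Longrightarrow> eigenvalue_count \<Omega> S \<le> eigenvalue_count \<Omega> T"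
  unfolding eigenvalue_count_eq eigen_families_def by (rule SUP_subset_mono) blast+

text \<open>
  Let \<open>n \<le> 3\<close> be the number of eigenvalues below \<open>2\<close>. The function \<open>z\<close> is orthogonal to all
  eigenfunctions below \<open>2\<close>, so it can be added to an independent family of \<open>n\<close> of them. Hence \<open>2\<close>
  occupies the position \<open>n + 1\<close>.
\<close>

lemma eigenvalue_two_position:
  assumes a: "small_cap a"
  obtains m where "1 \<le> m" "m \<le> 4" "nth_eigenvalue (cracked_sphere a) m = 2"
proof -
  let ?\<Omega> = "cracked_sphere a"
  let ?S = "eigen_families ?\<Omega> {..<2}"
  have bound: "n \<le> 3" if n: "n \<in> ?S" for n
  proof -
    obtain u \<nu> where "\<forall>i<n. \<nu> i \<in> {..<2} \<and> eigenfunction ?\<Omega> (\<nu> i) (u i)" "independent_ae ?\<Omega> n u"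
      using n unfolding eigen_families_def by blast
    then show ?thesis by (intro few_small_eigenvalues[OF a]) auto
  qed
  have fin: "finite ?S" by (rule finite_subset[of _ "{..3}"]) (use bound in auto)
  have "0 \<in> ?S" by (simp add: eigen_families_def independent_ae_def)
  define n where "n = Max ?S"
  have nS: "n \<in> ?S" unfolding n_def using fin \<open>0 \<in> ?S\<close> by (intro Max_in) auto
  have below: "eigenvalue_count ?\<Omega> {..<2} = enat n"
    unfolding eigenvalue_count_eq
    by (rule antisym, rule SUP_least, simp add: n_def fin, rule SUP_upper[OF nS])
  obtain u \<nu> where u: "\<And>i. i < n \<Longrightarrow> \<nu> i < 2" "\<And>i. i < n \<Longrightarrow> eigenfunction ?\<Omega> (\<nu> i) (u i)"
    and ind: "independent_ae ?\<Omega> n u"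
    using nS unfolding eigen_families_def by auto
  have above: "enat (Suc n) \<le> eigenvalue_count ?\<Omega> {..2}"
  proof -
    let ?v = "u(n := (\<lambda>p. p $ 3))" and ?\<mu> = "\<nu>(n := 2)"
    have ev: "\<forall>i<Suc n. ?\<mu> i \<in> {..2} \<and> eigenfunction ?\<Omega> (?\<mu> i) (?v i)"
      using u eigenfunction_z by (auto simp: less_Suc_eq intro: less_imp_le)
    have "independent_ae ?\<Omega> (Suc n) ?v"
      unfolding independent_ae_def AE_area_iff
    proof (intro allI impI)
      fix c :: "nat \<Rightarrow> real" and i
      assume z: "AE p in sphere_measure. (\<Sum>i<Suc n. c i * ?v i p) = 0" and i: "i < Suc n"
      let ?e = "zero_extension ?\<Omega>"
      let ?z = "?e (\<lambda>p. p $ 3)"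
      have z': "AE p in sphere_measure. (\<Sum>i<n. c i * ?e (u i) p) + c n * ?z p = 0"
        using z AE_cracked_sphere[of a] by eventually_elim (simp add: zero_extension_def)
      have sz: "square_integrable ?z" by (rule eigenfunction_square_integrable[OF eigenfunction_z])
      have su: "square_integrable (?e (u i))" if "i < n" for i by (rule eigenfunction_square_integrable[OF u(2)[OF that]])
      \<comment> \<open>integrate the vanishing combination against \<open>z\<close>: only the term of \<open>z\<close> survives\<close>
      have "0 = (\<integral>\<^sub>S p. ((\<Sum>i<n. c i * ?e (u i) p) + c n * ?z p) * ?z p)"
      proof -
        have "(\<integral>\<^sub>S p. ((\<Sum>i<n. c i * ?e (u i) p) + c n * ?z p) * ?z p) = (\<integral>\<^sub>S p. 0)"
        proof (rule integral_cong_AE)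
          have "square_integrable (\<lambda>p. (\<Sum>i<n. c i * ?e (u i) p) + c n * ?z p)"
            using su by (intro square_integrable_add square_integrable_sum square_integrable_cmult sz) simp
          from borel_measurable_integrable[OF square_integrable_mult[OF this sz]]
          show "(\<lambda>p. ((\<Sum>i<n. c i * ?e (u i) p) + c n * ?z p) * ?z p) \<in> borel_measurable sphere_measure" .
          show "AE p in sphere_measure. ((\<Sum>i<n. c i * ?e (u i) p) + c n * ?z p) * ?z p = 0"
            using z' by eventually_elim simp
        qed simp
        then show ?thesis by simp
      qed
      also have "\<dots> = (\<integral>\<^sub>S p. (\<Sum>i<n. c i * (?e (u i) p * ?z p)) + c n * (?z p)\<^sup>2)"
        by (simp add: distrib_right sum_distrib_right mult.assoc power2_eq_square)
      also have "\<dots> = (\<Sum>i<n. c i * (\<integral>\<^sub>S p. ?e (u i) p * ?z p)) + c n * (\<integral>\<^sub>S p. (?z p)\<^sup>2)"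
      proof -
        have "integrable sphere_measure (\<lambda>p. c i * (?e (u i) p * ?z p))" if "i < n" for i
          using square_integrable_mult[OF su[OF that] sz] by simp
        moreover have "integrable sphere_measure (\<lambda>p. c n * (?z p)\<^sup>2)" using square_integrable_integrable[OF sz] by simp
        ultimately show ?thesis
          by (subst Bochner_Integration.integral_add)
            (auto simp: Bochner_Integration.integral_sum intro!: Bochner_Integration.integrable_sum)
      qed
      also have "(\<Sum>i<n. c i * (\<integral>\<^sub>S p. ?e (u i) p * ?z p)) = 0"
      proof (rule sum.neutral, rule ballI)
        fix i assume "i \<in> {..<n}"
        then have "i < n" by simp
        from eigenfunctions_orthogonal[OF u(2)[OF this] eigenfunction_z] u(1)[OF this]
        show "c i * (\<integral>\<^sub>S p. ?e (u i) p * ?z p) = 0" by simp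
      qed
      finally have "c n * (\<integral>\<^sub>S p. (?z p)\<^sup>2) = 0" by simp
      moreover have "(\<integral>\<^sub>S p. (?z p)\<^sup>2) \<noteq> 0"
      proof
        assume "(\<integral>\<^sub>S p. (?z p)\<^sup>2) = 0"
        then have "AE p in sphere_measure. ?z p = 0" using integral_square_zero[OF sz] by simp
        then have "AE p in sphere_measure. p $ 3 = 0"
          using AE_cracked_sphere[of a] by eventually_elim (simp add: zero_extension_def)
        then show False using not_AE_coord_zero by blast
      qed
      ultimately have cn: "c n = 0" by simp
      show "c i = 0"
      proof (cases "i = n")
        case False
        then have "i < n" using i by simp
        moreover have "AE p in sphere_measure. (\<Sum>i<n. c i * ?e (u i) p) = 0" using z' cn by simp
        ultimately show ?thesis by (intro independent_ae_zero_extension[OF ind])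
      qed (simp add: cn)
    qed
    with ev have "Suc n \<in> eigen_families ?\<Omega> {..2}" unfolding eigen_families_def by blast
    then show ?thesis unfolding eigenvalue_count_eq by (rule SUP_upper)
  qed
  have "nth_eigenvalue ?\<Omega> (Suc n) = 2"
    unfolding nth_eigenvalue_def
  proof (rule the_equality)
    show "eigenvalue_count ?\<Omega> {..<2} < enat (Suc n) \<and> enat (Suc n) \<le> eigenvalue_count ?\<Omega> {..2}"
      using below above by simp
    fix \<mu> assume \<mu>: "eigenvalue_count ?\<Omega> {..<\<mu>} < enat (Suc n) \<and> enat (Suc n) \<le> eigenvalue_count ?\<Omega> {..\<mu>}"
    show "\<mu> = 2"
    proof (rule ccontr)
      assume "\<mu> \<noteq> 2"
      then consider "\<mu> < 2" | "2 < \<mu>" by linarith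
      then show False
      proof cases
        case 1
        then have "eigenvalue_count ?\<Omega> {..\<mu>} \<le> eigenvalue_count ?\<Omega> {..<2}" by (intro eigenvalue_count_mono) auto
        with \<mu> have "enat (Suc n) \<le> enat n" unfolding below by (blast intro: order_trans)
        then show False by simp
      next
        case 2
        then have "eigenvalue_count ?\<Omega> {..2} \<le> eigenvalue_count ?\<Omega> {..<\<mu>}" by (intro eigenvalue_count_mono) auto
        with above \<mu> have "enat (Suc n) < enat (Suc n)" by (meson order_trans le_less_trans)
        then show False by simp
      qed
    qed
  qed
  then show thesis using that[of "Suc n"] bound[OF nS] by simp
qed

text \<open>
  A connected set that avoids the level \<open>h = 1 - a / 2\<close> stays on one side of it. Above the level the
  cracked sphere has no point with \<open>x y = 0\<close>, since \<open>h > 1 - a\<close>, so there a connected set also keeps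
  the signs of \<open>x\<close> and \<open>y\<close>. One point in each of the four sectors and the south pole therefore lie in
  five different components.
\<close>

lemma five_nodal_domains:
  assumes a: "0 < a" "a < 1"
  shows "enat 5 \<le> beta0 (cracked_sphere a) (\<lambda>p. p $ 3 - (1 - a / 2))"
proof -
  let ?\<Omega> = "cracked_sphere a"
  let ?h = "1 - a / 2"
  let ?W = "{p \<in> ?\<Omega>. p $ 3 \<noteq> ?h}"
  \<comment> \<open>the level set is closed, so taking the closure adds no point of the cracked sphere\<close>
  have W: "?\<Omega> - nodal_set ?\<Omega> (\<lambda>p. p $ 3 - ?h) = ?W"
  proof -
    have "closed {p::real^3. p $ 3 = ?h}" by (intro closed_Collect_eq continuous_intros)
    then have "closure {p \<in> ?\<Omega>. p $ 3 - ?h = 0} \<subseteq> {p. p $ 3 = ?h}"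
      by (intro closure_minimal) auto
    moreover have "{p \<in> ?\<Omega>. p $ 3 - ?h = 0} \<subseteq> closure {p \<in> ?\<Omega>. p $ 3 - ?h = 0}" by (rule closure_subset)
    ultimately show ?thesis unfolding nodal_set_def by auto
  qed
  \<comment> \<open>a height between the level and the pole, with points at that height on the diagonals of the four sectors\<close>
  define t where "t = 1 - a / 4"
  define s where "s = sqrt ((1 - t\<^sup>2) / 2)"
  have t: "0 < t" "t < 1" "?h < t" using a by (auto simp: t_def)
  then have "t\<^sup>2 < 1" by (simp add: abs_square_less_1)
  then have s: "s > 0" "s\<^sup>2 = (1 - t\<^sup>2) / 2" by (simp_all add: s_def)
  define pt where "pt e d = (vector [e * s, d * s, t] :: real^3)" for e d :: real
  define south where "south = (vector [0, 0, -1] :: real^3)"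
  have pt_nth: "pt e d $ 1 = e * s" "pt e d $ 2 = d * s" "pt e d $ 3 = t" for e d
    by (simp_all add: pt_def)
  have south_nth: "south $ 1 = 0" "south $ 2 = 0" "south $ 3 = -1"
    by (simp_all add: south_def)
  have ptW: "pt e d \<in> ?W" if "e * e = 1" "d * d = 1" for e d
  proof -
    have "pt e d \<bullet> pt e d = (e * e) * s\<^sup>2 + (d * d) * s\<^sup>2 + t\<^sup>2"
      by (simp add: inner_vec_def sum_3 pt_nth power2_eq_square mult_ac)
    also have "\<dots> = 1" unfolding that s(2) by simp
    finally have "norm (pt e d) = 1" by (simp add: norm_eq_1)
    moreover have "e \<noteq> 0" "d \<noteq> 0" using that by auto
    ultimately show ?thesis using s t by (simp add: cracked_sphere_iff pt_nth)
  qed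
  have southW: "south \<in> ?W"
  proof -
    have "south \<bullet> south = 1" by (simp add: inner_vec_def sum_3 south_nth)
    then have "norm south = 1" by (simp add: norm_eq_1)
    then show ?thesis using a by (simp add: cracked_sphere_iff south_nth)
  qed
  have upper: "r $ 3 > ?h" if C: "connected C" "C \<subseteq> ?W" "p \<in> C" "p $ 3 > ?h" "r \<in> C" for C p r
  proof (rule ccontr)
    assume "\<not> r $ 3 > ?h"
    then have "\<exists>z\<in>C. z $ 3 = ?h"
      using C by (intro connected_ivt_component_cart[of C r p]) auto
    then show False using C(2) by blast
  qed
  \<comment> \<open>otherwise the coordinate would vanish somewhere above the level\<close>
  have same_sign: "p $ k > 0 \<longleftrightarrow> r $ k > 0"
    if C: "connected C" "C \<subseteq> ?W" "p \<in> C" "p $ 3 > ?h" "r \<in> C" and k: "k = 1 \<or> k = 2" for C p r k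
  proof (rule ccontr)
    assume ne: "\<not> (p $ k > 0 \<longleftrightarrow> r $ k > 0)"
    have "\<exists>z\<in>C. z $ k = 0"
    proof (cases "p $ k > 0")
      case True
      then show ?thesis using ne C by (intro connected_ivt_component_cart[of C r p]) auto
    next
      case False
      then show ?thesis using ne C by (intro connected_ivt_component_cart[of C p r]) auto
    qed
    then obtain z where z: "z \<in> C" "z $ k = 0" by blast
    have "z $ 3 > ?h" by (rule upper[OF C(1-4) z(1)])
    moreover have "z \<in> ?\<Omega>" using C(2) z(1) by blast
    ultimately show False using z(2) k a by (auto simp: cracked_sphere_iff)
  qed
  let ?C = "connected_component_set ?W"
  let ?P = "{pt 1 1, pt 1 (-1), pt (-1) 1, pt (-1) (-1), south}"
  have PW: "?P \<subseteq> ?W" by (intro insert_subsetI ptW southW empty_subsetI) simp_all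
  have sep: "p $ 1 > 0 \<longleftrightarrow> r $ 1 > 0" "p $ 2 > 0 \<longleftrightarrow> r $ 2 > 0" "r $ 3 > ?h"
    if "?C p = ?C r" "p \<in> ?W" "r \<in> ?W" "p $ 3 > ?h" for p r
  proof -
    have C: "connected (?C p)" "?C p \<subseteq> ?W" "p \<in> ?C p" "r \<in> ?C p"
    proof -
      show "connected (?C p)" by (rule connected_connected_component)
      show "?C p \<subseteq> ?W" by (rule connected_component_subset)
      show "p \<in> ?C p" unfolding mem_Collect_eq by (rule connected_component_refl[OF that(2)])
      show "r \<in> ?C p" unfolding that(1) mem_Collect_eq by (rule connected_component_refl[OF that(3)])
    qed
    show "p $ 1 > 0 \<longleftrightarrow> r $ 1 > 0" by (rule same_sign[OF C(1-3) that(4) C(4)]) simp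
    show "p $ 2 > 0 \<longleftrightarrow> r $ 2 > 0" by (rule same_sign[OF C(1-3) that(4) C(4)]) simp
    show "r $ 3 > ?h" by (rule upper[OF C(1-3) that(4) C(4)])
  qed
  have ne: "?C (pt e d) \<noteq> ?C (pt e' d')"
    if "e * e = 1" "d * d = 1" "e' * e' = 1" "d' * d' = 1" "(e, d) \<noteq> (e', d')" for e d e' d'
  proof
    assume "?C (pt e d) = ?C (pt e' d')"
    from sep(1,2)[OF this ptW[OF that(1,2)] ptW[OF that(3,4)]] t(3)
    have "e * s > 0 \<longleftrightarrow> e' * s > 0" "d * s > 0 \<longleftrightarrow> d' * s > 0" by (simp_all add: pt_nth)
    then have "e > 0 \<longleftrightarrow> e' > 0" "d > 0 \<longleftrightarrow> d' > 0" using s(1) by (simp_all add: zero_less_mult_iff)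
    then show False using that by (auto simp: square_eq_1_iff)
  qed
  have neS: "?C (pt e d) \<noteq> ?C south" if "e * e = 1" "d * d = 1" for e d
  proof
    assume "?C (pt e d) = ?C south"
    from sep(3)[OF this ptW[OF that] southW] t(3) show False using a by (simp add: pt_nth south_nth)
  qed
  have card5: "card (?C ` ?P) = 5"
  proof -
    have "distinct [?C (pt 1 1), ?C (pt 1 (-1)), ?C (pt (-1) 1), ?C (pt (-1) (-1)), ?C south]"
      using ne[of 1 1 1 "-1"] ne[of 1 1 "-1" 1] ne[of 1 1 "-1" "-1"] ne[of 1 "-1" "-1" 1]
        ne[of 1 "-1" "-1" "-1"] ne[of "-1" 1 "-1" "-1"]
        neS[of 1 1] neS[of 1 "-1"] neS[of "-1" 1] neS[of "-1" "-1"] by simp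
    from distinct_card[OF this] show ?thesis by simp
  qed
  have sub: "?C ` ?P \<subseteq> components ?W" unfolding components_def using PW by blast
  show ?thesis
    unfolding beta0_def W Let_def
  proof (cases "finite (components ?W)")
    case True
    then have "5 \<le> card (components ?W)" using card_mono[OF True sub] card5 by simp
    then show "enat 5 \<le> (if finite (components ?W) then enat (card (components ?W)) else \<infinity>)" using True by simp
  qed simp
qed

lemma level_function_eigen_combination:
  "eigen_combination (cracked_sphere a) 2 (\<lambda>p. p $ 3 - h)"
  unfolding eigen_combination_def
proof (intro conjI)
  show "continuous_on (cracked_sphere a) (\<lambda>p. p $ 3 - h)" by (intro continuous_intros)
  let ?c = "\<lambda>i::nat. if i = 0 then 1 else - h"
  let ?u = "\<lambda>i::nat. if i = 0 then (\<lambda>p::real^3. p $ 3) else (\<lambda>p. 1)"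
  let ?\<nu> = "\<lambda>i::nat. if i = 0 then 2 else (0::real)"
  show "\<exists>n (c :: nat \<Rightarrow> real) u \<nu>. (\<forall>i<n. \<nu> i \<le> 2 \<and> eigenfunction (cracked_sphere a) (\<nu> i) (u i)) \<and>
      (\<forall>p\<in>cracked_sphere a. p $ 3 - h = (\<Sum>i<n. c i * u i p))"
  proof (rule exI[of _ "2::nat"], rule exI[of _ ?c], rule exI[of _ ?u], rule exI[of _ ?\<nu>], rule conjI)
    show "\<forall>i<2. ?\<nu> i \<le> 2 \<and> eigenfunction (cracked_sphere a) (?\<nu> i) (?u i)"
      using eigenfunction_z eigenfunction_one by simp
    show "\<forall>p\<in>cracked_sphere a. p $ 3 - h = (\<Sum>i<2. ?c i * ?u i p)"
      by (simp add: numeral_2_eq_2)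
  qed
qed

theorem proposition6p1:
  shows "\<exists>a0>0. \<forall>a. 0 < a \<and> a < a0 \<longrightarrow>
    \<not> extended_courant_property (cracked_sphere a) \<and>
    (\<exists>m\<ge>1. \<exists>v.
       eigen_combination (cracked_sphere a) (nth_eigenvalue (cracked_sphere a) m) v \<and>
       beta0 (cracked_sphere a) v
         > enat (kappa (cracked_sphere a) (nth_eigenvalue (cracked_sphere a) m)))"
proof -
  obtain a0 where a0: "a0 > 0" "a0 \<le> 1" "\<And>a. 0 < a \<and> a < a0 \<Longrightarrow> small_cap a"
    using small_cap_eventually by blast
  show ?thesis
  proof (intro exI[of _ a0] conjI a0(1) allI impI)
    fix a assume a: "0 < a \<and> a < a0"
    let ?\<Omega> = "cracked_sphere a"
    let ?v = "\<lambda>p::real^3. p $ 3 - (1 - a / 2)"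
    obtain m where m: "1 \<le> m" "m \<le> 4" "nth_eigenvalue ?\<Omega> m = 2"
      using eigenvalue_two_position[OF a0(3)[OF a]] by blast
    have v: "eigen_combination ?\<Omega> (nth_eigenvalue ?\<Omega> m) ?v"
      unfolding m(3) by (rule level_function_eigen_combination)
    have "kappa ?\<Omega> (nth_eigenvalue ?\<Omega> m) \<le> m"
      unfolding kappa_def by (rule Least_le) (use m in simp)
    then have "enat (kappa ?\<Omega> (nth_eigenvalue ?\<Omega> m)) < enat 5" using m(2) by simp
    also have "enat 5 \<le> beta0 ?\<Omega> ?v" using a a0(2) by (intro five_nodal_domains) auto
    finally have beta: "enat (kappa ?\<Omega> (nth_eigenvalue ?\<Omega> m)) < beta0 ?\<Omega> ?v" .
    show "\<exists>m\<ge>1. \<exists>v. eigen_combination ?\<Omega> (nth_eigenvalue ?\<Omega> m) v \<and>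
        beta0 ?\<Omega> v > enat (kappa ?\<Omega> (nth_eigenvalue ?\<Omega> m))"
      using m(1) v beta by blast
    show "\<not> extended_courant_property ?\<Omega>"
      unfolding extended_courant_property_def using m(1) v beta leD by blast
  qed
qed

end
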